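(* For $f\in\mathbb{N}^{\mathbb{N}}$, the following are equivalent: (i) $f$ is hyperlow; (ii) $f$ strongly relativizes $\Delta^1_1$ (i.e. at every space $\mathcal{X}$); (iii) $f$ strongly relativizes $\Delta^1_1$ at $\mathbb{N}$.
   Context: A "space" is a recursively presented Polish metric space: a complete separable metric space with a dense sequence $(r_i)$ for which the relations $d(r_i,r_j)\le m/(k+1)$ and $d(r_i,r_j)<m/(k+1)$ are computable. It comes with an effective enumeration $N_s(\mathcal{X})$, $s\in\mathbb{N}$, of basic neighborhoods (balls with centers $r_i$ and rational radii). Examples are $\mathbb{N}$, $2^{\mathbb{N}}$, $\mathbb{N}^{\mathbb{N}}$ and finite products. $P\subseteq\mathcal{X}$ is $\Sigma^0_1$ if $P=\bigcup_{s\in R}N_s(\mathcal{X})$ for some c.e. $R\subseteq\mathbb{N}$; $\Pi^0_1$ sets are complements of $\Sigma^0_1$ sets; $\Sigma^1_1$ sets are the projections along $\mathbb{N}^{\mathbb{N}}$ of $\Pi^0_1$ subsets of $\mathcal{X}\times\mathbb{N}^{\mathbb{N}}$; $\Pi^1_1$ sets are their complements; $\Delta^1_1=\Sigma^1_1\cap\Pi^1_1$. For $Q\subseteq\mathbb{N}^{\mathbb{N}}\times\mathcal{X}$ and $f\in\mathbb{N}^{\mathbb{N}}$, the $f$-section is $Q_f=\{x\in\mathcal{X}: Q(f,x)\}$. For $f\in\mathbb{N}^{\mathbb{N}}$, $\Sigma^1_1(f)$ (resp. $\Pi^1_1(f)$) consists of the $f$-sections of $\Sigma^1_1$ (resp.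 $\Pi^1_1$) sets $Q\subseteq\mathbb{N}^{\mathbb{N}}\times\mathcal{X}$, and $\Delta^1_1(f)=\Sigma^1_1(f)\cap\Pi^1_1(f)$. $f$ strongly relativizes $\Delta^1_1$ at $\mathcal{X}$ if every $\Delta^1_1(f)$ set $P\subseteq\mathcal{X}$ equals $Q_f$ for some $\Delta^1_1$ set $Q\subseteq\mathbb{N}^{\mathbb{N}}\times\mathcal{X}$; $f$ strongly relativizes $\Delta^1_1$ if this holds at every space $\mathcal{X}$. $\omega_1^f$ is the least ordinal which is not the order type of an $f$-computable wellordering on $\mathbb{N}$; $\omega_1^{\mathrm{ck}}=\omega_1^{\emptyset}$. $f$ is hyperlow if $\omega_1^f=\omega_1^{\mathrm{ck}}$. *)

theory Defs
  imports "HOL-Analysis.Abstract_Metric_Spaces" "HOL-Library.Nat_Bijection"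
begin

section \<open>Computability relative to an oracle\<close>

text \<open>Programs for \<open>\<mu>\<close>-recursive functions, acting on argument lists. Arities are not part of the
  syntax: \<open>Sc\<close> and \<open>Oracle\<close> act on the first argument, and a program that does not fit its
  argument list diverges.\<close>

datatype recf =
    Zr
  | Sc
  | Proj nat
  | Oracle
  | Cn recf "recf list"
  | Rc recf recf
  | Mn recf

inductive evaluates :: "(nat \<Rightarrow> nat) \<Rightarrow> recf \<Rightarrow> nat list \<Rightarrow> nat \<Rightarrow> bool" for f :: "nat \<Rightarrow> nat" where
  ev_Zr: "evaluates f Zr xs 0"
| ev_Sc: "evaluates f Sc (x # xs) (Suc x)"
| ev_Proj: "i < length xs \<Longrightarrow> evaluates f (Proj i) xs (xs ! i)"
| ev_Oracle: "evaluates f Oracle (x # xs) (f x)"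
| ev_Cn: "list_all2 (\<lambda>g y. evaluates f g xs y) gs ys \<Longrightarrow> evaluates f h ys z
    \<Longrightarrow> evaluates f (Cn h gs) xs z"
| ev_Rc_0: "evaluates f g xs y \<Longrightarrow> evaluates f (Rc g h) (0 # xs) y"
| ev_Rc_Suc: "evaluates f (Rc g h) (n # xs) y \<Longrightarrow> evaluates f h (n # y # xs) z
    \<Longrightarrow> evaluates f (Rc g h) (Suc n # xs) z"
| ev_Mn: "evaluates f g (n # xs) 0 \<Longrightarrow> (\<forall>m<n. \<exists>y. evaluates f g (m # xs) (Suc y))
    \<Longrightarrow> evaluates f (Mn g) xs n"

text \<open>The empty oracle: absolute computability is computability relative to it.\<close>

definition no_oracle :: "nat \<Rightarrow> nat" where
  "no_oracle = (\<lambda>_. 0)"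

definition computable_rel_in :: "(nat \<Rightarrow> nat) \<Rightarrow> nat \<Rightarrow> (nat list \<Rightarrow> bool) \<Rightarrow> bool" where
  "computable_rel_in f k P \<longleftrightarrow>
     (\<exists>e. \<forall>xs. length xs = k \<longrightarrow> evaluates f e xs (if P xs then 1 else 0))"

definition ce_set :: "nat set \<Rightarrow> bool" where
  "ce_set R \<longleftrightarrow> (\<exists>e. R = {n. \<exists>y. evaluates no_oracle e [n] y})"

section \<open>Recursively presented Polish metric spaces\<close>

record 'a presented =
  pts :: "'a set"
  dst :: "'a \<Rightarrow> 'a \<Rightarrow> real"
  dns :: "nat \<Rightarrow> 'a"

definition rec_presented_Polish :: "'a presented \<Rightarrow> bool" where
  "rec_presented_Polish X \<longleftrightarrow>
     Metric_space (pts X) (dst X) \<and>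
     Metric_space.mcomplete (pts X) (dst X) \<and>
     range (dns X) \<subseteq> pts X \<and>
     Metric_space.mtopology (pts X) (dst X) closure_of (range (dns X)) = pts X \<and>
     computable_rel_in no_oracle 4
       (\<lambda>xs. dst X (dns X (xs ! 0)) (dns X (xs ! 1)) \<le> real (xs ! 2) / (real (xs ! 3) + 1)) \<and>
     computable_rel_in no_oracle 4
       (\<lambda>xs. dst X (dns X (xs ! 0)) (dns X (xs ! 1)) < real (xs ! 2) / (real (xs ! 3) + 1))"

text \<open>The index \<open>s\<close> codes a triple: \<open>s = \<langle>i, \<langle>m, k\<rangle>\<rangle>\<close> stands for the open ball with
  centre \<open>r\<^sub>i\<close> and radius \<open>m / (k + 1)\<close>.\<close>

definition nbhd :: "'a presented \<Rightarrow> nat \<Rightarrow> 'a set" where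
  "nbhd X s = (case prod_decode s of (i, t) \<Rightarrow> case prod_decode t of (m, k) \<Rightarrow>
     Metric_space.mball (pts X) (dst X) (dns X i) (real m / (real k + 1)))"

definition nat_space :: "nat presented" where
  "nat_space = \<lparr>pts = UNIV, dst = (\<lambda>m n. if m = n then 0 else 1), dns = (\<lambda>i. i)\<rparr>"

text \<open>The dense sequence of Baire space enumerates the eventually zero sequences.\<close>

definition baire_space :: "(nat \<Rightarrow> nat) presented" where
  "baire_space =
     \<lparr>pts = UNIV,
      dst = (\<lambda>x y. if x = y then 0 else 1 / (real (LEAST n. x n \<noteq> y n) + 1)),
      dns = (\<lambda>i n. if n < length (list_decode i) then list_decode i ! n else 0)\<rparr>"

text \<open>Products carry the maximum metric. The Euclidean product metric \<open>prod_metric\<close> of the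
  library is unsuitable: comparing its values with rationals need not be decidable.\<close>

definition prod_space :: "'a presented \<Rightarrow> 'b presented \<Rightarrow> ('a \<times> 'b) presented" where
  "prod_space X Y =
     \<lparr>pts = pts X \<times> pts Y,
      dst = (\<lambda>p q. max (dst X (fst p) (fst q)) (dst Y (snd p) (snd q))),
      dns = (\<lambda>s. case prod_decode s of (i, j) \<Rightarrow> (dns X i, dns Y j))\<rparr>"

section \<open>Lightface pointclasses\<close>

definition Sigma01 :: "'a presented \<Rightarrow> 'a set \<Rightarrow> bool" where
  "Sigma01 X P \<longleftrightarrow> (\<exists>R. ce_set R \<and> P = (\<Union>s\<in>R. nbhd X s))"

definition Pi01 :: "'a presented \<Rightarrow> 'a set \<Rightarrow> bool" where
  "Pi01 X P \<longleftrightarrow> (\<exists>S. Sigma01 X S \<and> P = pts X - S)"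

definition Sigma11 :: "'a presented \<Rightarrow> 'a set \<Rightarrow> bool" where
  "Sigma11 X P \<longleftrightarrow> (\<exists>C. Pi01 (prod_space X baire_space) C \<and> P = {x. \<exists>g. (x, g) \<in> C})"

definition Pi11 :: "'a presented \<Rightarrow> 'a set \<Rightarrow> bool" where
  "Pi11 X P \<longleftrightarrow> (\<exists>S. Sigma11 X S \<and> P = pts X - S)"

definition Delta11 :: "'a presented \<Rightarrow> 'a set \<Rightarrow> bool" where
  "Delta11 X P \<longleftrightarrow> Sigma11 X P \<and> Pi11 X P"

definition fsection :: "((nat \<Rightarrow> nat) \<times> 'a) set \<Rightarrow> (nat \<Rightarrow> nat) \<Rightarrow> 'a set" where
  "fsection Q f = {x. (f, x) \<in> Q}"

definition Sigma11_in :: "(nat \<Rightarrow> nat) \<Rightarrow> 'a presented \<Rightarrow> 'a set \<Rightarrow> bool" where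
  "Sigma11_in f X P \<longleftrightarrow> (\<exists>Q. Sigma11 (prod_space baire_space X) Q \<and> P = fsection Q f)"

definition Pi11_in :: "(nat \<Rightarrow> nat) \<Rightarrow> 'a presented \<Rightarrow> 'a set \<Rightarrow> bool" where
  "Pi11_in f X P \<longleftrightarrow> (\<exists>Q. Pi11 (prod_space baire_space X) Q \<and> P = fsection Q f)"

definition Delta11_in :: "(nat \<Rightarrow> nat) \<Rightarrow> 'a presented \<Rightarrow> 'a set \<Rightarrow> bool" where
  "Delta11_in f X P \<longleftrightarrow> Sigma11_in f X P \<and> Pi11_in f X P"

definition strongly_relativizes_at :: "(nat \<Rightarrow> nat) \<Rightarrow> 'a presented \<Rightarrow> bool" where
  "strongly_relativizes_at f X \<longleftrightarrow>
     (\<forall>P. Delta11_in f X P \<longrightarrow>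
        (\<exists>Q. Delta11 (prod_space baire_space X) Q \<and> P = fsection Q f))"

text \<open>The type argument says where the points live; HOL cannot quantify over it inside a formula.
  A separable metric space has at most continuum many points, so up to isometry every space has
  its points in \<^typ>\<open>nat \<Rightarrow> nat\<close>.\<close>

definition strongly_relativizes :: "'a itself \<Rightarrow> (nat \<Rightarrow> nat) \<Rightarrow> bool" where
  "strongly_relativizes (T :: 'a itself) f \<longleftrightarrow>
     (\<forall>X :: 'a presented. rec_presented_Polish X \<longrightarrow> strongly_relativizes_at f X)"

section \<open>Hyperlow functions\<close>

text \<open>Countable ordinals are represented by wellorderings of sets of natural numbers, up to
  isomorphism. The field of a computable wellordering may be any subset of \<open>\<nat>\<close>: with
  field \<open>\<nat>\<close>, finite ordinals would not be order types at all. As \<^const>\<open>Well_order\<close> is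
  reflexive, the field is itself computable.\<close>

definition computable_wellorder_in :: "(nat \<Rightarrow> nat) \<Rightarrow> nat rel \<Rightarrow> bool" where
  "computable_wellorder_in f r \<longleftrightarrow>
     Well_order r \<and> computable_rel_in f 2 (\<lambda>xs. (xs ! 0, xs ! 1) \<in> r)"

definition computable_ordinal_in :: "(nat \<Rightarrow> nat) \<Rightarrow> nat rel \<Rightarrow> bool" where
  "computable_ordinal_in f a \<longleftrightarrow> (\<exists>r. computable_wellorder_in f r \<and> (r, a) \<in> ordIso)"

definition is_omega1 :: "(nat \<Rightarrow> nat) \<Rightarrow> nat rel \<Rightarrow> bool" where
  "is_omega1 f a \<longleftrightarrow> Well_order a \<and> \<not> computable_ordinal_in f a \<and>
     (\<forall>b :: nat rel. (b, a) \<in> ordLess \<longrightarrow> computable_ordinal_in f b)"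

text \<open>A representative of \<open>\<omega>\<^sub>1\<^sup>f\<close>, which is a countable ordinal determined by
  \<^const>\<open>is_omega1\<close> up to isomorphism.\<close>

definition omega1 :: "(nat \<Rightarrow> nat) \<Rightarrow> nat rel" where
  "omega1 f = (SOME a. is_omega1 f a)"

definition hyperlow :: "(nat \<Rightarrow> nat) \<Rightarrow> bool" where
  "hyperlow f \<longleftrightarrow> (omega1 f, omega1 no_oracle) \<in> ordIso"

end

theory Submission
  imports Defs
begin

text \<open>A \<open>\<Sigma>\<^sup>1\<^sub>1\<close> set is the set of points over which a computable tree has a branch, and a tree has no
  branch iff its Kleene--Brouwer ordering is a well-order. For \<open>\<Sigma>\<^sup>1\<^sub>1\<close> sets whose sections at \<open>g\<close>
  are disjoint, the tree of attempts at a common point of the two sections is well-founded and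
  \<open>g\<close>-computable, and its Kleene--Brouwer ordering bounds the trees of the second section over all
  points of the first (boundedness).

  If \<open>f\<close> is hyperlow and \<open>P\<close> is \<open>\<Delta>\<^sup>1\<^sub>1(f)\<close>, boundedness for \<open>P\<close> and its complement yields a bound
  that may be taken to be a computable well-order \<open>\<alpha>\<close>; then ``the tree for the complement over
  \<open>(g, x)\<close> embeds into \<open>\<alpha>\<close>'' defines a \<open>\<Delta>\<^sup>1\<^sub>1\<close> set with \<open>f\<close>-section \<open>P\<close>. If \<open>f\<close> is not hyperlow,
  some \<open>f\<close>-computable well-order is longer than all computable ones; comparing trees with it is
  \<open>\<Delta>\<^sup>1\<^sub>1(f)\<close>, and diagonalizing over the indices of trees gives a subset of \<open>\<nat>\<close> that is, by
  boundedness, no section of a \<open>\<Delta>\<^sup>1\<^sub>1\<close> set.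

  Points of a space enter computations through fast converging sequences of indices of the dense
  sequence.\<close>

section \<open>Pairing\<close>

text \<open>Three points shape the details. First, the trees over \<open>(g, x)\<close> must be
  given uniformly in \<open>g\<close>, so one program has to serve many oracles; computability is
  therefore stated for sets of oracles. Finite certificates that consult only an initial segment of
  the oracle express halting, and they turn the code of a program into the index of a tree.

  Second, comparison with a well-order has to be \<open>\<Sigma>\<^sup>1\<^sub>1\<close> in both
  directions. Embedding by a strictly increasing map is so by its form. Since well-orders are
  comparable, the failure of embedding also has a witness: an infinite descent, or a copy of the
  well-order strictly below some point. This works at every parameter \<open>g\<close>, so the set
  defined in the hyperlow case is \<open>\<Delta>\<^sup>1\<^sub>1\<close> throughout, although it
  has to be the right one only at \<open>f\<close>.

  Third, the diagonal argument puts \<open>f\<close> into the point instead of the parameter. A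
  \<open>\<Delta>\<^sup>1\<^sub>1\<close> set and its complement are disjoint at all points, so
  boundedness at the zero parameter gives a bound that is computable without \<open>f\<close>, hence
  no longer than the \<open>f\<close>-computable well-order used in the diagonal set.\<close>

definition pair :: "nat \<Rightarrow> nat \<Rightarrow> nat" where
  "pair a b = prod_encode (a, b)"

definition p1 :: "nat \<Rightarrow> nat" where
  "p1 z = fst (prod_decode z)"

definition p2 :: "nat \<Rightarrow> nat" where
  "p2 z = snd (prod_decode z)"

lemma pair_simps [simp]: "p1 (pair a b) = a" "p2 (pair a b) = b" "pair (p1 z) (p2 z) = z"
  by (simp_all add: pair_def p1_def p2_def)

lemma pair_eq_iff [simp]: "pair a b = pair c d \<longleftrightarrow> a = c \<and> b = d"
  by (simp add: pair_def)

lemma pair_0_0: "pair 0 0 = 0"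
  by (simp add: pair_def prod_encode_def)

lemma p_zero [simp]: "p1 0 = 0" "p2 0 = 0"
  by (metis pair_0_0 pair_simps(1), metis pair_0_0 pair_simps(2))

lemma all_pair: "(\<forall>x. P (p1 x) (p2 x)) \<longleftrightarrow> (\<forall>a b. P a b)"
proof safe
  fix a b
  assume "\<forall>x. P (p1 x) (p2 x)"
  then have "P (p1 (pair a b)) (p2 (pair a b))" by blast
  then show "P a b" by simp
qed auto

lemma le_pair: "a \<le> pair a b" "b \<le> pair a b"
  by (simp_all add: pair_def le_prod_encode_1 le_prod_encode_2)

text \<open>Attaching a fixed first component to the entries of sequences keeps their order;
  boundedness relies on this to transfer Kleene--Brouwer comparisons.\<close>

lemma pair_strict_mono2: "b < c \<Longrightarrow> pair a b < pair a c"
proof (induction c)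
  case (Suc c)
  have "pair a c < pair a (Suc c)"
    by (simp add: pair_def prod_encode_def)
  with Suc show ?case
    by (cases "b = c") auto
qed simp

section \<open>Functionals computable by a uniform program\<close>

text \<open>The program is chosen before the oracle. For \<open>\<Phi> = UNIV\<close> this describes
  a computable functional, for \<open>\<Phi> = {f}\<close> computability in
  \<open>f\<close>.\<close>

definition nrec :: "(nat \<Rightarrow> nat) set \<Rightarrow> nat \<Rightarrow> ((nat \<Rightarrow> nat) \<Rightarrow> nat list \<Rightarrow> nat) \<Rightarrow> bool" where
  "nrec \<Phi> k F \<longleftrightarrow> (\<exists>e. \<forall>f\<in>\<Phi>. \<forall>xs. length xs = k \<longrightarrow> evaluates f e xs (F f xs))"

text \<open>Unary functionals suffice once several arguments are packed with \<open>pair\<close>;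
  closure under composition then avoids argument lists.\<close>

definition urec :: "(nat \<Rightarrow> nat) set \<Rightarrow> ((nat \<Rightarrow> nat) \<Rightarrow> nat \<Rightarrow> nat) \<Rightarrow> bool" where
  "urec \<Phi> F \<longleftrightarrow> (\<exists>e. \<forall>f\<in>\<Phi>. \<forall>x. evaluates f e [x] (F f x))"

definition dec :: "(nat \<Rightarrow> nat) set \<Rightarrow> ((nat \<Rightarrow> nat) \<Rightarrow> nat \<Rightarrow> bool) \<Rightarrow> bool" where
  "dec \<Phi> P \<longleftrightarrow> urec \<Phi> (\<lambda>f x. of_bool (P f x))"

lemma nrec_cong:
  assumes "nrec \<Phi> k F" "\<And>f xs. f \<in> \<Phi> \<Longrightarrow> length xs = k \<Longrightarrow> F f xs = G f xs"
  shows "nrec \<Phi> k G"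
  using assms unfolding nrec_def by metis

lemma nrec_Cn:
  assumes "nrec \<Phi> (length Gs) H" "\<forall>G\<in>set Gs. nrec \<Phi> k G"
  shows "nrec \<Phi> k (\<lambda>f xs. H f (map (\<lambda>G. G f xs) Gs))"
proof -
  obtain h where h: "\<And>f xs. f \<in> \<Phi> \<Longrightarrow> length xs = length Gs \<Longrightarrow> evaluates f h xs (H f xs)"
    using assms(1) unfolding nrec_def by blast
  obtain e where e: "\<forall>G\<in>set Gs. \<forall>f\<in>\<Phi>. \<forall>xs. length xs = k \<longrightarrow> evaluates f (e G) xs (G f xs)"
    using assms(2) unfolding nrec_def by metis
  have "evaluates f (Cn h (map e Gs)) xs (H f (map (\<lambda>G. G f xs) Gs))"
    if "f \<in> \<Phi>" "length xs = k" for f xs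
    by (rule ev_Cn[where ys = "map (\<lambda>G. G f xs) Gs"])
      (use e h that in \<open>auto simp: list_all2_map1 list_all2_map2 list_all2_same\<close>)
  then show ?thesis
    unfolding nrec_def by blast
qed

lemma nrec_const_0: "nrec \<Phi> k (\<lambda>f xs. 0)"
  unfolding nrec_def using ev_Zr by blast

lemma nrec_proj: "i < k \<Longrightarrow> nrec \<Phi> k (\<lambda>f xs. xs ! i)"
  unfolding nrec_def using ev_Proj by blast

lemma nrec_hd: "0 < k \<Longrightarrow> nrec \<Phi> k (\<lambda>f xs. hd xs)"
  by (rule nrec_cong[OF nrec_proj[of 0 k]]) (auto simp: hd_conv_nth)

lemma nrec_comp1: "nrec \<Phi> 1 (\<lambda>f xs. h f (hd xs)) \<Longrightarrow> nrec \<Phi> k F \<Longrightarrow> nrec \<Phi> k (\<lambda>f xs. h f (F f xs))"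
  using nrec_Cn[of \<Phi> "[F]" "\<lambda>f xs. h f (hd xs)" k] by simp

lemma nrec_comp2:
  "nrec \<Phi> 2 (\<lambda>f xs. h (xs ! 0) (xs ! 1)) \<Longrightarrow> nrec \<Phi> k F \<Longrightarrow> nrec \<Phi> k G \<Longrightarrow>
    nrec \<Phi> k (\<lambda>f xs. h (F f xs) (G f xs))"
  using nrec_Cn[of \<Phi> "[F, G]" "\<lambda>f xs. h (xs ! 0) (xs ! 1)" k] by (simp add: numeral_2_eq_2)

lemma nrec_1:
  "nrec \<Phi> 1 (\<lambda>f xs. F f (hd xs)) \<longleftrightarrow> (\<exists>e. \<forall>f\<in>\<Phi>. \<forall>x. evaluates f e [x] (F f x))"
proof -
  have "length xs = 1 \<longleftrightarrow> (\<exists>x. xs = [x])" for xs :: "nat list"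
    by (cases xs) auto
  then have "(\<forall>xs. length xs = 1 \<longrightarrow> evaluates f e xs (F f (hd xs))) \<longleftrightarrow> (\<forall>x. evaluates f e [x] (F f x))" for e f
    by auto
  then show ?thesis
    unfolding nrec_def by blast
qed

lemma nrec_Suc: "nrec \<Phi> k F \<Longrightarrow> nrec \<Phi> k (\<lambda>f xs. Suc (F f xs))"
proof (rule nrec_comp1[where h = "\<lambda>f. Suc"])
  show "nrec \<Phi> 1 (\<lambda>f xs. Suc (hd xs))"
    using ev_Sc[of _ _ "[]"] by (subst nrec_1) blast
qed

lemma nrec_oracle: "nrec \<Phi> k F \<Longrightarrow> nrec \<Phi> k (\<lambda>f xs. f (F f xs))"
proof (rule nrec_comp1[where h = "\<lambda>f. f"])
  show "nrec \<Phi> 1 (\<lambda>f xs. f (hd xs))"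
    using ev_Oracle[of _ _ "[]"] by (subst nrec_1) blast
qed

lemma nrec_Rc:
  assumes "nrec \<Phi> k A" "nrec \<Phi> (Suc (Suc k)) B"
  shows "nrec \<Phi> (Suc k) (\<lambda>f xs. rec_nat (A f (tl xs)) (\<lambda>n y. B f (n # y # tl xs)) (hd xs))"
proof -
  obtain a where a: "\<And>f xs. f \<in> \<Phi> \<Longrightarrow> length xs = k \<Longrightarrow> evaluates f a xs (A f xs)"
    using assms(1) unfolding nrec_def by blast
  obtain b where b: "\<And>f xs. f \<in> \<Phi> \<Longrightarrow> length xs = Suc (Suc k) \<Longrightarrow> evaluates f b xs (B f xs)"
    using assms(2) unfolding nrec_def by blast
  have "evaluates f (Rc a b) (n # xs) (rec_nat (A f xs) (\<lambda>n y. B f (n # y # xs)) n)"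
    if "f \<in> \<Phi>" "length xs = k" for f xs n
    by (induction n) (use that in \<open>auto intro!: ev_Rc_0 ev_Rc_Suc a b\<close>)
  then show ?thesis
    unfolding nrec_def by (intro exI[of _ "Rc a b"]) (auto simp: length_Suc_conv)
qed

lemma nrec_Rc1:
  assumes "nrec \<Phi> 2 (\<lambda>f xs. b (xs ! 0) (xs ! 1))" "\<And>n. h n = rec_nat c b n"
    "nrec \<Phi> 0 (\<lambda>f xs. c)" "nrec \<Phi> k F"
  shows "nrec \<Phi> k (\<lambda>f xs. h (F f xs))"
proof (rule nrec_comp1[where h = "\<lambda>f. h", OF _ assms(4)])
  show "nrec \<Phi> 1 (\<lambda>f xs. h (hd xs))"
    using nrec_Rc[OF assms(3), of "\<lambda>f xs. b (xs ! 0) (xs ! 1)"] assms(1,2)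
    by (simp add: numeral_2_eq_2)
qed

lemma nrec_Rc2:
  assumes "nrec \<Phi> 3 (\<lambda>f xs. b (xs ! 0) (xs ! 1) (xs ! 2))" "nrec \<Phi> 1 (\<lambda>f xs. c (hd xs))"
    "\<And>n x. h n x = rec_nat (c x) (\<lambda>m y. b m y x) n" "nrec \<Phi> k F" "nrec \<Phi> k G"
  shows "nrec \<Phi> k (\<lambda>f xs. h (F f xs) (G f xs))"
proof (rule nrec_comp2[where h = h, OF _ assms(4,5)])
  show "nrec \<Phi> 2 (\<lambda>f xs. h (xs ! 0) (xs ! 1))"
    by (rule nrec_cong[OF nrec_Rc[of \<Phi> 1 "\<lambda>f xs. c (hd xs)" "\<lambda>f xs. b (xs ! 0) (xs ! 1) (xs ! 2)",
            unfolded Suc_1, OF assms(2)]])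
      (use assms(1,3) in \<open>auto simp: numeral_3_eq_3 numeral_2_eq_2 length_Suc_conv\<close>)
qed

lemma nrec_const: "nrec \<Phi> k (\<lambda>f xs. c)"
  by (induction c) (auto intro: nrec_const_0 nrec_Suc)

lemma nrec_add: "nrec \<Phi> k F \<Longrightarrow> nrec \<Phi> k G \<Longrightarrow> nrec \<Phi> k (\<lambda>f xs. F f xs + G f xs)"
proof (rule nrec_Rc2[where h = "(+)" and b = "\<lambda>n y x. Suc y" and c = "\<lambda>x. x"])
  show "n + x = rec_nat x (\<lambda>m. Suc) n" for n x
    by (induction n) auto
qed (auto intro!: nrec_Suc nrec_proj nrec_hd)

lemma nrec_pred: "nrec \<Phi> k F \<Longrightarrow> nrec \<Phi> k (\<lambda>f xs. F f xs - 1)"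
proof (rule nrec_Rc1[where h = "\<lambda>x. x - 1" and b = "\<lambda>n y. n" and c = 0])
  show "n - 1 = rec_nat 0 (\<lambda>m y. m) n" for n :: nat
    by (cases n) auto
qed (auto intro!: nrec_const nrec_proj)

lemma nrec_diff: "nrec \<Phi> k F \<Longrightarrow> nrec \<Phi> k G \<Longrightarrow> nrec \<Phi> k (\<lambda>f xs. F f xs - G f xs)"
proof (rule nrec_Rc2[where h = "\<lambda>n x. x - n" and b = "\<lambda>n y x. y - 1" and c = "\<lambda>x. x" and F = G and G = F])
  show "x - n = rec_nat x (\<lambda>m y. y - 1) n" for n x :: nat
    by (induction n) auto
qed (auto intro!: nrec_pred nrec_proj nrec_hd simp del: One_nat_def)

lemma nrec_mult: "nrec \<Phi> k F \<Longrightarrow> nrec \<Phi> k G \<Longrightarrow> nrec \<Phi> k (\<lambda>f xs. F f xs * G f xs)"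
proof (rule nrec_Rc2[where h = "(*)" and b = "\<lambda>n y x. y + x" and c = "\<lambda>x. 0"])
  show "n * x = rec_nat 0 (\<lambda>m y. y + x) n" for n x :: nat
    by (induction n) auto
qed (auto intro!: nrec_add nrec_proj nrec_const)

lemma nrec_triangle: "nrec \<Phi> k F \<Longrightarrow> nrec \<Phi> k (\<lambda>f xs. triangle (F f xs))"
proof (rule nrec_Rc1[where h = triangle and b = "\<lambda>n y. y + Suc n" and c = 0])
  show "triangle n = rec_nat 0 (\<lambda>m y. y + Suc m) n" for n
    by (induction n) auto
qed (auto intro!: nrec_const nrec_proj nrec_add nrec_Suc simp del: add_Suc_right)

lemma nrec_pair: "nrec \<Phi> k F \<Longrightarrow> nrec \<Phi> k G \<Longrightarrow> nrec \<Phi> k (\<lambda>f xs. pair (F f xs) (G f xs))"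
  unfolding pair_def prod_encode_def prod.case by (intro nrec_triangle nrec_add)

section \<open>Inverting the pairing function by primitive recursion\<close>

lemma triangle_mono: "m \<le> n \<Longrightarrow> triangle m \<le> triangle n"
  by (induction n) (auto simp: le_Suc_eq)

text \<open>The antidiagonal of the Cantor enumeration on which z lies, equivalently the largest d
  with \<open>triangle d \<le> z\<close>. From one z to the next it grows by 0 or 1, so it is
  primitive recursive, and both projections are arithmetic in it.\<close>

definition diagonal :: "nat \<Rightarrow> nat" where
  "diagonal z = p1 z + p2 z"

lemma triangle_diagonal_add: "triangle (diagonal z) + p1 z = z"
proof -
  have "prod_encode (p1 z, p2 z) = z"
    by (simp add: p1_def p2_def)
  then show ?thesis
    by (simp add: prod_encode_def diagonal_def)
qed

lemma triangle_diagonal: "triangle (diagonal z) \<le> z" "z < triangle (Suc (diagonal z))"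
proof -
  have "p1 z \<le> diagonal z"
    by (simp add: diagonal_def)
  with triangle_diagonal_add[of z] show "triangle (diagonal z) \<le> z" "z < triangle (Suc (diagonal z))"
    by (simp_all only: triangle_Suc)
qed

lemma diagonal_unique:
  assumes "triangle w \<le> z" "z < triangle (Suc w)" shows "diagonal z = w"
proof (rule ccontr)
  assume "diagonal z \<noteq> w"
  then consider "Suc w \<le> diagonal z" | "Suc (diagonal z) \<le> w" by linarith
  then show False
    using triangle_diagonal[of z] triangle_mono assms by cases (meson le_trans not_le)+
qed

text \<open>Truncated subtraction acts as a test: the last summand is 1 exactly when
  \<open>Suc z\<close> reaches the next triangular number.\<close>

lemma diagonal_Suc:
  "diagonal (Suc z) = diagonal z + (1 - (triangle (Suc (diagonal z)) - Suc z))"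
proof (cases "triangle (Suc (diagonal z)) \<le> Suc z")
  case True
  with triangle_diagonal(2)[of z] have "Suc z = triangle (Suc (diagonal z))"
    by linarith
  then have "diagonal (Suc z) = Suc (diagonal z)"
    by (intro diagonal_unique) simp_all
  with True show ?thesis by simp
next
  case False
  with triangle_diagonal(1)[of z] have "diagonal (Suc z) = diagonal z"
    by (intro diagonal_unique) simp_all
  with False show ?thesis by simp
qed

lemma nrec_diagonal: "nrec \<Phi> k F \<Longrightarrow> nrec \<Phi> k (\<lambda>f xs. diagonal (F f xs))"
proof (rule nrec_Rc1[where h = diagonal and b = "\<lambda>n y. y + (1 - (triangle (Suc y) - Suc n))" and c = 0])
  show "diagonal n = rec_nat 0 (\<lambda>n y. y + (1 - (triangle (Suc y) - Suc n))) n" for n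
    by (induction n) (simp_all add: diagonal_Suc del: triangle_Suc, simp add: diagonal_def)
qed (auto intro!: nrec_const nrec_proj nrec_add nrec_diff nrec_triangle nrec_Suc
    simp del: triangle_Suc add_Suc_right diff_Suc_Suc)

lemma p1_eq: "p1 z = z - triangle (diagonal z)"
  using triangle_diagonal_add[of z] by linarith

lemma p2_eq: "p2 z = diagonal z - p1 z"
  by (simp add: diagonal_def)

lemma nrec_p1: "nrec \<Phi> k F \<Longrightarrow> nrec \<Phi> k (\<lambda>f xs. p1 (F f xs))"
  unfolding p1_eq by (intro nrec_diff nrec_triangle nrec_diagonal)

lemma nrec_p2: "nrec \<Phi> k F \<Longrightarrow> nrec \<Phi> k (\<lambda>f xs. p2 (F f xs))"
  unfolding p2_eq by (intro nrec_diff nrec_p1 nrec_diagonal)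

lemma urec_nrec: "urec \<Phi> F \<longleftrightarrow> nrec \<Phi> 1 (\<lambda>f xs. F f (hd xs))"
  by (simp only: urec_def nrec_1)

lemma nrec_urec: "urec \<Phi> F \<Longrightarrow> nrec \<Phi> k G \<Longrightarrow> nrec \<Phi> k (\<lambda>f xs. F f (G f xs))"
  unfolding urec_nrec by (rule nrec_comp1)

lemma urec_cong: "urec \<Phi> F \<Longrightarrow> (\<And>f x. f \<in> \<Phi> \<Longrightarrow> F f x = G f x) \<Longrightarrow> urec \<Phi> G"
  unfolding urec_def by metis

lemma urec_id: "urec \<Phi> (\<lambda>f x. x)"
  unfolding urec_nrec by (rule nrec_hd) simp

lemma urec_const: "urec \<Phi> (\<lambda>f x. c)"
  unfolding urec_nrec by (rule nrec_const)

lemma urec_comp: "urec \<Phi> H \<Longrightarrow> urec \<Phi> F \<Longrightarrow> urec \<Phi> (\<lambda>f x. H f (F f x))"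
  using nrec_urec unfolding urec_nrec by blast

lemma urec_Suc: "urec \<Phi> F \<Longrightarrow> urec \<Phi> (\<lambda>f x. Suc (F f x))"
  unfolding urec_nrec by (rule nrec_Suc)

lemma urec_oracle: "urec \<Phi> F \<Longrightarrow> urec \<Phi> (\<lambda>f x. f (F f x))"
  unfolding urec_nrec by (rule nrec_oracle)

lemma urec_add: "urec \<Phi> F \<Longrightarrow> urec \<Phi> G \<Longrightarrow> urec \<Phi> (\<lambda>f x. F f x + G f x)"
  unfolding urec_nrec by (rule nrec_add)

lemma urec_diff: "urec \<Phi> F \<Longrightarrow> urec \<Phi> G \<Longrightarrow> urec \<Phi> (\<lambda>f x. F f x - G f x)"
  unfolding urec_nrec by (rule nrec_diff)

lemma urec_mult: "urec \<Phi> F \<Longrightarrow> urec \<Phi> G \<Longrightarrow> urec \<Phi> (\<lambda>f x. F f x * G f x)"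
  unfolding urec_nrec by (rule nrec_mult)

lemma urec_pair: "urec \<Phi> F \<Longrightarrow> urec \<Phi> G \<Longrightarrow> urec \<Phi> (\<lambda>f x. pair (F f x) (G f x))"
  unfolding urec_nrec by (rule nrec_pair)

lemma urec_p1: "urec \<Phi> F \<Longrightarrow> urec \<Phi> (\<lambda>f x. p1 (F f x))"
  unfolding urec_nrec by (rule nrec_p1)

lemma urec_p2: "urec \<Phi> F \<Longrightarrow> urec \<Phi> (\<lambda>f x. p2 (F f x))"
  unfolding urec_nrec by (rule nrec_p2)

lemma urec_rec_nat:
  assumes A: "urec \<Phi> A" and B: "urec \<Phi> (\<lambda>f z. B f (p1 z) (p1 (p2 z)) (p2 (p2 z)))" and N: "urec \<Phi> N"
  shows "urec \<Phi> (\<lambda>f x. rec_nat (A f x) (\<lambda>n y. B f n y x) (N f x))"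
proof -
  have "nrec \<Phi> 2 (\<lambda>f xs. rec_nat (A f (hd (tl xs))) (\<lambda>n y. B f n y (hd (tl xs))) (hd xs))"
  proof (rule nrec_cong[OF nrec_Rc[of \<Phi> 1 "\<lambda>f xs. A f (hd xs)" "\<lambda>f xs. B f (xs ! 0) (xs ! 1) (xs ! 2)",
            unfolded Suc_1]])
    show "nrec \<Phi> 1 (\<lambda>f xs. A f (hd xs))"
      using A by (simp add: urec_nrec)
    show "nrec \<Phi> (Suc 2) (\<lambda>f xs. B f (xs ! 0) (xs ! 1) (xs ! 2))"
      using nrec_urec[OF B nrec_pair[OF nrec_proj[of 0 3] nrec_pair[OF nrec_proj[of 1 3] nrec_proj[of 2 3]]]]
      by (simp add: numeral_3_eq_3 numeral_2_eq_2)
  qed (auto simp: numeral_2_eq_2 length_Suc_conv)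
  from nrec_Cn[of \<Phi> "[\<lambda>f xs. N f (hd xs), \<lambda>f xs. hd xs]", simplified, folded numeral_2_eq_2,
      OF this, of 1]
  show ?thesis
    using N by (simp add: urec_nrec nrec_hd)
qed

section \<open>Decidable predicates and bounded quantifiers\<close>

lemma dec_cong: "dec \<Phi> P \<Longrightarrow> (\<And>f x. f \<in> \<Phi> \<Longrightarrow> P f x \<longleftrightarrow> Q f x) \<Longrightarrow> dec \<Phi> Q"
  unfolding dec_def by (erule urec_cong) auto

lemma urec_if:
  assumes "dec \<Phi> C" "urec \<Phi> A" "urec \<Phi> B"
  shows "urec \<Phi> (\<lambda>f x. if C f x then A f x else B f x)"
  by (rule urec_cong[OF urec_add[OF urec_mult[OF assms(1)[unfolded dec_def] assms(2)]
          urec_mult[OF urec_diff[OF urec_const[of _ 1] assms(1)[unfolded dec_def]] assms(3)]]])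
    auto

lemma dec_const: "dec \<Phi> (\<lambda>f x. c)"
  unfolding dec_def by (rule urec_const)

lemma dec_not: "dec \<Phi> P \<Longrightarrow> dec \<Phi> (\<lambda>f x. \<not> P f x)"
  unfolding dec_def by (drule urec_diff[OF urec_const[of _ 1]]) (auto elim: urec_cong)

lemma dec_conj: "dec \<Phi> P \<Longrightarrow> dec \<Phi> Q \<Longrightarrow> dec \<Phi> (\<lambda>f x. P f x \<and> Q f x)"
  unfolding dec_def by (drule (1) urec_mult) (auto elim: urec_cong)

lemma dec_disj: "dec \<Phi> P \<Longrightarrow> dec \<Phi> Q \<Longrightarrow> dec \<Phi> (\<lambda>f x. P f x \<or> Q f x)"
  using dec_not[OF dec_conj[OF dec_not dec_not]] by fastforce

lemma dec_imp: "dec \<Phi> P \<Longrightarrow> dec \<Phi> Q \<Longrightarrow> dec \<Phi> (\<lambda>f x. P f x \<longrightarrow> Q f x)"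
  using dec_disj[OF dec_not] by (fastforce elim: dec_cong)

lemma dec_iff: "dec \<Phi> P \<Longrightarrow> dec \<Phi> Q \<Longrightarrow> dec \<Phi> (\<lambda>f x. P f x \<longleftrightarrow> Q f x)"
  by (rule dec_cong[OF dec_conj[OF dec_imp[of \<Phi> P Q] dec_imp[of \<Phi> Q P]]]) auto

lemma dec_le: "urec \<Phi> F \<Longrightarrow> urec \<Phi> G \<Longrightarrow> dec \<Phi> (\<lambda>f x. F f x \<le> G f x)"
  unfolding dec_def
  by (rule urec_cong[OF urec_diff[OF urec_const[of _ 1] urec_diff], of _ F G]) auto

lemma dec_less: "urec \<Phi> F \<Longrightarrow> urec \<Phi> G \<Longrightarrow> dec \<Phi> (\<lambda>f x. F f x < G f x)"
  by (rule dec_cong[OF dec_not[OF dec_le], of _ G F]) auto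

lemma dec_eq: "urec \<Phi> F \<Longrightarrow> urec \<Phi> G \<Longrightarrow> dec \<Phi> (\<lambda>f x. F f x = G f x)"
  by (rule dec_cong[OF dec_conj[OF dec_le dec_le], of _ F G G F]) auto

lemma urec_of_bool: "dec \<Phi> P \<Longrightarrow> urec \<Phi> (\<lambda>f x. of_bool (P f x))"
  by (simp add: dec_def)

text \<open>A bounded universal quantifier is the product of its truth values, accumulated by
  recursion on the bound.\<close>

lemma dec_all_less:
  assumes "urec \<Phi> N" "dec \<Phi> (\<lambda>f z. P f (p1 z) (p2 z))"
  shows "dec \<Phi> (\<lambda>f x. \<forall>n<N f x. P f n x)"
  unfolding dec_def
proof (rule urec_cong[OF urec_rec_nat[OF urec_const[of _ 1] _ assms(1), of "\<lambda>f n y x. y * of_bool (P f n x)"]])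
  show "urec \<Phi> (\<lambda>f z. p1 (p2 z) * of_bool (P f (p1 z) (p2 (p2 z))))"
    using urec_comp[OF assms(2)[unfolded dec_def] urec_pair[OF urec_p1[OF urec_id] urec_p2[OF urec_p2[OF urec_id]]]]
    by (intro urec_mult urec_p1 urec_p2 urec_id) simp
  have "rec_nat (1 :: nat) (\<lambda>n y. y * of_bool (P f n x)) m = of_bool (\<forall>n<m. P f n x)" for f m x
    by (induction m) (auto simp: less_Suc_eq)
  then show "rec_nat (1 :: nat) (\<lambda>n y. y * of_bool (P f n x)) (N f x) = of_bool (\<forall>n<N f x. P f n x)" for f x .
qed

lemma dec_ex_less:
  assumes "urec \<Phi> N" "dec \<Phi> (\<lambda>f z. P f (p1 z) (p2 z))"
  shows "dec \<Phi> (\<lambda>f x. \<exists>n<N f x. P f n x)"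
  by (rule dec_cong[OF dec_not[OF dec_all_less[OF assms(1) dec_not[OF assms(2)]]]]) auto

lemma dec_all_le:
  "urec \<Phi> N \<Longrightarrow> dec \<Phi> (\<lambda>f z. P f (p1 z) (p2 z)) \<Longrightarrow> dec \<Phi> (\<lambda>f x. \<forall>n\<le>N f x. P f n x)"
  by (rule dec_cong[OF dec_all_less[OF urec_Suc, of _ N P]]) (auto simp: less_Suc_eq_le)

lemma dec_ex_le:
  "urec \<Phi> N \<Longrightarrow> dec \<Phi> (\<lambda>f z. P f (p1 z) (p2 z)) \<Longrightarrow> dec \<Phi> (\<lambda>f x. \<exists>n\<le>N f x. P f n x)"
  by (rule dec_cong[OF dec_ex_less[OF urec_Suc, of _ N P]]) (auto simp: less_Suc_eq_le)

lemma dec_comp: "dec \<Phi> P \<Longrightarrow> urec \<Phi> F \<Longrightarrow> dec \<Phi> (\<lambda>f x. P f (F f x))"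
  unfolding dec_def by (rule urec_comp)

section \<open>Sequence codes\<close>

text \<open>The constructor of \<open>list_encode\<close>: 0 is the empty sequence, and every number
  codes exactly one sequence. At 0 both \<open>shd\<close> and \<open>stl\<close> give 0, so
  dropping too many entries is harmless.\<close>

definition scons :: "nat \<Rightarrow> nat \<Rightarrow> nat" where
  "scons a s = Suc (pair a s)"

definition shd :: "nat \<Rightarrow> nat" where
  "shd s = p1 (s - 1)"

definition stl :: "nat \<Rightarrow> nat" where
  "stl s = p2 (s - 1)"

definition sdrop :: "nat \<Rightarrow> nat \<Rightarrow> nat" where
  "sdrop n s = (stl ^^ n) s"

definition snth :: "nat \<Rightarrow> nat \<Rightarrow> nat" where
  "snth s i = shd (sdrop i s)"

definition llen :: "nat \<Rightarrow> nat" where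
  "llen s = length (list_decode s)"

lemma scons_simps [simp]: "shd (scons a s) = a" "stl (scons a s) = s"
  "list_decode (scons a s) = a # list_decode s" "llen (scons a s) = Suc (llen s)" "llen 0 = 0"
  by (simp_all add: scons_def shd_def stl_def pair_def p1_def p2_def llen_def)

lemma scons_shd_stl: "s \<noteq> 0 \<Longrightarrow> scons (shd s) (stl s) = s"
  by (simp add: scons_def shd_def stl_def)

lemma list_decode_shd: "s \<noteq> 0 \<Longrightarrow> list_decode s = shd s # list_decode (stl s)"
  by (metis scons_shd_stl scons_simps(3))

lemma list_decode_stl: "list_decode (stl s) = tl (list_decode s)"
  by (cases "s = 0") (simp_all add: list_decode_shd, simp add: stl_def)

lemma list_decode_sdrop: "list_decode (sdrop n s) = drop n (list_decode s)"
  by (induction n) (simp_all add: sdrop_def list_decode_stl drop_Suc tl_drop)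

lemma list_decode_eq_Nil [simp]: "list_decode s = [] \<longleftrightarrow> s = 0"
  by (metis list_decode.simps(1) list_decode_inverse)

lemma snth_nth: "i < llen s \<Longrightarrow> snth s i = list_decode s ! i"
  using list_decode_shd[of "sdrop i s"] list_decode_sdrop[of i s]
  by (metis Cons_nth_drop_Suc drop_eq_Nil list.inject list_decode_eq_Nil llen_def not_le snth_def)

text \<open>Each entry raises the code by at least one. The code thus bounds the recursion that
  computes the length.\<close>

lemma llen_le: "llen s \<le> s"
proof (induction s rule: less_induct)
  case (less s)
  show ?case
  proof (cases "s = 0")
    case False
    then have "s = Suc (pair (shd s) (stl s))"
      by (metis scons_def scons_shd_stl)
    then have "stl s < s"
      using le_pair(2) le_imp_less_Suc by metis
    with less[of "stl s"] scons_shd_stl[OF False] show ?thesis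
      by (metis Suc_leI le_less_trans scons_simps(4))
  qed (simp add: llen_def)
qed

lemma urec_shd: "urec \<Phi> F \<Longrightarrow> urec \<Phi> (\<lambda>f x. shd (F f x))"
  unfolding shd_def by (intro urec_p1 urec_diff urec_const)

lemma urec_stl: "urec \<Phi> F \<Longrightarrow> urec \<Phi> (\<lambda>f x. stl (F f x))"
  unfolding stl_def by (intro urec_p2 urec_diff urec_const)

lemma urec_scons: "urec \<Phi> F \<Longrightarrow> urec \<Phi> G \<Longrightarrow> urec \<Phi> (\<lambda>f x. scons (F f x) (G f x))"
  unfolding scons_def by (intro urec_Suc urec_pair)

lemma urec_sdrop:
  assumes "urec \<Phi> N" "urec \<Phi> S" shows "urec \<Phi> (\<lambda>f x. sdrop (N f x) (S f x))"
proof -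
  have "sdrop n s = rec_nat s (\<lambda>m y. stl y) n" for n s
    by (induction n) (simp_all add: sdrop_def)
  then show ?thesis
    by (simp, intro urec_rec_nat urec_stl urec_p1 urec_p2 urec_id assms)
qed

lemma urec_snth: "urec \<Phi> S \<Longrightarrow> urec \<Phi> N \<Longrightarrow> urec \<Phi> (\<lambda>f x. snth (S f x) (N f x))"
  unfolding snth_def by (intro urec_shd urec_sdrop)

lemma urec_llen:
  assumes "urec \<Phi> S" shows "urec \<Phi> (\<lambda>f x. llen (S f x))"
proof -
  \<comment> \<open>The recursion counts the n below m for which something is left after dropping n
    entries.\<close>
  have "rec_nat 0 (\<lambda>n y. y + of_bool (sdrop n s \<noteq> 0)) m = min m (llen s)" for m s
  proof (induction m)
    case (Suc m)
    have "sdrop m s = 0 \<longleftrightarrow> llen s \<le> m"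
      by (metis drop_eq_Nil list_decode_eq_Nil list_decode_sdrop llen_def)
    with Suc show ?case by auto
  qed simp
  then have "llen s = rec_nat 0 (\<lambda>n y. y + of_bool (sdrop n s \<noteq> 0)) s" for s
    by (simp add: llen_le min_absorb2)
  moreover have "urec \<Phi> (\<lambda>f x. rec_nat 0 (\<lambda>n y. y + of_bool (sdrop n (S f x) \<noteq> 0)) (S f x))"
    by (intro urec_rec_nat urec_const assms urec_add urec_of_bool dec_not dec_eq urec_sdrop
        urec_p1 urec_p2 urec_id urec_comp[OF assms])
  ultimately show ?thesis by simp
qed

text \<open>Sequences are stored with the newest entry first, so that extending is consing;
  \<open>seqat t i\<close> counts from the oldest entry.\<close>

definition seqat :: "nat \<Rightarrow> nat \<Rightarrow> nat" where
  "seqat t i = snth t (llen t - Suc i)"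

primrec res :: "(nat \<Rightarrow> nat) \<Rightarrow> nat \<Rightarrow> nat" where
  "res F 0 = 0"
| "res F (Suc k) = scons (F k) (res F k)"

lemma llen_res [simp]: "llen (res F k) = k"
  by (induction k) simp_all

lemma list_decode_res: "list_decode (res F k) = rev (map F [0..<k])"
  by (induction k) simp_all

lemma seqat_res [simp]: "i < k \<Longrightarrow> seqat (res F k) i = F i"
  by (simp add: seqat_def snth_nth list_decode_res rev_nth)

lemma res_cong: "(\<And>i. i < k \<Longrightarrow> F i = G i) \<Longrightarrow> res F k = res G k"
  by (induction k) simp_all

lemma res_seqat [simp]: "res (seqat t) (llen t) = t"
proof -
  have "list_decode (res (seqat t) (llen t)) = list_decode t"
    by (rule nth_equalityI)
      (auto simp: list_decode_res rev_nth seqat_def snth_nth llen_def Suc_diff_Suc)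
  then show ?thesis
    by (metis list_decode_inverse)
qed

lemma seqat_eqI: "llen s = llen t \<Longrightarrow> (\<And>i. i < llen s \<Longrightarrow> seqat s i = seqat t i) \<Longrightarrow> s = t"
  by (metis res_seqat res_cong)

lemma urec_seqat: "urec \<Phi> S \<Longrightarrow> urec \<Phi> N \<Longrightarrow> urec \<Phi> (\<lambda>f x. seqat (S f x) (N f x))"
  unfolding seqat_def by (intro urec_snth urec_diff urec_llen urec_Suc)

lemma urec_res:
  assumes "urec \<Phi> (\<lambda>f z. G f (p1 z) (p2 z))" "urec \<Phi> K"
  shows "urec \<Phi> (\<lambda>f x. res (\<lambda>i. G f i x) (K f x))"
proof -
  have "res F k = rec_nat 0 (\<lambda>i y. scons (F i) y) k" for F k
    by (induction k) simp_all
  moreover have "urec \<Phi> (\<lambda>f x. rec_nat 0 (\<lambda>i y. scons (G f i x) y) (K f x))"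
    using urec_comp[OF assms(1) urec_pair[OF urec_p1[OF urec_id] urec_p2[OF urec_p2[OF urec_id]]]]
    by (intro urec_rec_nat urec_const assms(2) urec_scons urec_p1 urec_p2 urec_id) simp
  ultimately show ?thesis by simp
qed

lemmas rec_intros = urec_id urec_const urec_Suc urec_oracle urec_add urec_diff urec_mult urec_pair
  urec_p1 urec_p2 urec_if urec_of_bool urec_shd urec_stl urec_scons urec_sdrop urec_snth urec_llen
  urec_seqat urec_res dec_const dec_not dec_conj dec_disj dec_imp dec_iff dec_le dec_less dec_eq
  dec_all_less dec_ex_less dec_all_le dec_ex_le

section \<open>Changing the oracle\<close>

text \<open>\<open>Oracle\<close> accepts longer argument lists, whereas p is only known to work on
  a single argument; composing with \<open>Proj 0\<close> cuts the list down.\<close>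

primrec subst_oracle :: "recf \<Rightarrow> recf \<Rightarrow> recf" where
  "subst_oracle p Zr = Zr"
| "subst_oracle p Sc = Sc"
| "subst_oracle p (Proj i) = Proj i"
| "subst_oracle p Oracle = Cn p [Proj 0]"
| "subst_oracle p (Cn h gs) = Cn (subst_oracle p h) (map (subst_oracle p) gs)"
| "subst_oracle p (Rc g h) = Rc (subst_oracle p g) (subst_oracle p h)"
| "subst_oracle p (Mn g) = Mn (subst_oracle p g)"

lemma evaluates_subst_oracle:
  assumes "evaluates g e xs y" and p: "\<And>i. evaluates f p [i] (g i)"
  shows "evaluates f (subst_oracle p e) xs y"
  using assms(1)
proof (induction rule: evaluates.induct)
  case (ev_Oracle x xs)
  have "evaluates f (Proj 0) (x # xs) x"
    using evaluates.ev_Proj[of 0 "x # xs" f] by simp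
  then show ?case
    using p[of x] by (auto intro!: evaluates.ev_Cn[where ys = "[x]"])
next
  case (ev_Cn xs gs ys h z)
  then have "list_all2 (\<lambda>g y. evaluates f g xs y) (map (subst_oracle p) gs) ys"
    by (auto simp: list_all2_map1 elim: list_all2_mono)
  with ev_Cn show ?case
    by (auto intro: evaluates.ev_Cn)
next
  case (ev_Mn g' n xs)
  then have "\<forall>m<n. \<exists>y. evaluates f (subst_oracle p g') (m # xs) (Suc y)"
    by blast
  with ev_Mn show ?case
    by (auto intro: evaluates.ev_Mn)
qed (auto intro: evaluates.intros)

lemma urec_subst:
  assumes "urec \<Psi> P" "urec \<Phi> G" "\<And>f. f \<in> \<Phi> \<Longrightarrow> G f \<in> \<Psi>"
  shows "urec \<Phi> (\<lambda>f. P (G f))"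
  using assms evaluates_subst_oracle unfolding urec_def by metis

lemma dec_subst:
  "dec \<Psi> P \<Longrightarrow> urec \<Phi> G \<Longrightarrow> (\<And>f. f \<in> \<Phi> \<Longrightarrow> G f \<in> \<Psi>) \<Longrightarrow> dec \<Phi> (\<lambda>f. P (G f))"
  unfolding dec_def by (rule urec_subst)

lemma urec_mono: "urec \<Psi> F \<Longrightarrow> \<Phi> \<subseteq> \<Psi> \<Longrightarrow> urec \<Phi> F"
  unfolding urec_def by blast

lemma dec_mono: "dec \<Psi> F \<Longrightarrow> \<Phi> \<subseteq> \<Psi> \<Longrightarrow> dec \<Phi> F"
  unfolding dec_def by (rule urec_mono)

text \<open>The zero function can be computed from any oracle, so its program may replace the calls
  to \<open>no_oracle\<close>.\<close>

lemma urec_no_oracle: "urec {no_oracle} (\<lambda>_. F) \<Longrightarrow> urec \<Phi> (\<lambda>_. F)"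
  using urec_subst[of "{no_oracle}" "\<lambda>_. F" \<Phi> "\<lambda>f x. 0"] by (simp add: no_oracle_def urec_const)

section \<open>Certificates for computations\<close>

primrec code :: "recf \<Rightarrow> nat" where
  "code Zr = pair 0 0"
| "code Sc = pair 1 0"
| "code (Proj i) = pair 2 i"
| "code Oracle = pair 3 0"
| "code (Cn h gs) = pair 4 (pair (code h) (list_encode (map code gs)))"
| "code (Rc g h) = pair 5 (pair (code g) (code h))"
| "code (Mn g) = pair 6 (code g)"

definition item :: "nat \<Rightarrow> nat \<Rightarrow> nat \<Rightarrow> nat" where
  "item e xs y = pair e (pair xs y)"

definition elems :: "nat \<Rightarrow> nat set" where
  "elems W = set (list_decode W)"

text \<open>One disjunct per rule of \<open>evaluates\<close>, selected by the tags of
  \<open>code\<close>; M holds the claims already available. A query beyond the end of u justifies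
  nothing, so claims survive when u is prolonged along the same oracle.\<close>

definition step :: "nat \<Rightarrow> nat set \<Rightarrow> nat \<Rightarrow> nat \<Rightarrow> nat \<Rightarrow> bool" where
  "step u M e xs y \<longleftrightarrow>
     p1 e = 0 \<and> y = 0 \<or>
     p1 e = 1 \<and> xs \<noteq> 0 \<and> y = Suc (shd xs) \<or>
     p1 e = 2 \<and> p2 e < llen xs \<and> y = snth xs (p2 e) \<or>
     p1 e = 3 \<and> xs \<noteq> 0 \<and> shd xs < llen u \<and> y = seqat u (shd xs) \<or>
     p1 e = 4 \<and> (\<exists>ys. llen ys = llen (p2 (p2 e)) \<and>
       (\<forall>i<llen ys. item (snth (p2 (p2 e)) i) xs (snth ys i) \<in> M) \<and> item (p1 (p2 e)) ys y \<in> M) \<or>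
     p1 e = 5 \<and> xs \<noteq> 0 \<and> shd xs = 0 \<and> item (p1 (p2 e)) (stl xs) y \<in> M \<or>
     p1 e = 5 \<and> xs \<noteq> 0 \<and> 0 < shd xs \<and> (\<exists>v. item e (scons (shd xs - 1) (stl xs)) v \<in> M \<and>
       item (p2 (p2 e)) (scons (shd xs - 1) (scons v (stl xs))) y \<in> M) \<or>
     p1 e = 6 \<and> item (p2 e) (scons y xs) 0 \<in> M \<and> (\<forall>m<y. \<exists>v. item (p2 e) (scons m xs) (Suc v) \<in> M)"

text \<open>A certificate lists evaluation claims, each following by one rule from the claims behind it;
  oracle questions are answered from the finite sequence \<open>u\<close>.\<close>

definition valid :: "nat \<Rightarrow> nat \<Rightarrow> bool" where
  "valid u w \<longleftrightarrow> (\<forall>i<llen w. step u (elems (sdrop (Suc i) w))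
     (p1 (snth w i)) (p1 (p2 (snth w i))) (p2 (p2 (snth w i))))"

definition run :: "nat \<Rightarrow> nat \<Rightarrow> nat \<Rightarrow> nat \<Rightarrow> nat \<Rightarrow> bool" where
  "run u w e x y \<longleftrightarrow> valid u w \<and> item e (scons x 0) y \<in> elems w"

lemma item_simps [simp]: "p1 (item e xs y) = e" "p1 (p2 (item e xs y)) = xs" "p2 (p2 (item e xs y)) = y"
  by (simp_all add: item_def)

lemma item_eq_iff [simp]: "item e xs y = item e' xs' y' \<longleftrightarrow> e = e' \<and> xs = xs' \<and> y = y'"
  by (simp add: item_def)

lemma seq_induct [case_names Nil Cons]:
  assumes "P 0" "\<And>a W. P W \<Longrightarrow> P (scons a W)"
  shows "P W"
proof (induction W rule: less_induct)
  case (less W)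
  show ?case
  proof (cases "W = 0")
    case False
    then have W: "W = scons (shd W) (stl W)"
      by (simp add: scons_shd_stl)
    have "stl W \<le> pair (shd W) (stl W)"
      by (rule le_pair)
    with W have "stl W < W"
      by (metis less_Suc_eq_le scons_def)
    from assms(2)[OF less[OF this]] W show ?thesis by metis
  qed (use assms(1) in simp)
qed

lemma elems_simps [simp]: "elems 0 = {}" "elems (scons a W) = insert a (elems W)"
  by (simp_all add: elems_def)

lemma elems_le: "a \<in> elems W \<Longrightarrow> a \<le> W"
proof (induction W rule: seq_induct)
  case (Cons b W)
  then have "a = b \<or> a \<le> W" by auto
  then show ?case
    unfolding scons_def using le_pair(1)[of b W] le_pair(2)[of W b] by linarith
qed simp

lemma snth_scons [simp]: "snth (scons a W) 0 = a" "snth (scons a W) (Suc i) = snth W i"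
  by (simp_all add: snth_def sdrop_def funpow_swap1)

lemma sdrop_scons [simp]: "sdrop 0 W = W" "sdrop (Suc i) (scons a W) = sdrop i W"
  by (simp_all add: sdrop_def funpow_swap1)

lemma elems_snth: "a \<in> elems W \<longleftrightarrow> (\<exists>i<llen W. snth W i = a)"
  by (simp add: elems_def in_set_conv_nth snth_nth flip: llen_def) (auto simp: snth_nth)

lemma valid_simps [simp]:
  "valid u 0" "valid u (scons a W) \<longleftrightarrow> step u (elems W) (p1 a) (p1 (p2 a)) (p2 (p2 a)) \<and> valid u W"
  unfolding valid_def by (auto simp: less_Suc_eq_0_disj)

lemma scons_list_encode: "scons a (list_encode xs) = list_encode (a # xs)"
  by (simp add: scons_def pair_def)

lemma list_encode_simps [simp]: "llen (list_encode xs) = length xs"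
  "shd (list_encode (x # xs)) = x" "stl (list_encode (x # xs)) = list_encode xs"
  by (simp add: llen_def) (simp_all only: scons_simps flip: scons_list_encode)

lemma snth_list_encode [simp]: "i < length xs \<Longrightarrow> snth (list_encode xs) i = xs ! i"
  by (simp add: snth_nth)

lemma list_encode_eq_0 [simp]: "list_encode xs = 0 \<longleftrightarrow> xs = []"
  by (cases xs) simp_all

declare list_encode.simps(2) [simp del]

lemma step_mono: "step u M e xs y \<Longrightarrow> M \<subseteq> N \<Longrightarrow> step u N e xs y"
  unfolding step_def by (elim disj_forward conj_forward ex_forward; blast)

text \<open>The claims of V come in front of those of W; what lies behind each of them only grows,
  and \<open>step\<close> is monotone in that set.\<close>

lemma valid_append: "valid u V \<Longrightarrow> valid u W \<Longrightarrow> valid u (list_encode (list_decode V @ list_decode W))"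
proof (induction V rule: seq_induct)
  case (Cons a V)
  then show ?case
    by (auto simp: elems_def simp flip: scons_list_encode elim!: step_mono)
qed simp

lemma step_oracle_mono: "step (res f k) M e xs y \<Longrightarrow> k \<le> l \<Longrightarrow> step (res f l) M e xs y"
  unfolding step_def llen_res by (elim disj_forward) (assumption | simp)+

lemma valid_oracle_mono: "valid (res f k) w \<Longrightarrow> k \<le> l \<Longrightarrow> valid (res f l) w"
  by (induction w rule: seq_induct) (auto elim: step_oracle_mono)

lemma run_mono: "run (res f k) w e x y \<Longrightarrow> k \<le> l \<Longrightarrow> run (res f l) w e x y"
  unfolding run_def using valid_oracle_mono by blast

text \<open>Induction along the certificate: the newest claim rests on older ones. A claim about the
  code of a program rests only on claims about codes of its subprograms or of itself, so numbers in
  the certificate that code no program do no harm.\<close>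

lemma valid_sound:
  assumes "valid (res f k) W" "item (code e) (list_encode xs) y \<in> elems W"
  shows "evaluates f e xs y"
  using assms
proof (induction W arbitrary: e xs y rule: seq_induct)
  case (Cons a W)
  have IH: "evaluates f e xs y" if "item (code e) (list_encode xs) y \<in> elems W" for e xs y
    using Cons that by simp
  show ?case
  proof (cases "item (code e) (list_encode xs) y \<in> elems W")
    case False
    with Cons have st: "step (res f k) (elems W) (code e) (list_encode xs) y"
      by auto
    show ?thesis
    proof (cases e)
      case Zr
      with st show ?thesis by (simp add: step_def ev_Zr)
    next
      case Sc
      with st show ?thesis by (cases xs) (simp_all add: step_def ev_Sc)
    next
      case (Proj i)
      with st show ?thesis by (auto simp: step_def intro: ev_Proj)
    next
      case Oracle
      with st show ?thesis by (cases xs) (simp_all add: step_def ev_Oracle)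
    next
      case (Cn h gs)
      with st obtain c where c: "llen c = length gs"
        "\<And>i. i < length gs \<Longrightarrow> item (code (gs ! i)) (list_encode xs) (snth c i) \<in> elems W"
        "item (code h) c y \<in> elems W"
        by (auto simp: step_def)
      define ys where "ys = list_decode c"
      have ys: "c = list_encode ys" "length ys = length gs"
        using c(1) by (simp_all add: ys_def llen_def)
      have "list_all2 (\<lambda>g. evaluates f g xs) gs ys"
        using c(2) ys by (auto simp: list_all2_conv_all_nth intro!: IH)
      moreover have "evaluates f h ys y"
        using c(3) ys by (auto intro: IH)
      ultimately show ?thesis
        unfolding Cn by (rule ev_Cn)
    next
      case (Rc g h)
      with st obtain x zs where xs: "xs = x # zs"
        by (cases xs) (auto simp: step_def)
      show ?thesis
      proof (cases x)
        case 0
        with st xs Rc show ?thesis by (auto simp: step_def intro: ev_Rc_0 IH)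
      next
        case (Suc n)
        with st xs Rc obtain v where
          "item (code e) (list_encode (n # zs)) v \<in> elems W"
          "item (code h) (list_encode (n # v # zs)) y \<in> elems W"
          by (auto simp: step_def scons_list_encode)
        from this[THEN IH] show ?thesis
          unfolding Rc xs Suc by (rule ev_Rc_Suc)
      qed
    next
      case (Mn g)
      with st have "item (code g) (list_encode (y # xs)) 0 \<in> elems W"
        "\<forall>m<y. \<exists>v. item (code g) (list_encode (m # xs)) (Suc v) \<in> elems W"
        by (auto simp: step_def scons_list_encode)
      then show ?thesis
        unfolding Mn using IH by (blast intro: ev_Mn)
    qed
  qed (rule IH)
qed simp

text \<open>Validity is required for all sufficiently long segments of the oracle, so that
  certificates obtained with different segments can be merged.\<close>

definition derivable :: "(nat \<Rightarrow> nat) \<Rightarrow> nat set \<Rightarrow> bool" where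
  "derivable f A \<longleftrightarrow> (\<exists>W k0. A \<subseteq> elems W \<and> (\<forall>k\<ge>k0. valid (res f k) W))"

lemma derivable_finite:
  assumes "finite A" "\<And>a. a \<in> A \<Longrightarrow> derivable f {a}"
  shows "derivable f A"
  using assms
proof (induction A rule: finite_induct)
  case empty
  show ?case
    unfolding derivable_def by (intro exI[of _ 0]) simp
next
  case (insert a A)
  then have "derivable f A" "derivable f {a}"
    by simp_all
  then obtain V k W l where V: "A \<subseteq> elems V" "\<forall>i\<ge>k. valid (res f i) V"
    and W: "{a} \<subseteq> elems W" "\<forall>i\<ge>l. valid (res f i) W"
    unfolding derivable_def by (elim exE conjE)
  let ?U = "list_encode (list_decode V @ list_decode W)"
  have "insert a A \<subseteq> elems ?U"
    using V(1) W(1) by (auto simp: elems_def)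
  moreover have "\<forall>i\<ge>max k l. valid (res f i) ?U"
    using V(2) W(2) by (simp add: valid_append)
  ultimately show ?case
    unfolding derivable_def by blast
qed

text \<open>A rule has finitely many premises; their certificates are merged and the conclusion is
  put in front.\<close>

lemma derivable_step:
  assumes "finite A" "\<And>a. a \<in> A \<Longrightarrow> derivable f {a}" "\<And>k. k0 \<le> k \<Longrightarrow> step (res f k) A e xs y"
  shows "derivable f {item e xs y}"
proof -
  from assms(1,2) have "derivable f A"
    by (rule derivable_finite)
  then obtain W k where W: "A \<subseteq> elems W" "\<forall>i\<ge>k. valid (res f i) W"
    unfolding derivable_def by (elim exE conjE)
  have "\<forall>i\<ge>max k k0. valid (res f i) (scons (item e xs y) W)"
    using W assms(3) by (auto intro: step_mono)
  moreover have "{item e xs y} \<subseteq> elems (scons (item e xs y) W)"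
    by simp
  ultimately show ?thesis
    unfolding derivable_def by blast
qed

lemma evaluates_derivable:
  "evaluates f e xs y \<Longrightarrow> derivable f {item (code e) (list_encode xs) y}"
proof (induction rule: evaluates.induct)
  case (ev_Zr xs)
  show ?case by (rule derivable_step[of "{}"]) (auto simp: step_def)
next
  case (ev_Sc x xs)
  show ?case by (rule derivable_step[of "{}"]) (auto simp: step_def)
next
  case (ev_Proj i xs)
  then show ?case by (intro derivable_step[of "{}"]) (auto simp: step_def)
next
  case (ev_Oracle x xs)
  \<comment> \<open>Length \<open>Suc x\<close> is where the oracle segment first contains position
    x.\<close>
  show ?case by (rule derivable_step[of "{}" _ "Suc x"]) (auto simp: step_def)
next
  case (ev_Cn xs gs ys h z)
  let ?A = "insert (item (code h) (list_encode ys) z)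
    ((\<lambda>i. item (code (gs ! i)) (list_encode xs) (ys ! i)) ` {..<length gs})"
  have len: "length gs = length ys"
    using ev_Cn.IH(1) by (rule list_all2_lengthD)
  show ?case
  proof (rule derivable_step[of ?A])
    show "derivable f {a}" if "a \<in> ?A" for a
      using that ev_Cn.IH by (auto simp: list_all2_conv_all_nth)
    show "step (res f k) ?A (code (Cn h gs)) (list_encode xs) z" for k
      using len by (auto simp: step_def intro!: exI[of _ "list_encode ys"])
  qed auto
next
  case (ev_Rc_0 g xs y h)
  then show ?case
    by (intro derivable_step[of "{item (code g) (list_encode xs) y}"]) (auto simp: step_def)
next
  case (ev_Rc_Suc g h n xs y z)
  then show ?case
    by (intro derivable_step[of "{item (code (Rc g h)) (list_encode (n # xs)) y,
          item (code h) (list_encode (n # y # xs)) z}"]) (auto simp: step_def scons_list_encode)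
next
  case (ev_Mn g n xs)
  then obtain v where v: "\<And>m. m < n \<Longrightarrow> derivable f {item (code g) (list_encode (m # xs)) (Suc (v m))}"
    by metis
  show ?case
    by (rule derivable_step[of "insert (item (code g) (list_encode (n # xs)) 0)
          ((\<lambda>m. item (code g) (list_encode (m # xs)) (Suc (v m))) ` {..<n})"])
      (use ev_Mn.IH v in \<open>auto simp: step_def scons_list_encode\<close>)
qed

text \<open>Kleene's normal form, including the use principle: a halting computation consults only
  finitely many oracle values, and whether w certifies it is decidable.\<close>

lemma evaluates_iff_run: "evaluates f e [x] y \<longleftrightarrow> (\<exists>k w. run (res f k) w (code e) x y)"
proof
  assume "evaluates f e [x] y"
  then have "derivable f {item (code e) (list_encode [x]) y}"
    by (rule evaluates_derivable)
  then show "\<exists>k w. run (res f k) w (code e) x y"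
    unfolding derivable_def run_def by (auto simp flip: scons_list_encode)
next
  assume "\<exists>k w. run (res f k) w (code e) x y"
  then show "evaluates f e [x] y"
    unfolding run_def using valid_sound[of f _ _ e "[x]" y] by (auto simp flip: scons_list_encode)
qed

lemma evaluates_deterministic:
  "evaluates f e xs y \<Longrightarrow> evaluates f e xs z \<Longrightarrow> y = z"
proof (induction arbitrary: z rule: evaluates.induct)
  case (ev_Zr xs)
  then show ?case by (cases rule: evaluates.cases) auto
next
  case (ev_Sc x xs)
  then show ?case by (cases rule: evaluates.cases) auto
next
  case (ev_Proj i xs)
  from ev_Proj(2) show ?case by (cases rule: evaluates.cases) auto
next
  case (ev_Oracle x xs)
  then show ?case by (cases rule: evaluates.cases) auto
next
  case (ev_Cn xs gs ys h z')
  from ev_Cn.prems obtain ys' where ys': "list_all2 (\<lambda>g y. evaluates f g xs y) gs ys'" "evaluates f h ys' z"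
    by (cases rule: evaluates.cases) auto
  have "ys = ys'"
    using ev_Cn.IH(1) ys'(1) by (auto simp: list_all2_conv_all_nth intro!: nth_equalityI)
  with ev_Cn.IH(2) ys'(2) show ?case by simp
next
  case (ev_Rc_0 g xs y h)
  from ev_Rc_0.prems show ?case
    by (cases rule: evaluates.cases) (auto intro: ev_Rc_0.IH)
next
  case (ev_Rc_Suc g h n xs y z')
  from ev_Rc_Suc.prems obtain y' where "evaluates f (Rc g h) (n # xs) y'" "evaluates f h (n # y' # xs) z"
    by (cases rule: evaluates.cases) auto
  with ev_Rc_Suc.IH show ?case by metis
next
  case (ev_Mn g n xs)
  from ev_Mn.prems have z: "evaluates f g (z # xs) 0" "\<forall>m<z. \<exists>y. evaluates f g (m # xs) (Suc y)"
    by (cases rule: evaluates.cases; auto)+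
  show ?case
  proof (rule linorder_cases[of n z])
    assume "n < z"
    with z(2) ev_Mn.IH(1) show ?thesis by blast
  next
    assume "z < n"
    with z(1) ev_Mn.IH(2) show ?thesis by blast
  qed
qed

section \<open>Checking certificates is computable\<close>

lemma dec_mem:
  assumes "urec \<Phi> A" "urec \<Phi> W" shows "dec \<Phi> (\<lambda>f x. A f x \<in> elems (W f x))"
proof -
  have "dec \<Phi> (\<lambda>f t. \<exists>i<llen (p2 t). snth (p2 t) i = p1 t)"
    by (intro rec_intros)
  from dec_comp[OF this urec_pair[OF assms]] show ?thesis
    by (simp add: elems_snth)
qed

lemma urec_item: "urec \<Phi> E \<Longrightarrow> urec \<Phi> X \<Longrightarrow> urec \<Phi> Y \<Longrightarrow> urec \<Phi> (\<lambda>f x. item (E f x) (X f x) (Y f x))"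
  unfolding item_def by (intro rec_intros)

lemma elems_item_le:
  assumes "item e xs y \<in> elems W" shows "xs \<le> W" "y \<le> W"
proof -
  have "pair xs y \<le> item e xs y"
    unfolding item_def by (rule le_pair)
  with elems_le[OF assms] le_pair(1)[of xs y] le_pair(2)[of y xs] show "xs \<le> W" "y \<le> W"
    by linarith+
qed

text \<open>Every claim in a list is at most the code of the list, and its components are at most
  the claim. The existential quantifiers of \<open>step\<close> can thus be bounded by W, which
  makes it decidable.\<close>

lemma step_bounded: "step u (elems W) e xs y \<longleftrightarrow>
     p1 e = 0 \<and> y = 0 \<or>
     p1 e = 1 \<and> xs \<noteq> 0 \<and> y = Suc (shd xs) \<or>
     p1 e = 2 \<and> p2 e < llen xs \<and> y = snth xs (p2 e) \<or>
     p1 e = 3 \<and> xs \<noteq> 0 \<and> shd xs < llen u \<and> y = seqat u (shd xs) \<or>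
     p1 e = 4 \<and> (\<exists>ys\<le>W. llen ys = llen (p2 (p2 e)) \<and>
       (\<forall>i<llen ys. item (snth (p2 (p2 e)) i) xs (snth ys i) \<in> elems W) \<and> item (p1 (p2 e)) ys y \<in> elems W) \<or>
     p1 e = 5 \<and> xs \<noteq> 0 \<and> shd xs = 0 \<and> item (p1 (p2 e)) (stl xs) y \<in> elems W \<or>
     p1 e = 5 \<and> xs \<noteq> 0 \<and> 0 < shd xs \<and> (\<exists>v\<le>W. item e (scons (shd xs - 1) (stl xs)) v \<in> elems W \<and>
       item (p2 (p2 e)) (scons (shd xs - 1) (scons v (stl xs))) y \<in> elems W) \<or>
     p1 e = 6 \<and> item (p2 e) (scons y xs) 0 \<in> elems W \<and>
       (\<forall>m<y. \<exists>v\<le>W. item (p2 e) (scons m xs) (Suc v) \<in> elems W)"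
proof -
  have bd: "(\<exists>v. P v) \<longleftrightarrow> (\<exists>v\<le>W. P v)" if "\<And>v. P v \<Longrightarrow> v \<le> W" for P
    using that by blast
  have "(\<exists>ys. llen ys = llen (p2 (p2 e)) \<and>
       (\<forall>i<llen ys. item (snth (p2 (p2 e)) i) xs (snth ys i) \<in> elems W) \<and> item (p1 (p2 e)) ys y \<in> elems W) \<longleftrightarrow>
     (\<exists>ys\<le>W. llen ys = llen (p2 (p2 e)) \<and>
       (\<forall>i<llen ys. item (snth (p2 (p2 e)) i) xs (snth ys i) \<in> elems W) \<and> item (p1 (p2 e)) ys y \<in> elems W)"
    by (rule bd) (elim conjE, drule elems_item_le(1)[of "p1 (p2 e)"], assumption)
  moreover have "(\<exists>v. item e (scons (shd xs - 1) (stl xs)) v \<in> elems W \<and>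
       item (p2 (p2 e)) (scons (shd xs - 1) (scons v (stl xs))) y \<in> elems W) \<longleftrightarrow>
     (\<exists>v\<le>W. item e (scons (shd xs - 1) (stl xs)) v \<in> elems W \<and>
       item (p2 (p2 e)) (scons (shd xs - 1) (scons v (stl xs))) y \<in> elems W)"
    by (rule bd) (elim conjE, erule elems_item_le(2))
  moreover have "(\<exists>v. item (p2 e) (scons m xs) (Suc v) \<in> elems W) \<longleftrightarrow>
     (\<exists>v\<le>W. item (p2 e) (scons m xs) (Suc v) \<in> elems W)" for m
    by (rule bd) (drule elems_item_le(2), simp)
  ultimately show ?thesis
    unfolding step_def by (simp only:)
qed

lemma dec_step:
  "dec \<Phi> (\<lambda>f t. step (p1 t) (elems (p1 (p2 t))) (p1 (p2 (p2 t))) (p1 (p2 (p2 (p2 t)))) (p2 (p2 (p2 (p2 t)))))"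
  unfolding step_bounded by (intro rec_intros dec_mem urec_item)

lemma dec_valid: "dec \<Phi> (\<lambda>f t. valid (p1 t) (p2 t))"
proof -
  have "urec \<Phi> (\<lambda>f z. pair (p1 (p2 z)) (pair (sdrop (Suc (p1 z)) (p2 (p2 z)))
      (pair (p1 (snth (p2 (p2 z)) (p1 z))) (pair (p1 (p2 (snth (p2 (p2 z)) (p1 z))))
        (p2 (p2 (snth (p2 (p2 z)) (p1 z))))))))"
    by (intro rec_intros)
  from dec_comp[OF dec_step this]
  have "dec \<Phi> (\<lambda>f z. step (p1 (p2 z)) (elems (sdrop (Suc (p1 z)) (p2 (p2 z))))
     (p1 (snth (p2 (p2 z)) (p1 z))) (p1 (p2 (snth (p2 (p2 z)) (p1 z)))) (p2 (p2 (snth (p2 (p2 z)) (p1 z)))))"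
    by (simp only: pair_simps)
  moreover have "urec \<Phi> (\<lambda>f t. llen (p2 t))"
    by (intro rec_intros)
  ultimately show ?thesis
    unfolding valid_def by (intro dec_all_less)
qed

lemma dec_run:
  assumes "urec \<Phi> U" "urec \<Phi> W" "urec \<Phi> E" "urec \<Phi> X" "urec \<Phi> Y"
  shows "dec \<Phi> (\<lambda>f x. run (U f x) (W f x) (E f x) (X f x) (Y f x))"
proof -
  have "dec \<Phi> (\<lambda>f x. valid (U f x) (W f x))"
    using dec_comp[OF dec_valid urec_pair[OF assms(1,2)]] by simp
  then show ?thesis
    unfolding run_def using assms by (intro dec_conj dec_mem urec_item urec_scons urec_const)
qed

section \<open>Connection with the given notions of computability\<close>

lemma ce_setD:
  assumes "ce_set R"
  shows "\<exists>e. R = {n. \<exists>y k w. run (res no_oracle k) w e n y}"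
  using assms unfolding ce_set_def evaluates_iff_run by blast

lemma ce_setI:
  assumes "dec {no_oracle} (\<lambda>f n. P n)"
  shows "ce_set {n. P n}"
proof -
  \<comment> \<open>The first argument is the search variable of \<open>Mn\<close>. The value
    depends on the second one only, so the search stops at 0 or never.\<close>
  have "nrec {no_oracle} 2 (\<lambda>f xs. 1 - of_bool (P (xs ! 1)))"
    by (intro nrec_diff nrec_const nrec_urec[OF assms[unfolded dec_def]] nrec_proj) simp
  then obtain e where e0: "\<forall>xs. length xs = 2 \<longrightarrow> evaluates no_oracle e xs (1 - of_bool (P (xs ! 1)))"
    unfolding nrec_def by blast
  have e: "evaluates no_oracle e [m, n] (1 - of_bool (P n))" for m n
    using e0[rule_format, of "[m, n]"] by simp
  have "(\<exists>y. evaluates no_oracle (Mn e) [n] y) \<longleftrightarrow> P n" for n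
  proof
    assume "\<exists>y. evaluates no_oracle (Mn e) [n] y"
    then obtain y where "evaluates no_oracle e [y, n] 0"
      by (auto elim: evaluates.cases)
    from evaluates_deterministic[OF this e] show "P n"
      by (cases "P n") auto
  next
    assume "P n"
    then have "evaluates no_oracle (Mn e) [n] 0"
      using e[of 0 n] by (auto intro!: ev_Mn)
    then show "\<exists>y. evaluates no_oracle (Mn e) [n] y" ..
  qed
  then show ?thesis
    unfolding ce_set_def by blast
qed

lemma nrec_pairs:
  assumes "nrec {f} k (\<lambda>_. F)" "length Gs = k" "\<forall>G\<in>set Gs. urec {f} (\<lambda>_. G)"
  shows "urec {f} (\<lambda>_ x. F (map (\<lambda>G. G x) Gs))"
  using nrec_Cn[of "{f}" "map (\<lambda>G f xs. G (hd xs)) Gs" "\<lambda>_. F" 1] assms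
  by (simp add: urec_nrec comp_def)

lemma computable_rel_in_nrec:
  "computable_rel_in f k P \<longleftrightarrow> nrec {f} k (\<lambda>_ xs. of_bool (P xs))"
  by (simp add: computable_rel_in_def nrec_def of_bool_def)

lemma computable_rel_in_2:
  "computable_rel_in f 2 (\<lambda>xs. (xs ! 0, xs ! 1) \<in> r) \<longleftrightarrow> dec {f} (\<lambda>_ x. (p1 x, p2 x) \<in> r)"
proof
  assume "computable_rel_in f 2 (\<lambda>xs. (xs ! 0, xs ! 1) \<in> r)"
  then show "dec {f} (\<lambda>_ x. (p1 x, p2 x) \<in> r)"
    using nrec_pairs[of f 2 "\<lambda>xs. of_bool ((xs ! 0, xs ! 1) \<in> r)" "[p1, p2]"]
    by (simp add: computable_rel_in_nrec dec_def urec_p1 urec_p2 urec_id)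
next
  assume "dec {f} (\<lambda>_ x. (p1 x, p2 x) \<in> r)"
  from nrec_urec[OF this[unfolded dec_def] nrec_pair[OF nrec_proj[of 0 2] nrec_proj[of 1 2]]]
  show "computable_rel_in f 2 (\<lambda>xs. (xs ! 0, xs ! 1) \<in> r)"
    by (simp add: computable_rel_in_nrec)
qed

lemma computable_rel_in_4D:
  assumes "computable_rel_in f 4 (\<lambda>xs. P (xs ! 0) (xs ! 1) (xs ! 2) (xs ! 3))"
  shows "dec {f} (\<lambda>_ x. P (p1 x) (p1 (p2 x)) (p1 (p2 (p2 x))) (p2 (p2 (p2 x))))"
  using nrec_pairs[of f 4 "\<lambda>xs. of_bool (P (xs ! 0) (xs ! 1) (xs ! 2) (xs ! 3))"
      "[p1, \<lambda>x. p1 (p2 x), \<lambda>x. p1 (p2 (p2 x)), \<lambda>x. p2 (p2 (p2 x))]"] assms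
  by (simp add: computable_rel_in_nrec dec_def urec_p1 urec_p2 urec_id numeral_2_eq_2 numeral_3_eq_3)

lemma computable_rel_in_4I:
  assumes "dec {f} (\<lambda>_ x. P (p1 x) (p1 (p2 x)) (p1 (p2 (p2 x))) (p2 (p2 (p2 x))))"
  shows "computable_rel_in f 4 (\<lambda>xs. P (xs ! 0) (xs ! 1) (xs ! 2) (xs ! 3))"
  using nrec_urec[OF assms[unfolded dec_def] nrec_pair[OF nrec_proj[of 0 4] nrec_pair[OF nrec_proj[of 1 4]
        nrec_pair[OF nrec_proj[of 2 4] nrec_proj[of 3 4]]]]]
  by (simp add: computable_rel_in_nrec)

lemma dec_no_oracle: "dec {no_oracle} (\<lambda>_. P) \<Longrightarrow> dec \<Phi> (\<lambda>_. P)"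
  unfolding dec_def by (rule urec_no_oracle)

section \<open>Analytic predicates and their trees\<close>

definition join :: "(nat \<Rightarrow> nat) \<Rightarrow> (nat \<Rightarrow> nat) \<Rightarrow> nat \<Rightarrow> nat" where
  "join z h = (\<lambda>i. pair (z i) (h i))"

definition left :: "(nat \<Rightarrow> nat) \<Rightarrow> nat \<Rightarrow> nat" where
  "left z = (\<lambda>i. p1 (z i))"

definition right :: "(nat \<Rightarrow> nat) \<Rightarrow> nat \<Rightarrow> nat" where
  "right z = (\<lambda>i. p2 (z i))"

lemma join_simps [simp]: "left (join z h) = z" "right (join z h) = h" "join (left z) (right z) = z"
  by (simp_all add: join_def left_def right_def)

lemma join_apply: "join z h i = pair (z i) (h i)" "left z i = p1 (z i)" "right z i = p2 (z i)"
  by (simp_all add: join_def left_def right_def)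

text \<open>The normal form of a lightface \<open>\<Sigma>\<^sup>1\<^sub>1\<close> set of functions,
  with a matrix decided by one program that is total for every oracle. The point and the witness
  share the oracle through \<open>join\<close>.\<close>

definition S11 :: "((nat \<Rightarrow> nat) \<Rightarrow> bool) \<Rightarrow> bool" where
  "S11 A \<longleftrightarrow> (\<exists>P. dec UNIV P \<and> (\<forall>z. A z \<longleftrightarrow> (\<exists>h. \<forall>x. P (join z h) x)))"

lemma S11I:
  assumes "dec UNIV (\<lambda>f x. P (left f) (right f) x)"
  shows "S11 (\<lambda>z. \<exists>h. \<forall>x. P z h x)"
  unfolding S11_def by (intro exI[of _ "\<lambda>f x. P (left f) (right f) x"]) (simp add: assms)

lemma S11_conj:
  assumes "S11 A" "S11 B" shows "S11 (\<lambda>z. A z \<and> B z)"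
proof -
  obtain P where P: "dec UNIV P" "\<And>z. A z \<longleftrightarrow> (\<exists>h. \<forall>x. P (join z h) x)"
    using assms(1) unfolding S11_def by blast
  obtain Q where Q: "dec UNIV Q" "\<And>z. B z \<longleftrightarrow> (\<exists>h. \<forall>x. Q (join z h) x)"
    using assms(2) unfolding S11_def by blast
  have "A z \<and> B z \<longleftrightarrow> (\<exists>h. \<forall>x. P (join z (left h)) x \<and> Q (join z (right h)) x)" for z
    unfolding P(2) Q(2) by (metis join_simps(1,2))
  moreover have "S11 (\<lambda>z. \<exists>h. \<forall>x. P (join z (left h)) x \<and> Q (join z (right h)) x)"
    by (intro S11I dec_conj dec_subst[OF P(1)] dec_subst[OF Q(1)] UNIV_I)
      (simp_all only: join_def left_def right_def, (intro rec_intros)+)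
  ultimately show ?thesis by simp
qed

lemma S11_subst:
  assumes "S11 A" "urec UNIV F" shows "S11 (\<lambda>z. A (F z))"
proof -
  obtain P where P: "dec UNIV P" "\<And>z. A z \<longleftrightarrow> (\<exists>h. \<forall>x. P (join z h) x)"
    using assms(1) unfolding S11_def by blast
  have "urec UNIV (\<lambda>f. F (left f))"
    by (rule urec_subst[OF assms(2)]) (simp_all only: left_def UNIV_I, intro rec_intros)
  then have "urec UNIV (\<lambda>f. join (F (left f)) (right f))"
    unfolding join_def right_def by (intro urec_pair rec_intros)
  from dec_subst[OF P(1) this] have "S11 (\<lambda>z. \<exists>h. \<forall>x. P (join (F z) h) x)"
    by (intro S11I) simp
  then show ?thesis
    by (simp add: P(2))
qed

text \<open>A refutation found so far: program a yields 0, that is false, at some x. The length of u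
  bounds both the certificate and x, which makes the test decidable; longer segments of the same
  oracle keep every refutation.\<close>

definition bad :: "nat \<Rightarrow> nat \<Rightarrow> bool" where
  "bad a u \<longleftrightarrow> (\<exists>w\<le>llen u. \<exists>x\<le>llen u. run u w a x 0)"

definition branch :: "nat \<Rightarrow> (nat \<Rightarrow> nat) \<Rightarrow> (nat \<Rightarrow> nat) \<Rightarrow> bool" where
  "branch a z h \<longleftrightarrow> (\<forall>k. \<not> bad a (res (join z h) k))"

text \<open>Only the witness is guessed; the point z is read off to the length of t. Any number a
  may serve as index, which lets the diagonal set range over all n.\<close>

definition tree :: "nat \<Rightarrow> (nat \<Rightarrow> nat) \<Rightarrow> nat set" where
  "tree a z = {t. \<not> bad a (res (\<lambda>i. pair (z i) (seqat t i)) (llen t))}"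

lemma bad_mono: "bad a (res F k) \<Longrightarrow> k \<le> l \<Longrightarrow> bad a (res F l)"
  unfolding bad_def llen_res using run_mono order_trans by metis

text \<open>The index is the code of the program deciding the matrix. Where the matrix fails, the
  program halts with value 0, and this shows up as \<open>bad\<close> on a long enough segment; by
  determinism of \<open>evaluates\<close>, \<open>bad\<close> occurs only then.\<close>

theorem S11_index:
  assumes "S11 A" shows "\<exists>a. \<forall>z. A z \<longleftrightarrow> (\<exists>h. branch a z h)"
proof -
  obtain P where P: "dec UNIV P" "\<And>z. A z \<longleftrightarrow> (\<exists>h. \<forall>x. P (join z h) x)"
    using assms(1) unfolding S11_def by blast
  obtain e where e: "\<And>f x. evaluates f e [x] (of_bool (P f x))"
    using P(1) unfolding dec_def urec_def by blast
  have "(\<forall>x. P f x) \<longleftrightarrow> (\<forall>k. \<not> bad (code e) (res f k))" for f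
  proof (intro iffI allI)
    fix k
    assume P: "\<forall>x. P f x"
    show "\<not> bad (code e) (res f k)"
    proof
      assume "bad (code e) (res f k)"
      then obtain x where "evaluates f e [x] 0"
        unfolding bad_def evaluates_iff_run by blast
      from evaluates_deterministic[OF this e] P show False
        by simp
    qed
  next
    fix x
    assume nb: "\<forall>k. \<not> bad (code e) (res f k)"
    show "P f x"
    proof (rule ccontr)
      assume "\<not> P f x"
      then have "evaluates f e [x] 0"
        using e[of f x] by simp
      then obtain k w where "run (res f k) w (code e) x 0"
        unfolding evaluates_iff_run by blast
      \<comment> \<open>This length covers the oracle use k, the certificate w and the argument x at
        once.\<close>
      then have "run (res f (k + w + x)) w (code e) x 0"
        by (rule run_mono) simp
      then have "bad (code e) (res f (k + w + x))"
        unfolding bad_def llen_res by (intro exI[of _ w] exI[of _ x] conjI) simp_all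
      with nb show False by blast
    qed
  qed
  then show ?thesis
    unfolding P(2) branch_def by blast
qed

lemma res_in_tree: "res h k \<in> tree a z \<longleftrightarrow> \<not> bad a (res (join z h) k)"
proof -
  have "res (\<lambda>i. pair (z i) (seqat (res h k) i)) k = res (join z h) k"
    by (rule res_cong) (simp add: join_def)
  then show ?thesis
    by (simp add: tree_def)
qed

lemma branch_tree: "branch a z h \<longleftrightarrow> (\<forall>k. res h k \<in> tree a z)"
  by (simp add: branch_def res_in_tree)

lemma dec_bad: "urec \<Phi> A \<Longrightarrow> urec \<Phi> U \<Longrightarrow> dec \<Phi> (\<lambda>f x. bad (A f x) (U f x))"
proof -
  assume "urec \<Phi> A" "urec \<Phi> U"
  have "dec \<Phi> (\<lambda>f t. bad (p1 t) (p2 t))"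
    unfolding bad_def by (intro rec_intros dec_run)
  from dec_comp[OF this urec_pair[OF \<open>urec \<Phi> A\<close> \<open>urec \<Phi> U\<close>]] show ?thesis
    by simp
qed

lemma dec_tree:
  assumes "urec \<Phi> T" "urec \<Phi> A" "urec \<Phi> (\<lambda>f q. Z f (p1 q) (p2 q))"
  shows "dec \<Phi> (\<lambda>f x. T f x \<in> tree (A f x) (\<lambda>i. Z f i x))"
  unfolding tree_def mem_Collect_eq
  by (intro dec_not dec_bad urec_res urec_pair urec_seqat urec_llen assms
      urec_comp[OF assms(1)] urec_p1 urec_p2 urec_id)

section \<open>The Kleene--Brouwer ordering\<close>

definition slt :: "nat \<Rightarrow> nat \<Rightarrow> nat \<Rightarrow> bool" where
  "slt s t i \<longleftrightarrow> i < llen s \<and> (i < llen t \<longrightarrow> seqat s i < seqat t i)"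

definition seqv :: "nat \<Rightarrow> nat \<Rightarrow> nat \<Rightarrow> bool" where
  "seqv s t i \<longleftrightarrow> (i < llen s \<longleftrightarrow> i < llen t) \<and> (i < llen s \<longrightarrow> seqat s i = seqat t i)"

text \<open>The end of a sequence counts as larger than every entry.\<close>

definition kbl :: "nat \<Rightarrow> nat \<Rightarrow> bool" where
  "kbl s t \<longleftrightarrow> (\<exists>i<llen s. slt s t i \<and> (\<forall>j<i. seqv s t j))"

definition KB :: "nat set \<Rightarrow> nat rel" where
  "KB T = {(s, t). s \<in> T \<and> t \<in> T \<and> (s = t \<or> kbl s t)}"

lemma dec_kbl: "urec \<Phi> S \<Longrightarrow> urec \<Phi> T \<Longrightarrow> dec \<Phi> (\<lambda>f x. kbl (S f x) (T f x))"
proof -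
  assume "urec \<Phi> S" "urec \<Phi> T"
  have "dec \<Phi> (\<lambda>f t. kbl (p1 t) (p2 t))"
    unfolding kbl_def slt_def seqv_def by (intro rec_intros)
  from dec_comp[OF this urec_pair[OF \<open>urec \<Phi> S\<close> \<open>urec \<Phi> T\<close>]] show ?thesis
    by simp
qed

lemma kblI: "slt s t i \<Longrightarrow> (\<And>j. j < i \<Longrightarrow> seqv s t j) \<Longrightarrow> kbl s t"
  unfolding kbl_def by (intro exI[of _ i]) (simp add: slt_def)

lemma kbl_irrefl: "\<not> kbl s s"
  by (auto simp: kbl_def slt_def)

lemma slt_trans: "slt s t i \<Longrightarrow> slt t u i \<Longrightarrow> slt s u i"
  by (auto simp: slt_def)

lemma slt_seqv: "slt s t i \<Longrightarrow> seqv t u i \<Longrightarrow> slt s u i" "seqv s t i \<Longrightarrow> slt t u i \<Longrightarrow> slt s u i"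
  by (auto simp: slt_def seqv_def)

lemma seqv_trans: "seqv s t i \<Longrightarrow> seqv t u i \<Longrightarrow> seqv s u i"
  by (auto simp: seqv_def)

lemma kbl_trans:
  assumes "kbl s t" "kbl t u" shows "kbl s u"
proof -
  obtain i where i: "slt s t i" "\<forall>j<i. seqv s t j"
    using assms(1) by (auto simp: kbl_def)
  obtain k where k: "slt t u k" "\<forall>j<k. seqv t u j"
    using assms(2) by (auto simp: kbl_def)
  have "slt s u (min i k)"
  proof (cases i k rule: linorder_cases)
    case less
    with i k slt_seqv(1)[of s t i u] show ?thesis by (simp add: min_absorb1)
  next
    case equal
    with i k slt_trans[of s t i u] show ?thesis by simp
  next
    case greater
    with i k slt_seqv(2)[of s t k u] show ?thesis by (simp add: min_absorb2)
  qed
  moreover have "seqv s u j" if "j < min i k" for j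
    using i k that seqv_trans[of s t j u] by simp
  ultimately show ?thesis
    by (rule kblI)
qed

lemma kbl_total:
  assumes "s \<noteq> t" shows "kbl s t \<or> kbl t s"
proof -
  have ex: "\<exists>i. \<not> seqv s t i"
  proof (rule ccontr)
    assume "\<nexists>i. \<not> seqv s t i"
    then have eqv: "seqv s t i" for i by blast
    have "llen s = llen t"
      using eqv[of "llen s"] eqv[of "llen t"] by (simp add: seqv_def not_less)
    moreover have "seqat s i = seqat t i" if "i < llen s" for i
      using eqv[of i] that by (simp add: seqv_def)
    ultimately show False
      using assms seqat_eqI by blast
  qed
  define i where "i = (LEAST i. \<not> seqv s t i)"
  have ne: "\<not> seqv s t i"
    using LeastI_ex[OF ex] by (simp add: i_def)
  have eqv: "seqv s t j" if "j < i" for j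
    using not_less_Least that unfolding i_def by blast
  have "seqv t s j" if "j < i" for j
    using eqv[OF that] by (auto simp: seqv_def)
  moreover have "slt s t i \<or> slt t s i"
    using ne unfolding seqv_def slt_def by linarith
  ultimately show ?thesis
    using eqv kblI by blast
qed

definition prefix_of :: "nat \<Rightarrow> nat \<Rightarrow> bool" where
  "prefix_of p q \<longleftrightarrow> llen p \<le> llen q \<and> (\<forall>i<llen p. seqat p i = seqat q i)"

lemma prefix_of_res: "prefix_of p q \<Longrightarrow> p = res (seqat q) (llen p)"
  by (rule seqat_eqI) (simp_all add: prefix_of_def)

lemma seqat_scons [simp]:
  "i < llen p \<Longrightarrow> seqat (scons a p) i = seqat p i" "seqat (scons a p) (llen p) = a"
proof -
  assume "i < llen p"
  then have *: "llen p - i = Suc (llen p - Suc i)"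
    by simp
  show "seqat (scons a p) i = seqat p i"
    by (simp only: seqat_def scons_simps diff_Suc_Suc snth_scons *)
qed (simp add: seqat_def)

lemma prefix_of_scons:
  "prefix_of (scons a p) q \<longleftrightarrow> prefix_of p q \<and> llen p < llen q \<and> seqat q (llen p) = a"
  by (auto simp: prefix_of_def less_Suc_eq)

text \<open>A nonempty Q without least element yields a leftmost branch. A sequence p is
  \<open>good\<close> if some member of Q extends it and all such members come before the rest of Q;
  continuing p by the least entry that occurs next in Q keeps it \<open>good\<close>.\<close>

lemma kbl_minimal:
  assumes closed: "\<And>t j. t \<in> T \<Longrightarrow> j \<le> llen t \<Longrightarrow> res (seqat t) j \<in> T"
    and no_branch: "\<And>h. \<exists>k. res h k \<notin> T"
    and Q: "Q \<subseteq> T" "Q \<noteq> {}"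
  shows "\<exists>m\<in>Q. \<forall>q\<in>Q. \<not> kbl q m"
proof (rule ccontr)
  assume "\<not> ?thesis"
  then have nomin: "\<exists>q\<in>Q. kbl q m" if "m \<in> Q" for m
    using that by blast
  define good where "good p \<longleftrightarrow> (\<exists>q\<in>Q. prefix_of p q) \<and>
    (\<forall>q\<in>Q. prefix_of p q \<or> (\<forall>s\<in>Q. prefix_of p s \<longrightarrow> kbl s q))" for p
  have step: "\<exists>a. good (scons a p)" if p: "good p" for p
  proof -
    \<comment> \<open>Otherwise p would be the only member of Q extending p, and being
      \<open>good\<close> would make it the least element.\<close>
    have ex: "\<exists>a. \<exists>s\<in>Q. prefix_of p s \<and> llen p < llen s \<and> seqat s (llen p) = a"
    proof (rule ccontr)
      assume none: "\<not> ?thesis"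
      have eq: "q = p" if "q \<in> Q" "prefix_of p q" for q
      proof -
        have "\<not> llen p < llen q"
          using none that by blast
        with that(2) have "llen p = llen q"
          by (simp add: prefix_of_def)
        show ?thesis
          by (rule seqat_eqI) (use that(2) \<open>llen p = llen q\<close> in \<open>simp_all add: prefix_of_def\<close>)
      qed
      obtain q0 where "q0 \<in> Q" "prefix_of p q0"
        using p unfolding good_def by (elim conjE bexE)
      with eq have "p \<in> Q"
        by metis
      then obtain q where q: "q \<in> Q" "kbl q p"
        using nomin by blast
      have "prefix_of p p"
        by (simp add: prefix_of_def)
      then have "prefix_of p q \<or> kbl p q"
        using p q(1) \<open>p \<in> Q\<close> unfolding good_def by blast
      then show False
      proof
        assume "prefix_of p q"
        with eq[OF q(1)] q(2) kbl_irrefl show False by simp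
      next
        assume "kbl p q"
        from kbl_trans[OF this q(2)] kbl_irrefl show False by simp
      qed
    qed
    define a where "a = (LEAST a. \<exists>s\<in>Q. prefix_of p s \<and> llen p < llen s \<and> seqat s (llen p) = a)"
    have a: "\<exists>s\<in>Q. prefix_of p s \<and> llen p < llen s \<and> seqat s (llen p) = a"
      unfolding a_def by (rule LeastI_ex[OF ex])
    have least: "a \<le> seqat s (llen p)" if "s \<in> Q" "prefix_of p s" "llen p < llen s" for s
      unfolding a_def by (rule Least_le) (use that in blast)
    have "good (scons a p)"
      unfolding good_def
    proof (intro conjI ballI)
      show "\<exists>q\<in>Q. prefix_of (scons a p) q"
        using a by (simp add: prefix_of_scons)
      fix q
      assume q: "q \<in> Q"
      have "kbl s q" if s: "s \<in> Q" "prefix_of (scons a p) s" and nq: "\<not> prefix_of (scons a p) q" for s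
      proof (cases "prefix_of p q")
        \<comment> \<open>Here q extends p but not by \<open>a\<close>: it ends at p or continues
          with an entry above the least one, and in both cases it comes after s.\<close>
        case True
        have s': "prefix_of p s" "llen p < llen s" "seqat s (llen p) = a"
          using s(2) by (simp_all add: prefix_of_scons)
        have "a < seqat q (llen p)" if "llen p < llen q"
        proof -
          have "seqat q (llen p) \<noteq> a"
            using nq True that by (simp add: prefix_of_scons)
          with least[OF q True that] show ?thesis by simp
        qed
        then have "slt s q (llen p)"
          using s' by (simp add: slt_def)
        moreover have "seqv s q j" if "j < llen p" for j
        proof -
          have "seqat s j = seqat q j" "j < llen s" "j < llen q"
            using s'(1) True that unfolding prefix_of_def by simp_all
          then show ?thesis
            by (simp add: seqv_def)
        qed
        ultimately show ?thesis
          by (rule kblI)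
      next
        case False
        then show ?thesis
          using p q s unfolding good_def prefix_of_scons by blast
      qed
      then show "prefix_of (scons a p) q \<or> (\<forall>s\<in>Q. prefix_of (scons a p) s \<longrightarrow> kbl s q)"
        by blast
    qed
    then show ?thesis ..
  qed
  define p where "p = rec_nat 0 (\<lambda>_ p. scons (SOME a. good (scons a p)) p)"
  define h where "h = (\<lambda>n. SOME a. good (scons a (p n)))"
  have p_Suc: "p (Suc n) = scons (h n) (p n)" for n
    by (simp add: p_def h_def)
  have p_res: "p n = res h n" for n
    by (induction n) (simp_all add: p_Suc, simp add: p_def)
  have "good (p n)" for n
  proof (induction n)
    case 0
    have "prefix_of 0 q" for q
      by (simp add: prefix_of_def)
    with Q(2) show ?case
      by (auto simp: good_def p_def)
  next
    case (Suc n)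
    from someI_ex[OF step[OF this]] show ?case
      unfolding p_Suc h_def .
  qed
  then have good: "good (res h n)" for n
    by (simp only: p_res)
  have "res h n \<in> T" for n
  proof -
    obtain q where q: "q \<in> Q" "prefix_of (res h n) q"
      using good[of n] unfolding good_def by blast
    have "res h n = res (seqat q) n"
      using prefix_of_res[OF q(2)] by simp
    moreover have "n \<le> llen q"
      using q(2) by (simp add: prefix_of_def)
    ultimately show ?thesis
      using closed q(1) Q(1) by auto
  qed
  with no_branch show False by blast
qed

lemma Field_KB [simp]: "Field (KB T) = T"
  by (auto simp: KB_def Field_def)

lemma Linear_order_KB: "Linear_order (KB T)"
  unfolding linear_order_on_def partial_order_on_def preorder_on_def Field_KB
proof (intro conjI)
  show "refl_on T (KB T)"
    by (auto simp: refl_on_def KB_def)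
  show "trans (KB T)"
    unfolding trans_def KB_def using kbl_trans by blast
  show "antisym (KB T)"
    unfolding antisym_def KB_def using kbl_trans kbl_irrefl by blast
  show "total_on T (KB T)"
    unfolding total_on_def KB_def using kbl_total by blast
qed (auto simp: KB_def)

lemma Well_order_KB:
  assumes closed: "\<And>t j. t \<in> T \<Longrightarrow> j \<le> llen t \<Longrightarrow> res (seqat t) j \<in> T"
    and no_branch: "\<And>h. \<exists>k. res h k \<notin> T"
  shows "Well_order (KB T)"
proof -
  have "\<exists>m\<in>Q. \<forall>q. (q, m) \<in> KB T - Id \<longrightarrow> q \<notin> Q" if "x \<in> Q" for x Q
  proof (cases "Q \<inter> T = {}")
    case True
    with that show ?thesis
      by (auto simp: KB_def)
  next
    case False
    from kbl_minimal[OF closed no_branch _ False] obtain m where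
      "m \<in> Q \<inter> T" "\<forall>q\<in>Q \<inter> T. \<not> kbl q m" by auto
    then show ?thesis
      by (intro bexI[of _ m]) (auto simp: KB_def)
  qed
  then have "wf (KB T - Id)"
    unfolding wf_eq_minimal by blast
  then show ?thesis
    unfolding well_order_on_def using Linear_order_KB by blast
qed

section \<open>Embeddings between linear orders\<close>

unbundle cardinal_syntax

text \<open>The image need not be an initial segment, unlike for \<open>embed\<close>. The condition
  quantifies over numbers only, so existence of such a map has
  \<open>\<Sigma>\<^sup>1\<^sub>1\<close> form, and it makes sense when L is not
  well-founded.\<close>

definition mono_map :: "nat rel \<Rightarrow> nat rel \<Rightarrow> (nat \<Rightarrow> nat) \<Rightarrow> bool" where
  "mono_map L r \<phi> \<longleftrightarrow> (\<forall>s t. (s, t) \<in> L \<longrightarrow> (\<phi> s, \<phi> t) \<in> r \<and> (s \<noteq> t \<longrightarrow> \<phi> s \<noteq> \<phi> t))"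

definition emb :: "nat rel \<Rightarrow> nat rel \<Rightarrow> bool" where
  "emb L r \<longleftrightarrow> (\<exists>\<phi>. mono_map L r \<phi>)"

lemma emb_trans: "emb L r \<Longrightarrow> emb r s \<Longrightarrow> emb L s"
proof -
  assume "emb L r" "emb r s"
  then obtain \<phi> \<psi> where "mono_map L r \<phi>" "mono_map r s \<psi>"
    unfolding emb_def by blast
  then have "mono_map L s (\<psi> \<circ> \<phi>)"
    unfolding mono_map_def by simp
  then show ?thesis
    unfolding emb_def by blast
qed

lemma emb_wf:
  assumes "emb L r" "wf (r - Id)" shows "wf (L - Id)"
proof -
  obtain \<phi> where "mono_map L r \<phi>"
    using assms(1) unfolding emb_def by blast
  then have "L - Id \<subseteq> inv_image (r - Id) \<phi>"
    unfolding mono_map_def by (auto simp: inv_image_def)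
  with assms(2) show ?thesis
    using wf_subset wf_inv_image by blast
qed

text \<open>If some points were moved down, take a minimal one m: the point \<open>g m\<close> lies
  strictly below m and is itself moved down.\<close>

lemma mono_map_not_decreasing:
  assumes "wf (L - Id)" "mono_map L L g" "(g b, b) \<in> L"
  shows "g b = b"
proof (rule ccontr)
  assume "g b \<noteq> b"
  with assms(3) have "b \<in> {x. (g x, x) \<in> L \<and> g x \<noteq> x}" by simp
  with assms(1) obtain m where m: "(g m, m) \<in> L" "g m \<noteq> m"
    and min: "\<And>y. (y, m) \<in> L - Id \<Longrightarrow> \<not> ((g y, y) \<in> L \<and> g y \<noteq> y)"
    by (rule wfE_min) blast
  have "(g (g m), g m) \<in> L \<and> g (g m) \<noteq> g m"
    using assms(2) m unfolding mono_map_def by blast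
  with min[of "g m"] m show False by blast
qed

lemma mono_mapI_embed:
  assumes "Well_order r" "embed r s f" shows "mono_map r s f"
  unfolding mono_map_def
proof (intro allI impI conjI)
  fix x y
  assume xy: "(x, y) \<in> r"
  have "compat r s f"
    using assms(2) by (rule embed_compat)
  with xy show "(f x, f y) \<in> s"
    unfolding compat_def by blast
  have "inj_on f (Field r)"
    using assms by (rule embed_inj_on)
  moreover have "x \<in> Field r" "y \<in> Field r"
    using xy by (simp_all add: FieldI1 FieldI2)
  ultimately show "f x \<noteq> f y" if "x \<noteq> y"
    using that by (simp add: inj_on_eq_iff)
qed

lemma ordLeq_emb: "r \<le>o s \<Longrightarrow> emb r s"
  unfolding ordLeq_def emb_def by (auto intro: mono_mapI_embed)

text \<open>The image of r is a proper initial segment of s, and any b outside it lies above all of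
  it.\<close>

lemma ordLess_bounded:
  assumes "r <o s"
  shows "\<exists>\<psi> b. b \<in> Field s \<and> mono_map r s \<psi> \<and> (\<forall>x\<in>Field r. (\<psi> x, b) \<in> s \<and> \<psi> x \<noteq> b)"
proof -
  obtain f where f: "Well_order r" "Well_order s" "embed r s f" "\<not> bij_betw f (Field r) (Field s)"
    using assms unfolding ordLess_def embedS_def mem_Collect_eq prod.case by (elim exE conjE)
  have s: "wo_rel s"
    using f(2) by (simp add: wo_rel_def)
  have of: "wo_rel.ofilter s (f ` Field r)"
    using embed_Field_ofilter[OF f(1-3)] .
  have sub: "f ` Field r \<subseteq> Field s"
    using of by (simp add: wo_rel.ofilter_def[OF s])
  have "f ` Field r \<noteq> Field s"
    using f(4) embed_inj_on[OF f(1,3)] by (simp add: bij_betw_def)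
  with sub obtain b where b: "b \<in> Field s" "b \<notin> f ` Field r"
    by blast
  have "(f x, b) \<in> s \<and> f x \<noteq> b" if "x \<in> Field r" for x
  proof -
    have fx: "f x \<in> Field s" "f x \<noteq> b"
      using that sub b by blast+
    have "under s (f x) \<subseteq> f ` Field r"
      using of that by (simp add: wo_rel.ofilter_def[OF s])
    with b(2) have "(b, f x) \<notin> s"
      by (auto simp: under_def)
    then show ?thesis
      using fx b(1) wo_rel.TOTALS[OF s] by blast
  qed
  with b(1) mono_mapI_embed[OF f(1,3)] show ?thesis
    by blast
qed

text \<open>An embedding of L into r would make L well-founded, and followed by
  \<open>\<psi>\<close> it would be a strictly increasing map of L into itself that moves b
  down.\<close>

lemma bounded_not_emb:
  assumes "wf (r - Id)" "b \<in> Field L" "mono_map r L \<psi>" "\<forall>x\<in>Field r. (\<psi> x, b) \<in> L \<and> \<psi> x \<noteq> b"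
    and refl: "(b, b) \<in> L"
  shows "\<not> emb L r"
proof
  assume emb: "emb L r"
  then obtain \<phi> where \<phi>: "mono_map L r \<phi>"
    unfolding emb_def by blast
  have "mono_map L L (\<psi> \<circ> \<phi>)"
    using \<phi> assms(3) unfolding mono_map_def by simp
  moreover have "\<phi> b \<in> Field r"
    using \<phi> refl unfolding mono_map_def Field_def by blast
  ultimately show False
    using mono_map_not_decreasing[OF emb_wf[OF emb assms(1)], of "\<psi> \<circ> \<phi>" b] assms(4) by simp
qed

text \<open>This turns a negated existential statement over functions into an existential one. If L
  is well-founded, comparability with r leaves only the case that r is strictly shorter, whence the
  bound b.\<close>

lemma not_emb_iff:
  assumes L: "Linear_order L" and r: "Well_order r"
  shows "\<not> emb L r \<longleftrightarrow> (\<exists>d. \<forall>n. (d (Suc n), d n) \<in> L \<and> d (Suc n) \<noteq> d n) \<or>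
    (\<exists>\<psi> b. b \<in> Field L \<and> mono_map r L \<psi> \<and> (\<forall>x\<in>Field r. (\<psi> x, b) \<in> L \<and> \<psi> x \<noteq> b))"
proof
  assume ne: "\<not> emb L r"
  show "(\<exists>d. \<forall>n. (d (Suc n), d n) \<in> L \<and> d (Suc n) \<noteq> d n) \<or>
    (\<exists>\<psi> b. b \<in> Field L \<and> mono_map r L \<psi> \<and> (\<forall>x\<in>Field r. (\<psi> x, b) \<in> L \<and> \<psi> x \<noteq> b))"
  proof (cases "wf (L - Id)")
    case True
    with L have "Well_order L"
      by (simp add: well_order_on_def)
    moreover have "\<not> L \<le>o r"
      using ne ordLeq_emb by blast
    ultimately have "r <o L"
      using r not_ordLeq_iff_ordLess by blast
    then show ?thesis
      using ordLess_bounded by blast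
  next
    case False
    then show ?thesis
      unfolding wf_iff_no_infinite_down_chain by auto
  qed
next
  assume "(\<exists>d. \<forall>n. (d (Suc n), d n) \<in> L \<and> d (Suc n) \<noteq> d n) \<or>
    (\<exists>\<psi> b. b \<in> Field L \<and> mono_map r L \<psi> \<and> (\<forall>x\<in>Field r. (\<psi> x, b) \<in> L \<and> \<psi> x \<noteq> b))"
  then show "\<not> emb L r"
  proof
    assume "\<exists>d. \<forall>n. (d (Suc n), d n) \<in> L \<and> d (Suc n) \<noteq> d n"
    then have "\<not> wf (L - Id)"
      unfolding wf_iff_no_infinite_down_chain by auto
    then show ?thesis
      using emb_wf r unfolding well_order_on_def by blast
  next
    assume "\<exists>\<psi> b. b \<in> Field L \<and> mono_map r L \<psi> \<and> (\<forall>x\<in>Field r. (\<psi> x, b) \<in> L \<and> \<psi> x \<noteq> b)"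
    then obtain \<psi> b where *: "b \<in> Field L" "mono_map r L \<psi>" "\<forall>x\<in>Field r. (\<psi> x, b) \<in> L \<and> \<psi> x \<noteq> b"
      by blast
    have "(b, b) \<in> L"
      using L *(1) unfolding order_on_defs refl_on_def by blast
    with * r bounded_not_emb show ?thesis
      unfolding well_order_on_def by blast
  qed
qed

no_notation elt_set_eq (infix \<open>=o\<close> 50)

section \<open>Comparing Kleene--Brouwer orderings with decidable orderings\<close>

text \<open>Membership is kept in both an existential and a universal form, so that it can be put
  into a universal matrix as a premise as well as a conclusion.\<close>

definition decides :: "(nat \<Rightarrow> nat) \<Rightarrow> nat \<Rightarrow> nat rel \<Rightarrow> bool" where
  "decides g c r \<longleftrightarrow> (\<forall>x y. ((x, y) \<in> r \<longleftrightarrow> (\<exists>k w. run (res g k) w c (pair x y) 1)) \<and>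
     ((x, y) \<in> r \<longleftrightarrow> (\<forall>k w. \<not> run (res g k) w c (pair x y) 0)))"

lemma dec_decides:
  assumes "dec \<Phi> (\<lambda>_ x. (p1 x, p2 x) \<in> r)"
  shows "\<exists>c. \<forall>g\<in>\<Phi>. decides g c r"
proof -
  obtain e where e: "\<And>g x. g \<in> \<Phi> \<Longrightarrow> evaluates g e [x] (of_bool ((p1 x, p2 x) \<in> r))"
    using assms unfolding dec_def urec_def by blast
  have "evaluates g e [pair x y] v \<longleftrightarrow> v = of_bool ((x, y) \<in> r)" if "g \<in> \<Phi>" for g x y v
    using e[OF that, of "pair x y"] evaluates_deterministic by auto
  then have "decides g (code e) r" if "g \<in> \<Phi>" for g
    unfolding decides_def using that by (simp flip: evaluates_iff_run not_ex)
  then show ?thesis by blast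
qed

lemma decides_unique: "decides g c r \<Longrightarrow> decides g c s \<Longrightarrow> r = s"
  unfolding decides_def by auto

lemma all_quadruple:
  "(\<forall>x. P (p1 x) (p1 (p2 x)) (p1 (p2 (p2 x))) (p2 (p2 (p2 x)))) \<longleftrightarrow> (\<forall>s t k w. P s t k w)"
proof safe
  fix s t k w
  assume *: "\<forall>x. P (p1 x) (p1 (p2 x)) (p1 (p2 (p2 x))) (p2 (p2 (p2 x)))"
  from *[rule_format, of "pair s (pair t (pair k w))"] show "P s t k w"
    by simp
qed simp

text \<open>The index of the tree is passed as \<open>N 0\<close>, because the diagonal argument
  lets it vary with the point. Membership in r is a conclusion here, hence its universal form: no
  run with value 0.\<close>

lemma S11_emb:
  "\<exists>E. S11 E \<and> (\<forall>N g z r. decides g c r \<longrightarrow>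
     (E (join (join N g) z) \<longleftrightarrow> emb (KB (tree (N 0) z)) r))"
proof -
  define B where "B n g z \<phi> s t k w \<longleftrightarrow> (s \<in> tree n z \<and> t \<in> tree n z \<and> (s = t \<or> kbl s t) \<longrightarrow>
    \<not> run (res g k) w c (pair (\<phi> s) (\<phi> t)) 0 \<and> (s \<noteq> t \<longrightarrow> \<phi> s \<noteq> \<phi> t))"
    for n z and g \<phi> :: "nat \<Rightarrow> nat" and s t k w
  define E where "E v \<longleftrightarrow> (\<exists>\<phi>. \<forall>x. B (left (left v) 0) (right (left v)) (right v) \<phi>
    (p1 x) (p1 (p2 x)) (p1 (p2 (p2 x))) (p2 (p2 (p2 x))))" for v
  have "S11 E"
    unfolding E_def B_def
    by (rule S11I) (unfold left_def right_def, intro rec_intros dec_tree dec_kbl dec_run)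
  moreover have "E (join (join N g) z) \<longleftrightarrow> emb (KB (tree (N 0) z)) r" if "decides g c r" for N g z r
  proof -
    have r: "(x, y) \<in> r \<longleftrightarrow> (\<forall>k w. \<not> run (res g k) w c (pair x y) 0)" for x y
      using that unfolding decides_def by blast
    have "(\<forall>s t k w. B n g z \<phi> s t k w) \<longleftrightarrow> mono_map (KB (tree n z)) r \<phi>" for n \<phi>
      unfolding B_def mono_map_def r KB_def by blast
    then show ?thesis
      unfolding E_def all_quadruple emb_def by simp
  qed
  ultimately show ?thesis by blast
qed

text \<open>The witness h packs both alternatives of \<open>not_emb_iff\<close>, with
  \<open>h 0\<close> as the choice. If it is 0, the descending sequence is \<open>h 1\<close>,
  \<open>h 2\<close>, ...; otherwise \<open>h 1\<close> is the bound b and \<open>h (i + 2)\<close>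
  the image of i. Membership in r is a premise here, hence its existential form: some run with value
  1.\<close>

lemma S11_not_emb:
  "\<exists>E. S11 E \<and> (\<forall>N g z r. decides g c r \<and> Well_order r \<longrightarrow>
     (E (join (join N g) z) \<longleftrightarrow> \<not> emb (KB (tree (N 0) z)) r))"
proof -
  define B where "B n g z h s t k w \<longleftrightarrow>
    h 0 = 0 \<and> h (s + 2) \<in> tree n z \<and> h (s + 1) \<in> tree n z \<and> kbl (h (s + 2)) (h (s + 1)) \<or>
    h 0 \<noteq> 0 \<and> h 1 \<in> tree n z \<and> (run (res g k) w c (pair s t) 1 \<longrightarrow>
      h (s + 2) \<in> tree n z \<and> h (t + 2) \<in> tree n z \<and> (h (s + 2) = h (t + 2) \<or> kbl (h (s + 2)) (h (t + 2))) \<and>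
      (s \<noteq> t \<longrightarrow> h (s + 2) \<noteq> h (t + 2)) \<and> kbl (h (s + 2)) (h 1) \<and> kbl (h (t + 2)) (h 1))"
    for n z and g h :: "nat \<Rightarrow> nat" and s t k w
  define E where "E v \<longleftrightarrow> (\<exists>h. \<forall>x. B (left (left v) 0) (right (left v)) (right v) h
    (p1 x) (p1 (p2 x)) (p1 (p2 (p2 x))) (p2 (p2 (p2 x))))" for v
  have "S11 E"
    unfolding E_def B_def
    by (rule S11I) (unfold left_def right_def, intro rec_intros dec_tree dec_kbl dec_run)
  moreover have "E (join (join N g) z) \<longleftrightarrow> \<not> emb (KB (tree (N 0) z)) r"
    if "decides g c r" "Well_order r" for N g z r
  proof -
    let ?L = "KB (tree (N 0) z)"
    have r: "(x, y) \<in> r \<longleftrightarrow> (\<exists>k w. run (res g k) w c (pair x y) 1)" for x y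
      using that(1) unfolding decides_def by blast
    have lt: "(x, y) \<in> ?L \<and> x \<noteq> y \<longleftrightarrow> x \<in> tree (N 0) z \<and> y \<in> tree (N 0) z \<and> kbl x y" for x y
      unfolding KB_def using kbl_irrefl by auto
    have case0: "(\<forall>s t k w. B (N 0) g z h s t k w) \<longleftrightarrow>
        (\<forall>n. (h (n + 2), h (n + 1)) \<in> ?L \<and> h (n + 2) \<noteq> h (n + 1))" if "h 0 = 0" for h
      unfolding B_def lt using that by simp
    have case1: "(\<forall>s t k w. B (N 0) g z h s t k w) \<longleftrightarrow> h 1 \<in> Field ?L \<and> mono_map r ?L (\<lambda>i. h (i + 2)) \<and>
        (\<forall>x\<in>Field r. (h (x + 2), h 1) \<in> ?L \<and> h (x + 2) \<noteq> h 1)" if "h 0 \<noteq> 0" for h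
    proof
      assume B: "\<forall>s t k w. B (N 0) g z h s t k w"
      then have h1: "h 1 \<in> tree (N 0) z"
        using that by (simp add: B_def)
      have st: "h (s + 2) \<in> tree (N 0) z \<and> h (t + 2) \<in> tree (N 0) z \<and>
          (h (s + 2) = h (t + 2) \<or> kbl (h (s + 2)) (h (t + 2))) \<and>
          (s \<noteq> t \<longrightarrow> h (s + 2) \<noteq> h (t + 2)) \<and> kbl (h (s + 2)) (h 1) \<and> kbl (h (t + 2)) (h 1)"
        if st: "(s, t) \<in> r" for s t
      proof -
        obtain k w where "run (res g k) w c (pair s t) 1"
          using st r by blast
        moreover have "B (N 0) g z h s t k w"
          using B by blast
        ultimately show ?thesis
          using \<open>h 0 \<noteq> 0\<close> unfolding B_def by blast
      qed
      have "mono_map r ?L (\<lambda>i. h (i + 2))"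
        unfolding mono_map_def KB_def using st by blast
      moreover have "\<forall>x\<in>Field r. (h (x + 2), h 1) \<in> ?L \<and> h (x + 2) \<noteq> h 1"
      proof
        fix x
        assume "x \<in> Field r"
        then obtain y where "(x, y) \<in> r \<or> (y, x) \<in> r"
          unfolding Field_def by blast
        with st h1 show "(h (x + 2), h 1) \<in> ?L \<and> h (x + 2) \<noteq> h 1"
          unfolding lt by blast
      qed
      ultimately show "h 1 \<in> Field ?L \<and> mono_map r ?L (\<lambda>i. h (i + 2)) \<and>
          (\<forall>x\<in>Field r. (h (x + 2), h 1) \<in> ?L \<and> h (x + 2) \<noteq> h 1)"
        using h1 by simp
    next
      assume *: "h 1 \<in> Field ?L \<and> mono_map r ?L (\<lambda>i. h (i + 2)) \<and>
        (\<forall>x\<in>Field r. (h (x + 2), h 1) \<in> ?L \<and> h (x + 2) \<noteq> h 1)"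
      show "\<forall>s t k w. B (N 0) g z h s t k w"
      proof (intro allI)
        fix s t k w
        have "h (s + 2) \<in> tree (N 0) z \<and> h (t + 2) \<in> tree (N 0) z \<and>
          (h (s + 2) = h (t + 2) \<or> kbl (h (s + 2)) (h (t + 2))) \<and>
          (s \<noteq> t \<longrightarrow> h (s + 2) \<noteq> h (t + 2)) \<and> kbl (h (s + 2)) (h 1) \<and> kbl (h (t + 2)) (h 1)"
          if "run (res g k) w c (pair s t) 1"
        proof -
          have st: "(s, t) \<in> r"
            using that r by blast
          then have "(h (s + 2), h (t + 2)) \<in> ?L" "s \<noteq> t \<longrightarrow> h (s + 2) \<noteq> h (t + 2)"
            using * unfolding mono_map_def by blast+
          moreover have "s \<in> Field r" "t \<in> Field r"
            using st by (simp_all add: FieldI1 FieldI2)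
          then have "kbl (h (s + 2)) (h 1)" "kbl (h (t + 2)) (h 1)"
            using * unfolding lt by blast+
          ultimately show ?thesis
            by (simp add: KB_def)
        qed
        moreover have "h 1 \<in> tree (N 0) z"
          using * by simp
        ultimately show "B (N 0) g z h s t k w"
          unfolding B_def using that by blast
      qed
    qed
    have "E (join (join N g) z) \<longleftrightarrow> (\<exists>h. \<forall>s t k w. B (N 0) g z h s t k w)"
      unfolding E_def all_quadruple by simp
    also have "\<dots> \<longleftrightarrow> (\<exists>d. \<forall>n. (d (Suc n), d n) \<in> ?L \<and> d (Suc n) \<noteq> d n) \<or>
      (\<exists>\<psi> b. b \<in> Field ?L \<and> mono_map r ?L \<psi> \<and> (\<forall>x\<in>Field r. (\<psi> x, b) \<in> ?L \<and> \<psi> x \<noteq> b))"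
      (is "?l \<longleftrightarrow> ?r1 \<or> ?r2")
    proof
      assume ?l
      then obtain h where h: "\<forall>s t k w. B (N 0) g z h s t k w" by blast
      show "?r1 \<or> ?r2"
      proof (cases "h 0 = 0")
        case True
        from h[unfolded case0[of h, OF True]] have "\<forall>n. (h (n + 2), h (n + 1)) \<in> ?L \<and> h (n + 2) \<noteq> h (n + 1)"
          .
        then have ?r1
          by (intro exI[of _ "\<lambda>n. h (n + 1)"]) simp
        then show ?thesis ..
      next
        case False
        from h[unfolded case1[of h, OF False]] have "h 1 \<in> Field ?L \<and> mono_map r ?L (\<lambda>i. h (i + 2)) \<and>
            (\<forall>x\<in>Field r. (h (x + 2), h 1) \<in> ?L \<and> h (x + 2) \<noteq> h 1)"
          .
        then have ?r2 by blast
        then show ?thesis ..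
      qed
    next
      assume "?r1 \<or> ?r2"
      then show ?l
      proof
        assume ?r1
        then obtain d where d: "\<forall>n. (d (Suc n), d n) \<in> ?L \<and> d (Suc n) \<noteq> d n" by blast
        have "\<forall>s t k w. B (N 0) g z (case_nat 0 d) s t k w"
          using d by (subst case0[of "case_nat 0 d"]) simp_all
        then show ?l by blast
      next
        assume ?r2
        then obtain \<psi> b where "b \<in> Field ?L \<and> mono_map r ?L \<psi> \<and> (\<forall>x\<in>Field r. (\<psi> x, b) \<in> ?L \<and> \<psi> x \<noteq> b)"
          by blast
        then have "\<forall>s t k w. B (N 0) g z (case_nat 1 (case_nat b \<psi>)) s t k w"
          by (subst case1[of "case_nat 1 (case_nat b \<psi>)"]) simp_all
        then show ?l by blast
      qed
    qed
    also have "\<dots> \<longleftrightarrow> \<not> emb ?L r"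
      using not_emb_iff[OF Linear_order_KB that(2)] by simp
    finally show ?thesis .
  qed
  ultimately show ?thesis by blast
qed

section \<open>Boundedness\<close>

lemma computable_wellorder_in_dec:
  "computable_wellorder_in f r \<longleftrightarrow> Well_order r \<and> dec {f} (\<lambda>_ x. (p1 x, p2 x) \<in> r)"
  unfolding computable_wellorder_in_def computable_rel_in_2 ..

text \<open>Two disjoint \<open>\<Sigma>\<^sup>1\<^sub>1\<close> sets of points \<open>y\<close>, given by the trees \<open>a\<close> and \<open>b\<close>: the tree of
  attempts at a common point is well-founded and absorbs every \<open>b\<close>-tree over a point of the first set.\<close>

lemma boundedness:
  assumes disj: "\<And>y h k. branch a (join g y) h \<Longrightarrow> \<not> branch b (join g y) k"
  shows "\<exists>\<sigma>. computable_wellorder_in g \<sigma> \<and>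
    (\<forall>y h. branch a (join g y) h \<longrightarrow> emb (KB (tree b (join g y))) \<sigma>)"
proof -
  \<comment> \<open>An entry of c codes three values, in the form ((y, h), k): one of the common
    point, one of its branch for a and one of its branch for b.\<close>
  define ok where "ok f c \<longleftrightarrow>
    \<not> bad a (res (\<lambda>i. pair (pair (f i) (p1 (p1 (seqat c i)))) (p2 (p1 (seqat c i)))) (llen c)) \<and>
    \<not> bad b (res (\<lambda>i. pair (pair (f i) (p1 (p1 (seqat c i)))) (p2 (seqat c i))) (llen c))"
    for f :: "nat \<Rightarrow> nat" and c
  define T where "T = {c. ok g c}"
  have ok_res: "ok g (res H k) \<longleftrightarrow>
    \<not> bad a (res (join (join g (left (left H))) (right (left H))) k) \<and>
    \<not> bad b (res (join (join g (left (left H))) (right H)) k)" for H k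
  proof -
    have "res (\<lambda>i. pair (pair (g i) (p1 (p1 (seqat (res H k) i)))) (p2 (p1 (seqat (res H k) i)))) k =
        res (join (join g (left (left H))) (right (left H))) k"
      by (rule res_cong) (simp add: join_apply)
    moreover have "res (\<lambda>i. pair (pair (g i) (p1 (p1 (seqat (res H k) i)))) (p2 (seqat (res H k) i))) k =
        res (join (join g (left (left H))) (right H)) k"
      by (rule res_cong) (simp add: join_apply)
    ultimately show ?thesis
      by (simp add: ok_def)
  qed
  have closed: "res (seqat t) j \<in> T" if "t \<in> T" "j \<le> llen t" for t j
    using that ok_res[of "seqat t" "llen t"] ok_res[of "seqat t" j] bad_mono[OF _ that(2)]
    unfolding T_def by (simp only: mem_Collect_eq res_seqat) blast
  have no_branch: "\<exists>k. res H k \<notin> T" for H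
  proof (rule ccontr)
    assume "\<nexists>k. res H k \<notin> T"
    then have "branch a (join g (left (left H))) (right (left H))" "branch b (join g (left (left H))) (right H)"
      unfolding branch_def T_def by (simp_all add: ok_res)
    with disj show False by blast
  qed
  have ok: "dec UNIV (\<lambda>f c. ok f c)"
    unfolding ok_def by (intro rec_intros dec_bad)
  have "dec UNIV (\<lambda>f x. ok f (p1 x) \<and> ok f (p2 x) \<and> (p1 x = p2 x \<or> kbl (p1 x) (p2 x)))"
    by (intro dec_conj dec_disj dec_eq dec_kbl dec_comp[OF ok urec_p1[OF urec_id]]
        dec_comp[OF ok urec_p2[OF urec_id]] urec_p1 urec_p2 urec_id)
  then have "dec {g} (\<lambda>f x. ok f (p1 x) \<and> ok f (p2 x) \<and> (p1 x = p2 x \<or> kbl (p1 x) (p2 x)))"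
    by (rule dec_mono) simp
  then have "dec {g} (\<lambda>_ x. (p1 x, p2 x) \<in> KB T)"
    by (rule dec_cong) (simp add: KB_def T_def)
  moreover have "Well_order (KB T)"
    using closed no_branch by (rule Well_order_KB)
  ultimately have "computable_wellorder_in g (KB T)"
    by (simp add: computable_wellorder_in_dec)
  moreover have "emb (KB (tree b (join g y))) (KB T)" if br: "branch a (join g y) h" for y h
  proof -
    \<comment> \<open>The fixed y and its branch h are attached to t. Since t supplies the second
      component of each entry, comparisons of entries are preserved.\<close>
    define \<phi> where "\<phi> t = res (join (join y h) (seqat t)) (llen t)" for t
    have llen_\<phi>: "llen (\<phi> t) = llen t" for t
      by (simp add: \<phi>_def)
    have at_\<phi>: "seqat (\<phi> t) i = pair (pair (y i) (h i)) (seqat t i)" if "i < llen t" for t i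
      using that by (simp add: \<phi>_def join_apply)
    have \<phi>_T: "\<phi> t \<in> T" if "t \<in> tree b (join g y)" for t
      using that br res_in_tree[of "seqat t" "llen t" b "join g y"]
      unfolding T_def \<phi>_def mem_Collect_eq ok_res branch_def by simp
    have "kbl (\<phi> s) (\<phi> t)" if st: "kbl s t" for s t
    proof -
      obtain i where i: "slt s t i" "\<forall>j<i. seqv s t j"
        using st unfolding kbl_def by blast
      have "slt (\<phi> s) (\<phi> t) i"
        using i(1) by (auto simp: slt_def llen_\<phi> at_\<phi> pair_strict_mono2)
      moreover have "seqv (\<phi> s) (\<phi> t) j" if "j < i" for j
        using i(2) that by (auto simp: seqv_def llen_\<phi> at_\<phi>)
      ultimately show ?thesis
        by (rule kblI)
    qed
    then have "(\<phi> s, \<phi> t) \<in> KB T \<and> (s \<noteq> t \<longrightarrow> \<phi> s \<noteq> \<phi> t)"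
      if "(s, t) \<in> KB (tree b (join g y))" for s t
      using that \<phi>_T by (auto simp: KB_def) (metis kbl_irrefl)
    then have "mono_map (KB (tree b (join g y))) (KB T) \<phi>"
      unfolding mono_map_def by blast
    then show ?thesis
      unfolding emb_def by blast
  qed
  ultimately show ?thesis by blast
qed

section \<open>The ordinals \<open>\<omega>\<^sub>1\<^sup>f\<close>\<close>

lemma computable_wellorder_in_no_oracle:
  "computable_wellorder_in no_oracle r \<Longrightarrow> computable_wellorder_in f r"
  unfolding computable_wellorder_in_dec using dec_no_oracle by blast

text \<open>A counting argument at the first uncountable cardinal \<open>cardSuc natLeq\<close>. Its
  proper initial segments are countable, so otherwise each would have a copy decided by some code.
  The code determines the copy, and distinct segments are not isomorphic, so the codes would inject
  an uncountable set into the numbers.\<close>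

lemma noncomputable_wellorder_exists:
  "\<exists>a :: nat rel. Well_order a \<and> \<not> computable_ordinal_in g a"
proof (rule ccontr)
  assume "\<not> ?thesis"
  then have all: "computable_ordinal_in g a" if "Well_order a" for a
    using that by blast
  let ?C = "cardSuc natLeq"
  have C: "Card_order ?C" "Well_order ?C"
    by (rule cardSuc_Card_order[OF natLeq_Card_order], rule cardSuc_Well_order[OF natLeq_Card_order])
  have ex: "\<exists>c r. decides g c r \<and> r =o Restr ?C (underS ?C x)" if x: "x \<in> Field ?C" for x
  proof -
    let ?R = "Restr ?C (underS ?C x)"
    have "Well_order ?R"
      using C(2) by (rule Well_order_Restr)
    have "|underS ?C x| <o ?C"
      using C(1) x by (rule card_of_underS)
    then have "|underS ?C x| \<le>o natLeq"
      by (rule cardSuc_ordLeq_ordLess[OF natLeq_Card_order card_of_Card_order, THEN iffD1])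
    then have "|underS ?C x| \<le>o |UNIV :: nat set|"
      by (rule ordLeq_ordIso_trans[OF _ card_of_nat[THEN ordIso_symmetric]])
    then obtain u :: "_ \<Rightarrow> nat" where u: "inj_on u (underS ?C x)"
      using card_of_ordLeq[of "underS ?C x" "UNIV :: nat set"] by auto
    have inj: "inj_on u (Field ?R)"
      by (rule inj_on_subset[OF u]) (auto simp: Field_def)
    note iso = dir_image_ordIso[OF \<open>Well_order ?R\<close> inj]
    note wo = Well_order_dir_image[OF \<open>Well_order ?R\<close> inj]
    obtain r where r: "computable_wellorder_in g r" "r =o dir_image ?R u"
      using all[OF wo] unfolding computable_ordinal_in_def by (elim exE conjE)
    have "dec {g} (\<lambda>_ x. (p1 x, p2 x) \<in> r)"
      using r(1) by (simp add: computable_wellorder_in_dec)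
    from dec_decides[OF this] obtain c where "decides g c r"
      by auto
    moreover have "r =o ?R"
      by (rule ordIso_transitive[OF r(2) ordIso_symmetric[OF iso]])
    ultimately show ?thesis by blast
  qed
  then have "\<exists>c r. \<forall>x\<in>Field ?C. decides g (c x) (r x) \<and> r x =o Restr ?C (underS ?C x)"
    by metis
  then obtain c r where cr: "\<And>x. x \<in> Field ?C \<Longrightarrow> decides g (c x) (r x)"
    "\<And>x. x \<in> Field ?C \<Longrightarrow> r x =o Restr ?C (underS ?C x)"
    by blast
  have less: "Restr ?C (underS ?C x) <o Restr ?C (underS ?C y)" if "(x, y) \<in> ?C" "x \<noteq> y" for x y
  proof -
    have wo: "wo_rel ?C"
      using C(2) by (simp add: wo_rel_def)
    have trans: "(z, y) \<in> ?C \<and> z \<noteq> y" if "(z, x) \<in> ?C" "z \<noteq> x" for z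
      using that \<open>(x, y) \<in> ?C\<close> \<open>x \<noteq> y\<close> wo_rel.TRANS[OF wo] wo_rel.ANTISYM[OF wo]
      by (metis antisymD transD)
    then have "underS ?C x \<subseteq> underS ?C y"
      by (auto simp: underS_def)
    moreover have "x \<in> underS ?C y" "x \<notin> underS ?C x"
      using that by (simp_all add: underS_def)
    ultimately have "underS ?C x \<subset> underS ?C y"
      by blast
    then show ?thesis
      by (rule ofilter_subset_ordLess[OF C(2) wo_rel.underS_ofilter[OF wo]
          wo_rel.underS_ofilter[OF wo], THEN iffD1])
  qed
  have "inj_on c (Field ?C)"
  proof (rule inj_onI, rule ccontr)
    fix x y
    assume xy: "x \<in> Field ?C" "y \<in> Field ?C" "c x = c y" "x \<noteq> y"
    have "r x = r y"
      using decides_unique[OF cr(1)[OF xy(1)]] cr(1)[OF xy(2)] xy(3) by simp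
    then have "r x =o Restr ?C (underS ?C y)"
      using cr(2)[OF xy(2)] by (simp only:)
    then have iso: "Restr ?C (underS ?C x) =o Restr ?C (underS ?C y)"
      by (rule ordIso_transitive[OF ordIso_symmetric[OF cr(2)[OF xy(1)]]])
    have wo: "wo_rel ?C"
      using C(2) by (simp add: wo_rel_def)
    have "(x, y) \<in> ?C \<or> (y, x) \<in> ?C"
      using wo_rel.TOTALS[OF wo] xy by blast
    then show False
    proof
      assume "(x, y) \<in> ?C"
      from not_ordLess_ordIso[OF less[OF this xy(4)]] iso show False by (rule notE)
    next
      assume "(y, x) \<in> ?C"
      from not_ordLess_ordIso[OF less[OF this xy(4)[symmetric]]] ordIso_symmetric[OF iso]
      show False by (rule notE)
    qed
  qed
  then have "|Field ?C| \<le>o |UNIV :: nat set|"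
    using card_of_ordLeq[of "Field ?C" "UNIV :: nat set"] by auto
  then have "|Field ?C| \<le>o natLeq"
    by (rule ordLeq_ordIso_trans[OF _ card_of_nat])
  then have "?C \<le>o natLeq"
    by (rule ordIso_ordLeq_trans[OF ordIso_symmetric[OF card_of_Field_ordIso[OF C(1)]]])
  with not_ordLess_ordLeq[OF cardSuc_greater[OF natLeq_Card_order]] show False
    by (rule notE)
qed

text \<open>Well-foundedness of \<open>ordLess\<close> yields a least well-order without computable
  copy, so the choice in \<open>omega1\<close> picks a genuine representative.\<close>

lemma is_omega1_omega1: "is_omega1 g (omega1 g)"
proof -
  let ?Q = "{a :: nat rel. Well_order a \<and> \<not> computable_ordinal_in g a}"
  obtain a0 where a0: "a0 \<in> ?Q"
    using noncomputable_wellorder_exists by blast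
  obtain a where a: "a \<in> ?Q" and min: "\<And>b. (b, a) \<in> ordLess \<Longrightarrow> b \<notin> ?Q"
    by (rule wfE_min[OF wf_ordLess a0]) (rule that)
  have "computable_ordinal_in g b" if "(b, a) \<in> ordLess" for b
    using min[OF that] that by (auto simp: ordLess_def)
  with a have "is_omega1 g a"
    unfolding is_omega1_def by simp
  then show ?thesis
    unfolding omega1_def by (rule someI)
qed

lemma Well_order_omega1: "Well_order (omega1 g)"
  and not_computable_omega1: "\<not> computable_ordinal_in g (omega1 g)"
  and computable_less_omega1: "b <o omega1 g \<Longrightarrow> computable_ordinal_in g b"
  using is_omega1_omega1[of g] unfolding is_omega1_def by simp_all

lemma computable_wellorder_Restr:
  assumes "computable_wellorder_in g r" "a \<in> Field r"
  shows "computable_wellorder_in g (Restr r (underS r a))"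
proof -
  have r: "dec {g} (\<lambda>_ x. (p1 x, p2 x) \<in> r)" "Well_order r"
    using assms(1) by (simp_all add: computable_wellorder_in_dec)
  have mem: "dec {g} (\<lambda>_ x. (F x, G x) \<in> r)" if "urec {g} (\<lambda>_. F)" "urec {g} (\<lambda>_. G)" for F G
    using dec_comp[OF r(1) urec_pair[OF that]] by simp
  have "dec {g} (\<lambda>_ x. (p1 x, p2 x) \<in> r \<and> (p1 x \<noteq> a \<and> (p1 x, a) \<in> r) \<and> (p2 x \<noteq> a \<and> (p2 x, a) \<in> r))"
    by (intro dec_conj dec_not dec_eq mem urec_p1 urec_p2 urec_id urec_const)
  then have "dec {g} (\<lambda>_ x. (p1 x, p2 x) \<in> Restr r (underS r a))"
    by (rule dec_cong) (auto simp: underS_def)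
  then show ?thesis
    using Well_order_Restr[OF r(2)] by (simp add: computable_wellorder_in_dec)
qed

text \<open>If a computable well-order reached \<open>omega1 g\<close>, then it or one of its proper
  initial segments would be a computable copy of \<open>omega1 g\<close>; such segments are
  computable, the cut point being a constant.\<close>

lemma computable_wellorder_less_omega1:
  assumes "computable_wellorder_in g r" shows "r <o omega1 g"
proof (rule ccontr)
  assume not: "\<not> r <o omega1 g"
  have r: "Well_order r"
    using assms by (simp add: computable_wellorder_in_def)
  have "omega1 g \<le>o r"
    using not not_ordLess_iff_ordLeq[OF Well_order_omega1 r] by simp
  then have "omega1 g <o r \<or> omega1 g =o r"
    by (simp only: ordLeq_iff_ordLess_or_ordIso)
  then have "\<exists>s. computable_wellorder_in g s \<and> omega1 g =o s"
  proof
    assume "omega1 g <o r"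
    then show ?thesis
      using ordLess_iff_ordIso_Restr[OF r Well_order_omega1] computable_wellorder_Restr[OF assms] by auto
  next
    assume "omega1 g =o r"
    with assms show ?thesis by blast
  qed
  then have "computable_ordinal_in g (omega1 g)"
    unfolding computable_ordinal_in_def by (blast intro: ordIso_symmetric)
  with not_computable_omega1 show False ..
qed

lemma hyperlow_computable:
  assumes "hyperlow f" "computable_wellorder_in f \<sigma>"
  shows "\<exists>\<alpha>. computable_wellorder_in no_oracle \<alpha> \<and> \<sigma> \<le>o \<alpha>"
proof -
  have "\<sigma> <o omega1 no_oracle"
    by (rule ordLess_ordIso_trans[OF computable_wellorder_less_omega1[OF assms(2)]
          assms(1)[unfolded hyperlow_def]])
  then have "computable_ordinal_in no_oracle \<sigma>"
    by (rule computable_less_omega1)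
  then obtain \<alpha> where "computable_wellorder_in no_oracle \<alpha>" "\<alpha> =o \<sigma>"
    unfolding computable_ordinal_in_def by (elim exE conjE)
  moreover from this(2) have "\<sigma> \<le>o \<alpha>"
    by (rule ordIso_imp_ordLeq[OF ordIso_symmetric])
  ultimately show ?thesis by blast
qed

text \<open>Absolute computability implies computability in f, so \<open>omega1 f\<close> is not the
  smaller ordinal. If the two differ, \<open>omega1 no_oracle\<close> lies below it and therefore
  has an f-computable copy, which serves as r.\<close>

lemma not_hyperlow_bound:
  assumes "\<not> hyperlow f"
  shows "\<exists>r. computable_wellorder_in f r \<and> (\<forall>\<sigma>. computable_wellorder_in no_oracle \<sigma> \<longrightarrow> \<sigma> \<le>o r)"
proof -
  let ?a = "omega1 no_oracle" and ?b = "omega1 f"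
  have "\<not> ?b <o ?a"
  proof
    assume "?b <o ?a"
    then have "computable_ordinal_in no_oracle ?b"
      by (rule computable_less_omega1)
    then have "computable_ordinal_in f ?b"
      unfolding computable_ordinal_in_def using computable_wellorder_in_no_oracle by blast
    with not_computable_omega1 show False ..
  qed
  moreover have "\<not> ?b =o ?a"
    using assms by (simp add: hyperlow_def)
  ultimately have "\<not> ?b \<le>o ?a"
    by (simp add: ordLeq_iff_ordLess_or_ordIso)
  then have "?a <o ?b"
    by (simp add: not_ordLeq_iff_ordLess Well_order_omega1)
  then have "computable_ordinal_in f ?a"
    by (rule computable_less_omega1)
  then obtain r where r: "computable_wellorder_in f r" "r =o ?a"
    unfolding computable_ordinal_in_def by (elim exE conjE)
  have "\<sigma> \<le>o r" if "computable_wellorder_in no_oracle \<sigma>" for \<sigma>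
    by (rule ordLess_imp_ordLeq[OF ordLess_ordIso_trans[OF
          computable_wellorder_less_omega1[OF that] ordIso_symmetric[OF r(2)]]])
  with r(1) show ?thesis by blast
qed

section \<open>Baire space and products\<close>

lemma prod_decode_p: "prod_decode s = (p1 s, p2 s)"
  by (simp add: p1_def p2_def)

text \<open>With first difference L the inequality reads \<open>k + 1 < m * (L + 1)\<close>, that
  is, agreement at all n violating it. For positive m these n are at most k, so the quantifier is
  bounded.\<close>

lemma baire_dst_less:
  "dst baire_space x y < real m / (real k + 1) \<longleftrightarrow>
    0 < m \<and> (\<forall>n\<le>k. m * (n + 1) \<le> k + 1 \<longrightarrow> x n = y n)"
proof (cases "x = y")
  case True
  then show ?thesis
    by (simp add: baire_space_def field_simps)
next
  case False
  define L where "L = (LEAST n. x n \<noteq> y n)"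
  have ex: "\<exists>n. x n \<noteq> y n"
    using False by auto
  have L: "x L \<noteq> y L"
    unfolding L_def by (rule LeastI_ex[OF ex])
  have below: "x n = y n" if "n < L" for n
    using not_less_Least[of n "\<lambda>n. x n \<noteq> y n"] that by (auto simp: L_def)
  have "dst baire_space x y < real m / (real k + 1) \<longleftrightarrow> 1 / (real L + 1) < real m / (real k + 1)"
    using False by (simp add: baire_space_def L_def)
  also have "\<dots> \<longleftrightarrow> real (k + 1) < real (m * (L + 1))"
    by (simp add: field_simps)
  also have "\<dots> \<longleftrightarrow> k + 1 < m * (L + 1)"
    by (simp only: of_nat_less_iff)
  also have "\<dots> \<longleftrightarrow> 0 < m \<and> (\<forall>n\<le>k. m * (n + 1) \<le> k + 1 \<longrightarrow> x n = y n)"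
  proof
    assume less: "k + 1 < m * (L + 1)"
    have "x n = y n" if "m * (n + 1) \<le> k + 1" for n
    proof (rule below)
      have "m * (n + 1) < m * (L + 1)"
        using less that by linarith
      then show "n < L" by simp
    qed
    with less show "0 < m \<and> (\<forall>n\<le>k. m * (n + 1) \<le> k + 1 \<longrightarrow> x n = y n)"
      by (cases m) simp_all
  next
    assume *: "0 < m \<and> (\<forall>n\<le>k. m * (n + 1) \<le> k + 1 \<longrightarrow> x n = y n)"
    show "k + 1 < m * (L + 1)"
    proof (rule ccontr)
      assume "\<not> k + 1 < m * (L + 1)"
      then have "m * (L + 1) \<le> k + 1" by simp
      moreover have "L + 1 \<le> m * (L + 1)"
        using * by (cases m) simp_all
      ultimately have "x L = y L"
        using * by simp
      with L show False by simp
    qed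
  qed
  finally show ?thesis .
qed

lemma baire_dst_less_inverse: "dst baire_space x y < 1 / (real k + 1) \<longleftrightarrow> (\<forall>n\<le>k. x n = y n)"
  using baire_dst_less[of x y 1 k] by simp

lemma pts_simps [simp]: "pts baire_space = UNIV" "pts (prod_space X Y) = pts X \<times> pts Y"
  by (simp_all add: baire_space_def prod_space_def)

lemma Metric_space_baire: "Metric_space (pts baire_space) (dst baire_space)"
proof
  fix x y z :: "nat \<Rightarrow> nat"
  show "0 \<le> dst baire_space x y"
    by (simp add: baire_space_def)
  have "(\<lambda>n. x n \<noteq> y n) = (\<lambda>n. y n \<noteq> x n)"
    by auto
  then show "dst baire_space x y = dst baire_space y x"
    by (simp add: baire_space_def)
  show "dst baire_space x y = 0 \<longleftrightarrow> x = y"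
    by (simp add: baire_space_def)
  show "dst baire_space x z \<le> dst baire_space x y + dst baire_space y z"
  proof (cases "x = z")
    case False
    define L where "L = (LEAST n. x n \<noteq> z n)"
    have ex: "\<exists>n. x n \<noteq> z n"
      using False by auto
    have L: "x L \<noteq> z L"
      unfolding L_def by (rule LeastI_ex[OF ex])
    have xz: "dst baire_space x z = 1 / (real L + 1)"
      using False by (simp add: baire_space_def L_def)
    have ge: "1 / (real L + 1) \<le> dst baire_space u v" if "u L \<noteq> v L" for u v
      using baire_dst_less_inverse[of u v L] that by auto
    have nonneg: "0 \<le> dst baire_space u v" for u v
      by (simp add: baire_space_def)
    show ?thesis
    proof (cases "x L = y L")
      case True
      then have "1 / (real L + 1) \<le> dst baire_space y z"
        using L by (intro ge) simp
      then show ?thesis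
        unfolding xz using nonneg[of x y] by linarith
    next
      case False
      then have "1 / (real L + 1) \<le> dst baire_space x y"
        by (rule ge)
      then show ?thesis
        unfolding xz using nonneg[of y z] by linarith
    qed
  qed (simp add: baire_space_def)
qed

lemma Metric_space_prod:
  assumes "Metric_space (pts X) (dst X)" "Metric_space (pts Y) (dst Y)"
  shows "Metric_space (pts (prod_space X Y)) (dst (prod_space X Y))"
proof -
  interpret X: Metric_space "pts X" "dst X" by (rule assms)
  interpret Y: Metric_space "pts Y" "dst Y" by (rule assms)
  have d: "dst (prod_space X Y) p q = max (dst X (fst p) (fst q)) (dst Y (snd p) (snd q))" for p q
    by (simp add: prod_space_def)
  show ?thesis
  proof
    fix p q s
    show "0 \<le> dst (prod_space X Y) p q"
      by (simp add: d le_max_iff_disj)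
    show "dst (prod_space X Y) p q = dst (prod_space X Y) q p"
      by (simp add: d X.commute Y.commute)
    assume p: "p \<in> pts (prod_space X Y)" and q: "q \<in> pts (prod_space X Y)"
    then have in_pts: "fst p \<in> pts X" "snd p \<in> pts Y" "fst q \<in> pts X" "snd q \<in> pts Y"
      by auto
    have "dst (prod_space X Y) p q = 0 \<longleftrightarrow> dst X (fst p) (fst q) = 0 \<and> dst Y (snd p) (snd q) = 0"
      unfolding d using X.nonneg[of "fst p" "fst q"] Y.nonneg[of "snd p" "snd q"] by linarith
    then show "dst (prod_space X Y) p q = 0 \<longleftrightarrow> p = q"
      by (simp add: in_pts prod_eq_iff)
    assume s: "s \<in> pts (prod_space X Y)"
    then have "fst s \<in> pts X" "snd s \<in> pts Y"
      by auto
    then show "dst (prod_space X Y) p s \<le> dst (prod_space X Y) p q + dst (prod_space X Y) q s"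
      unfolding d using X.triangle[of "fst p" "fst q" "fst s"] Y.triangle[of "snd p" "snd q" "snd s"] in_pts
      by linarith
  qed
qed

lemma baire_dns: "dns baire_space a n = (if n < llen a then snth a n else 0)"
  by (simp add: baire_space_def snth_nth flip: llen_def)

lemma urec_baire_dns:
  "urec \<Phi> A \<Longrightarrow> urec \<Phi> N \<Longrightarrow> urec \<Phi> (\<lambda>f x. dns baire_space (A f x) (N f x))"
  unfolding baire_dns by (intro rec_intros)

lemma baire_dns_approx: "\<exists>a. \<forall>n\<le>k. dns baire_space a n = g n"
  by (intro exI[of _ "list_encode (map g [0..<Suc k])"]) (auto simp: baire_dns simp del: upt_Suc)

section \<open>Names of points\<close>

locale presented_space =
  fixes X :: "'a presented"
  assumes rec_presented: "rec_presented_Polish X"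
begin

sublocale Metric_space "pts X" "dst X"
  using rec_presented by (simp add: rec_presented_Polish_def)

lemma dns_pts [simp]: "dns X i \<in> pts X"
  using rec_presented by (auto simp: rec_presented_Polish_def)

lemma dense:
  assumes "x \<in> pts X" "0 < \<epsilon>" shows "\<exists>i. dst X x (dns X i) < \<epsilon>"
proof -
  have "mtopology closure_of (range (dns X)) = pts X"
    using rec_presented by (simp add: rec_presented_Polish_def)
  with assms show ?thesis
    unfolding metric_closure_of by auto
qed

section \<open>Decidable inequalities between distances of dense points\<close>

lemma dec_dst_le:
  assumes "urec \<Phi> I" "urec \<Phi> J" "urec \<Phi> M" "urec \<Phi> K"
  shows "dec \<Phi> (\<lambda>f x. dst X (dns X (I f x)) (dns X (J f x)) \<le> real (M f x) / (real (K f x) + 1))"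
proof -
  have "computable_rel_in no_oracle 4
      (\<lambda>xs. dst X (dns X (xs ! 0)) (dns X (xs ! 1)) \<le> real (xs ! 2) / (real (xs ! 3) + 1))"
    using rec_presented by (simp add: rec_presented_Polish_def)
  from dec_comp[OF dec_no_oracle[OF computable_rel_in_4D[OF this]]
      urec_pair[OF assms(1) urec_pair[OF assms(2) urec_pair[OF assms(3,4)]]]]
  show ?thesis by simp
qed

lemma dec_dst_less:
  assumes "urec \<Phi> I" "urec \<Phi> J" "urec \<Phi> M" "urec \<Phi> K"
  shows "dec \<Phi> (\<lambda>f x. dst X (dns X (I f x)) (dns X (J f x)) < real (M f x) / (real (K f x) + 1))"
proof -
  have "computable_rel_in no_oracle 4
      (\<lambda>xs. dst X (dns X (xs ! 0)) (dns X (xs ! 1)) < real (xs ! 2) / (real (xs ! 3) + 1))"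
    using rec_presented by (simp add: rec_presented_Polish_def)
  from dec_comp[OF dec_no_oracle[OF computable_rel_in_4D[OF this]]
      urec_pair[OF assms(1) urec_pair[OF assms(2) urec_pair[OF assms(3,4)]]]]
  show ?thesis by simp
qed

lemma inverse_sum: "1 / (real j + 1) + 1 / (real k + 1) = real (j + k + 2) / (real (j * k + j + k) + 1)"
  by (simp add: field_simps)

lemma dec_dst_le_sum:
  assumes "urec \<Phi> I" "urec \<Phi> J" "urec \<Phi> M" "urec \<Phi> K"
  shows "dec \<Phi> (\<lambda>f x. dst X (dns X (I f x)) (dns X (J f x)) \<le> 1 / (real (M f x) + 1) + 1 / (real (K f x) + 1))"
  unfolding inverse_sum by (intro dec_dst_le assms urec_add urec_mult urec_const)

text \<open>Brings the inequality into the form decided by the presentation. Where the subtraction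
  truncates, both sides are false because distances are nonnegative.\<close>

lemma dst_add_less:
  "dst X u v + 1 / (real n + 1) < real m / (real k + 1) \<longleftrightarrow>
    dst X u v < real (m * (n + 1) - (k + 1)) / (real (k * n + k + n) + 1)"
proof -
  have *: "real (k * n + k + n) + 1 = (real k + 1) * (real n + 1)"
    by (simp add: algebra_simps)
  have "dst X u v + 1 / (real n + 1) < real m / (real k + 1) \<longleftrightarrow>
      dst X u v * ((real k + 1) * (real n + 1)) < real m * (real n + 1) - (real k + 1)"
    by (simp add: field_simps)
  also have "\<dots> \<longleftrightarrow> dst X u v * ((real k + 1) * (real n + 1)) < real (m * (n + 1) - (k + 1))"
  proof (cases "k + 1 \<le> m * (n + 1)")
    case True
    then have "real (m * (n + 1) - (k + 1)) = real (m * (n + 1)) - real (k + 1)"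
      by (rule of_nat_diff)
    also have "\<dots> = real m * (real n + 1) - (real k + 1)"
      by (simp add: algebra_simps)
    finally show ?thesis by simp
  next
    case False
    then have "real (m * (n + 1)) < real (k + 1)"
      by (simp only: of_nat_less_iff not_le)
    then have "real m * (real n + 1) - (real k + 1) < 0"
      by (simp add: algebra_simps)
    moreover have "0 \<le> dst X u v * ((real k + 1) * (real n + 1))"
      by simp
    moreover have "real (m * (n + 1) - (k + 1)) = 0"
      using False by simp
    ultimately show ?thesis by linarith
  qed
  also have "\<dots> \<longleftrightarrow> dst X u v < real (m * (n + 1) - (k + 1)) / (real (k * n + k + n) + 1)"
    unfolding * by (rule pos_less_divide_eq[symmetric]) simp
  finally show ?thesis .
qed

lemma dec_dst_add_less:
  assumes "urec \<Phi> I" "urec \<Phi> J" "urec \<Phi> N" "urec \<Phi> M" "urec \<Phi> K"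
  shows "dec \<Phi> (\<lambda>f x. dst X (dns X (I f x)) (dns X (J f x)) + 1 / (real (N f x) + 1)
    < real (M f x) / (real (K f x) + 1))"
  unfolding dst_add_less by (intro dec_dst_less assms urec_add urec_mult urec_diff urec_const)

definition names :: "(nat \<Rightarrow> nat) \<Rightarrow> 'a \<Rightarrow> bool" where
  "names y x \<longleftrightarrow> x \<in> pts X \<and> (\<forall>k. dst X x (dns X (y k)) \<le> 1 / (real k + 1))"

lemma small_inverse: "0 < \<epsilon> \<Longrightarrow> \<exists>n. 1 / (real n + 1) < (\<epsilon> :: real)"
  using reals_Archimedean[of \<epsilon>] by (simp add: inverse_eq_divide add.commute)

lemma small_inverse_double: "0 < \<epsilon> \<Longrightarrow> \<exists>n. 1 / (real n + 1) + 1 / (real n + 1) < (\<epsilon> :: real)"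
proof -
  assume "0 < \<epsilon>"
  then obtain n where n: "1 / (real n + 1) < \<epsilon> / 2"
    using small_inverse[of "\<epsilon> / 2"] by auto
  from add_strict_mono[OF n n] show ?thesis
    unfolding field_sum_of_halves by blast
qed

lemma names_unique:
  assumes "names y x" "names y x'" shows "x = x'"
proof (rule ccontr)
  assume "x \<noteq> x'"
  have x: "x \<in> pts X" "x' \<in> pts X"
    using assms by (simp_all add: names_def)
  with \<open>x \<noteq> x'\<close> have "0 < dst X x x' / 2"
    by (simp add: mdist_pos_eq)
  then obtain n where n: "1 / (real n + 1) < dst X x x' / 2"
    using small_inverse by blast
  have "dst X x x' \<le> dst X x (dns X (y n)) + dst X (dns X (y n)) x'"
    using x by (intro triangle) simp_all
  also have "\<dots> \<le> 1 / (real n + 1) + 1 / (real n + 1)"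
    using assms by (intro add_mono) (simp_all add: names_def commute)
  finally show False
    using n by simp
qed

text \<open>By completeness, being a name is a universal condition on y with a decidable matrix; the
  point itself does not occur in it.\<close>

lemma names_exist_iff:
  "(\<exists>x. names y x) \<longleftrightarrow>
    (\<forall>j k. dst X (dns X (y j)) (dns X (y k)) \<le> 1 / (real j + 1) + 1 / (real k + 1))"
proof
  assume "\<exists>x. names y x"
  then obtain x where x: "x \<in> pts X" "\<And>k. dst X x (dns X (y k)) \<le> 1 / (real k + 1)"
    unfolding names_def by blast
  show "\<forall>j k. dst X (dns X (y j)) (dns X (y k)) \<le> 1 / (real j + 1) + 1 / (real k + 1)"
  proof (intro allI)
    fix j k
    have "dst X (dns X (y j)) (dns X (y k)) \<le> dst X (dns X (y j)) x + dst X x (dns X (y k))"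
      using x(1) by (intro triangle) simp_all
    also have "\<dots> \<le> 1 / (real j + 1) + 1 / (real k + 1)"
      using x(2) by (intro add_mono) (simp_all add: commute)
    finally show "dst X (dns X (y j)) (dns X (y k)) \<le> 1 / (real j + 1) + 1 / (real k + 1)" .
  qed
next
  assume *: "\<forall>j k. dst X (dns X (y j)) (dns X (y k)) \<le> 1 / (real j + 1) + 1 / (real k + 1)"
  have "MCauchy (\<lambda>k. dns X (y k))"
    unfolding MCauchy_def
  proof (intro conjI allI impI)
    fix \<epsilon> :: real
    assume "0 < \<epsilon>"
    then obtain N where N: "1 / (real N + 1) < \<epsilon> / 2"
      using small_inverse[of "\<epsilon> / 2"] by auto
    show "\<exists>N. \<forall>n n'. N \<le> n \<longrightarrow> N \<le> n' \<longrightarrow> dst X (dns X (y n)) (dns X (y n')) < \<epsilon>"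
    proof (intro exI allI impI)
      fix n n'
      assume "N \<le> n" "N \<le> n'"
      then have "1 / (real n + 1) \<le> 1 / (real N + 1)" "1 / (real n' + 1) \<le> 1 / (real N + 1)"
        by (simp_all add: frac_le)
      moreover have "dst X (dns X (y n)) (dns X (y n')) \<le> 1 / (real n + 1) + 1 / (real n' + 1)"
        using * by blast
      ultimately show "dst X (dns X (y n)) (dns X (y n')) < \<epsilon>"
        using N by linarith
    qed
  qed auto
  moreover have "mcomplete"
    using rec_presented by (simp add: rec_presented_Polish_def)
  ultimately obtain x where "limitin mtopology (\<lambda>k. dns X (y k)) x sequentially"
    unfolding mcomplete_def by blast
  then have x: "x \<in> pts X" "\<And>\<epsilon>. 0 < \<epsilon> \<Longrightarrow> \<exists>N. \<forall>n\<ge>N. dst X (dns X (y n)) x < \<epsilon>"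
    unfolding limit_metric_sequentially by auto
  have "dst X x (dns X (y k)) \<le> 1 / (real k + 1)" for k
  proof (rule field_le_epsilon)
    fix \<epsilon> :: real
    assume "0 < \<epsilon>"
    then obtain N where N: "\<forall>n\<ge>N. dst X (dns X (y n)) x < \<epsilon> / 2"
      using x(2)[of "\<epsilon> / 2"] by auto
    obtain M where M: "1 / (real M + 1) < \<epsilon> / 2"
      using small_inverse[of "\<epsilon> / 2"] \<open>0 < \<epsilon>\<close> by auto
    have "1 / (real (max N M) + 1) \<le> 1 / (real M + 1)"
      by (simp add: frac_le)
    moreover have "dst X x (dns X (y k)) \<le> dst X x (dns X (y (max N M))) + dst X (dns X (y (max N M))) (dns X (y k))"
      using x(1) by (intro triangle) simp_all
    moreover have "dst X (dns X (y (max N M))) x < \<epsilon> / 2"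
      using N by simp
    then have "dst X x (dns X (y (max N M))) < \<epsilon> / 2"
      by (simp add: commute)
    moreover have "dst X (dns X (y (max N M))) (dns X (y k)) \<le> 1 / (real (max N M) + 1) + 1 / (real k + 1)"
      using * by blast
    ultimately show "dst X x (dns X (y k)) \<le> 1 / (real k + 1) + \<epsilon>"
      using M by linarith
  qed
  with x(1) show "\<exists>x. names y x"
    unfolding names_def by blast
qed

text \<open>A strict inequality for the point becomes existential over decidable inequalities
  between dense points, since it leaves room for twice the error of a good approximation.\<close>

lemma names_dst_less:
  assumes "names y x"
  shows "dst X x (dns X i) < \<rho> \<longleftrightarrow> (\<exists>n. dst X (dns X (y n)) (dns X i) + 1 / (real n + 1) < \<rho>)"
proof
  assume "dst X x (dns X i) < \<rho>"
  then have "0 < \<rho> - dst X x (dns X i)" by simp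
  then obtain n where n: "1 / (real n + 1) + 1 / (real n + 1) < \<rho> - dst X x (dns X i)"
    using small_inverse_double by blast
  have "dst X (dns X (y n)) (dns X i) \<le> dst X (dns X (y n)) x + dst X x (dns X i)"
    using assms by (intro triangle) (simp_all add: names_def)
  moreover have "dst X (dns X (y n)) x \<le> 1 / (real n + 1)"
    using assms by (simp add: names_def commute)
  ultimately show "\<exists>n. dst X (dns X (y n)) (dns X i) + 1 / (real n + 1) < \<rho>"
    using n by (intro exI[of _ n]) linarith
next
  assume "\<exists>n. dst X (dns X (y n)) (dns X i) + 1 / (real n + 1) < \<rho>"
  then obtain n where n: "dst X (dns X (y n)) (dns X i) + 1 / (real n + 1) < \<rho>" ..
  have "dst X x (dns X i) \<le> dst X x (dns X (y n)) + dst X (dns X (y n)) (dns X i)"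
    using assms by (intro triangle) (simp_all add: names_def)
  moreover have "dst X x (dns X (y n)) \<le> 1 / (real n + 1)"
    using assms by (simp add: names_def)
  ultimately show "dst X x (dns X i) < \<rho>"
    using n by linarith
qed

lemma names_dst_greater:
  assumes "names y x"
  shows "\<rho> < dst X x (dns X i) \<longleftrightarrow> (\<exists>n. \<rho> + 1 / (real n + 1) < dst X (dns X (y n)) (dns X i))"
proof
  assume "\<rho> < dst X x (dns X i)"
  then have "0 < dst X x (dns X i) - \<rho>" by simp
  then obtain n where n: "1 / (real n + 1) + 1 / (real n + 1) < dst X x (dns X i) - \<rho>"
    using small_inverse_double by blast
  have "dst X x (dns X i) \<le> dst X x (dns X (y n)) + dst X (dns X (y n)) (dns X i)"
    using assms by (intro triangle) (simp_all add: names_def)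
  moreover have "dst X x (dns X (y n)) \<le> 1 / (real n + 1)"
    using assms by (simp add: names_def)
  ultimately show "\<exists>n. \<rho> + 1 / (real n + 1) < dst X (dns X (y n)) (dns X i)"
    using n by (intro exI[of _ n]) linarith
next
  assume "\<exists>n. \<rho> + 1 / (real n + 1) < dst X (dns X (y n)) (dns X i)"
  then obtain n where n: "\<rho> + 1 / (real n + 1) < dst X (dns X (y n)) (dns X i)" ..
  have "dst X (dns X (y n)) (dns X i) \<le> dst X (dns X (y n)) x + dst X x (dns X i)"
    using assms by (intro triangle) (simp_all add: names_def)
  moreover have "dst X (dns X (y n)) x \<le> 1 / (real n + 1)"
    using assms by (simp add: names_def commute)
  ultimately show "\<rho> < dst X x (dns X i)"
    using n by linarith
qed

text \<open>Singling out one name per point, the least one, makes ranks of trees over names well defined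
  on points.\<close>

definition canonical :: "(nat \<Rightarrow> nat) \<Rightarrow> 'a \<Rightarrow> bool" where
  "canonical y x \<longleftrightarrow> names y x \<and> (\<forall>k. \<forall>i<y k. 1 / (real k + 1) < dst X x (dns X i))"

lemma canonical_exists:
  assumes "x \<in> pts X" shows "\<exists>y. canonical y x"
proof -
  define y where "y k = (LEAST i. dst X x (dns X i) \<le> 1 / (real k + 1))" for k
  have ex: "\<exists>i. dst X x (dns X i) \<le> 1 / (real k + 1)" for k
    using dense[OF assms, of "1 / (real k + 1)"] by (auto intro: less_imp_le)
  have "dst X x (dns X (y k)) \<le> 1 / (real k + 1)" for k
    unfolding y_def by (rule LeastI_ex[OF ex])
  moreover have "1 / (real k + 1) < dst X x (dns X i)" if "i < y k" for i k
    using not_less_Least that unfolding y_def not_le[symmetric] by blast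
  ultimately show ?thesis
    unfolding canonical_def names_def using assms by blast
qed

lemma canonical_unique:
  assumes "canonical y x" "canonical y' x" shows "y = y'"
proof
  fix k
  have "\<not> v k < u k" if "canonical u x" "canonical v x" for u v
  proof
    assume "v k < u k"
    then have "1 / (real k + 1) < dst X x (dns X (v k))"
      using that(1) unfolding canonical_def by blast
    moreover have "dst X x (dns X (v k)) \<le> 1 / (real k + 1)"
      using that(2) unfolding canonical_def names_def by blast
    ultimately show False by linarith
  qed
  from this[OF assms] this[OF assms(2,1)] show "y k = y' k"
    by simp
qed

text \<open>Minimality requires a strict lower bound on a distance for each pair t of k and i; by
  \<open>names_dst_greater\<close> each bound has a witness, and h collects them all.\<close>

lemma S11_canonical: "\<exists>I. S11 I \<and> (\<forall>g y x. names y x \<longrightarrow> (I (join g y) \<longleftrightarrow> canonical y x))"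
proof -
  define I where "I z \<longleftrightarrow> (\<exists>h. \<forall>t. p2 t < right z (p1 t) \<longrightarrow>
    \<not> dst X (dns X (right z (h t))) (dns X (p2 t)) \<le> 1 / (real (p1 t) + 1) + 1 / (real (h t) + 1))" for z
  have "S11 I"
    unfolding I_def
    by (rule S11I) (unfold left_def right_def, intro rec_intros dec_dst_le_sum)
  moreover have "I (join g y) \<longleftrightarrow> canonical y x" if "names y x" for g y x
  proof -
    have "I (join g y) \<longleftrightarrow> (\<forall>t. \<exists>n. p2 t < y (p1 t) \<longrightarrow>
        1 / (real (p1 t) + 1) + 1 / (real n + 1) < dst X (dns X (y n)) (dns X (p2 t)))"
      unfolding I_def choice_iff by (simp add: not_le)
    also have "\<dots> \<longleftrightarrow> (\<forall>t. p2 t < y (p1 t) \<longrightarrow> 1 / (real (p1 t) + 1) < dst X x (dns X (p2 t)))"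
      unfolding names_dst_greater[OF that] by simp
    also have "\<dots> \<longleftrightarrow> (\<forall>k i. i < y k \<longrightarrow> 1 / (real k + 1) < dst X x (dns X i))"
      by (rule all_pair[of "\<lambda>k i. i < y k \<longrightarrow> 1 / (real k + 1) < dst X x (dns X i)"])
    finally show ?thesis
      using that by (simp add: canonical_def)
  qed
  ultimately show ?thesis by blast
qed


section \<open>Sigma-1-1 sets over a space and predicates of names\<close>

lemma dst_prod: "dst (prod_space Y Z) p q = max (dst Y (fst p) (fst q)) (dst Z (snd p) (snd q))"
  by (simp add: prod_space_def)

lemma dns_prod: "dns (prod_space Y Z) s = (dns Y (p1 s), dns Z (p2 s))"
  by (simp add: prod_space_def prod_decode_p)

text \<open>\<open>p1 s\<close> codes the centre, namely ((centre for g, centre for x), centre for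
  h), and \<open>p2 s\<close> the radius. The maximum metric separates the three conditions.\<close>

lemma nbhd_baire_prod:
  "((g, x), h) \<in> nbhd (prod_space (prod_space baire_space X) baire_space) s \<longleftrightarrow> x \<in> pts X \<and>
    dst baire_space (dns baire_space (p1 (p1 (p1 s)))) g < real (p1 (p2 s)) / (real (p2 (p2 s)) + 1) \<and>
    dst X x (dns X (p2 (p1 (p1 s)))) < real (p1 (p2 s)) / (real (p2 (p2 s)) + 1) \<and>
    dst baire_space (dns baire_space (p2 (p1 s))) h < real (p1 (p2 s)) / (real (p2 (p2 s)) + 1)"
proof -
  have "Metric_space (pts (prod_space (prod_space baire_space X) baire_space))
      (dst (prod_space (prod_space baire_space X) baire_space))"
    by (intro Metric_space_prod Metric_space_baire Metric_space_axioms)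
  note mball = Metric_space.in_mball[OF this]
  show ?thesis
    unfolding nbhd_def prod_decode_p prod.case mball
    by (auto simp: dst_prod dns_prod commute)
qed

text \<open>Avoiding all enumerated balls is universal over the index s and the certificates for its
  enumeration. The distance of x from a centre is known only through approximations n, but it too
  occurs negatively, so n joins the universal quantifier.\<close>

lemma Sigma11_imp_S11:
  assumes "Sigma11 (prod_space baire_space X) A"
  shows "S11 (\<lambda>z. \<exists>x. names (right z) x \<and> (left z, x) \<in> A)"
proof -
  let ?Z = "prod_space (prod_space baire_space X) baire_space"
  obtain C where "Pi01 ?Z C" and A: "A = {p. \<exists>h. (p, h) \<in> C}"
    using assms unfolding Sigma11_def by blast
  then obtain R where "ce_set R" and C: "C = pts ?Z - (\<Union>s\<in>R. nbhd ?Z s)"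
    unfolding Pi01_def Sigma01_def by blast
  then obtain e where R: "R = {s. \<exists>v k w. run (res no_oracle k) w e s v}"
    using ce_setD by blast
  define near where "near f a m k \<longleftrightarrow> 0 < m \<and> (\<forall>l\<le>k. m * (l + 1) \<le> k + 1 \<longrightarrow> dns baire_space a l = f l)"
    for f and a m k :: nat
  define B where "B g y h s n v k w \<longleftrightarrow> run (res no_oracle k) w e s v \<longrightarrow>
    \<not> (near g (p1 (p1 (p1 s))) (p1 (p2 s)) (p2 (p2 s)) \<and> near h (p2 (p1 s)) (p1 (p2 s)) (p2 (p2 s)) \<and>
      dst X (dns X (y n)) (dns X (p2 (p1 (p1 s)))) + 1 / (real n + 1) < real (p1 (p2 s)) / (real (p2 (p2 s)) + 1))"
    for g h y and s n v k w :: nat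
  have quintuple: "(\<forall>x. P (p1 x) (p1 (p2 x)) (p1 (p2 (p2 x))) (p1 (p2 (p2 (p2 x)))) (p2 (p2 (p2 (p2 x))))) \<longleftrightarrow>
      (\<forall>s n v k w. P s n v k w)" for P :: "nat \<Rightarrow> nat \<Rightarrow> nat \<Rightarrow> nat \<Rightarrow> nat \<Rightarrow> bool"
  proof safe
    fix s n v k w
    assume *: "\<forall>x. P (p1 x) (p1 (p2 x)) (p1 (p2 (p2 x))) (p1 (p2 (p2 (p2 x)))) (p2 (p2 (p2 (p2 x))))"
    from *[rule_format, of "pair s (pair n (pair v (pair k w)))"] show "P s n v k w"
      by simp
  qed simp
  have fol: "(\<forall>s. (\<exists>v k w. E s v k w) \<longrightarrow> \<not> (M s \<and> N s \<and> (\<exists>n. D s n))) \<longleftrightarrow>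
      (\<forall>s n v k w. E s v k w \<longrightarrow> \<not> (M s \<and> N s \<and> D s n))"
    for E :: "nat \<Rightarrow> nat \<Rightarrow> nat \<Rightarrow> nat \<Rightarrow> bool" and M N :: "nat \<Rightarrow> bool" and D :: "nat \<Rightarrow> nat \<Rightarrow> bool"
    by blast
  have mem: "(g, x) \<in> A \<longleftrightarrow> (\<exists>h. \<forall>s n v k w. B g y h s n v k w)" if y: "names y x" for g x y
  proof -
    have x: "x \<in> pts X"
      using y by (simp add: names_def)
    have "((g, x), h) \<in> C \<longleftrightarrow> (\<forall>s n v k w. B g y h s n v k w)" for h
    proof -
      have "((g, x), h) \<in> nbhd ?Z s \<longleftrightarrow> near g (p1 (p1 (p1 s))) (p1 (p2 s)) (p2 (p2 s)) \<and>
          near h (p2 (p1 s)) (p1 (p2 s)) (p2 (p2 s)) \<and>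
          (\<exists>n. dst X (dns X (y n)) (dns X (p2 (p1 (p1 s)))) + 1 / (real n + 1)
            < real (p1 (p2 s)) / (real (p2 (p2 s)) + 1))" for s
        unfolding nbhd_baire_prod names_dst_less[OF y] baire_dst_less near_def using x by blast
      note nb = this
      have "((g, x), h) \<in> C \<longleftrightarrow>
          (\<forall>s. (\<exists>v k w. run (res no_oracle k) w e s v) \<longrightarrow> ((g, x), h) \<notin> nbhd ?Z s)"
        unfolding C R using x by auto
      also have "\<dots> \<longleftrightarrow> (\<forall>s n v k w. B g y h s n v k w)"
        unfolding B_def nb by (rule fol)
      finally show ?thesis .
    qed
    then show ?thesis
      unfolding A by simp
  qed
  have "S11 (\<lambda>z. \<exists>h :: nat \<Rightarrow> nat. \<forall>t. dst X (dns X (right z (p1 t))) (dns X (right z (p2 t)))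
      \<le> 1 / (real (p1 t) + 1) + 1 / (real (p2 t) + 1))"
    by (rule S11I) (unfold left_def right_def, intro rec_intros dec_dst_le_sum)
  moreover have "(\<exists>h :: nat \<Rightarrow> nat. \<forall>t. dst X (dns X (right z (p1 t))) (dns X (right z (p2 t)))
      \<le> 1 / (real (p1 t) + 1) + 1 / (real (p2 t) + 1)) \<longleftrightarrow> (\<exists>x. names (right z) x)" for z
    unfolding names_exist_iff all_pair[of "\<lambda>j k. dst X (dns X (right z j)) (dns X (right z k))
      \<le> 1 / (real j + 1) + 1 / (real k + 1)"] by simp
  ultimately have "S11 (\<lambda>z. \<exists>x. names (right z) x)"
    by (simp only:)
  moreover have "S11 (\<lambda>z. \<exists>h. \<forall>x. B (left z) (right z) h
      (p1 x) (p1 (p2 x)) (p1 (p2 (p2 x))) (p1 (p2 (p2 (p2 x)))) (p2 (p2 (p2 (p2 x)))))"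
    unfolding B_def near_def no_oracle_def
    by (rule S11I)
      (unfold left_def right_def, intro rec_intros dec_dst_add_less dec_run urec_baire_dns)
  then have "S11 (\<lambda>z. \<exists>h. \<forall>s n v k w. B (left z) (right z) h s n v k w)"
    by (simp only: quintuple)
  ultimately have "S11 (\<lambda>z. (\<exists>x. names (right z) x) \<and> (\<exists>h. \<forall>s n v k w. B (left z) (right z) h s n v k w))"
    by (rule S11_conj)
  moreover have "(\<exists>x. names (right z) x) \<and> (\<exists>h. \<forall>s n v k w. B (left z) (right z) h s n v k w) \<longleftrightarrow>
      (\<exists>x. names (right z) x \<and> (left z, x) \<in> A)" for z
  proof -
    have "(\<exists>h. \<forall>s n v k w. B (left z) (right z) h s n v k w) \<longleftrightarrow> (left z, x) \<in> A"
      if "names (right z) x" for x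
      using mem[OF that, of "left z"] by (rule sym)
    then show ?thesis by meson
  qed
  ultimately show ?thesis by (simp only:)
qed

text \<open>The witness H carries a name of x on the left and a branch over it on the right. Every
  violation is visible from finitely many values of g and H and an approximation of x, so the
  complement of C is a computable union of balls.\<close>

lemma S11_imp_Sigma11:
  assumes "S11 B"
  shows "Sigma11 (prod_space baire_space X) {(g, x). \<exists>y. names y x \<and> B (join g y)}"
proof -
  let ?Z = "prod_space (prod_space baire_space X) baire_space"
  obtain a where a: "\<And>z. B z \<longleftrightarrow> (\<exists>h. branch a z h)"
    using S11_index[OF assms] by blast
  define C where "C = {((g, x), H). names (left H) x \<and> branch a (join g (left H)) (right H)}"
  let ?q = "dns baire_space"
  \<comment> \<open>Only radii 1/(N+1) with N = \<open>p2 (p2 s)\<close> occur: such a ball fixes g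
    and H up to position N. The extra 1/(N+1) in the distance test pays for replacing x by the
    centre.\<close>
  define R where "R s \<longleftrightarrow> p1 (p2 s) = 1 \<and>
    ((\<exists>j\<le>p2 (p2 s). \<not> dst X (dns X (p2 (p1 (p1 s)))) (dns X (p1 (?q (p2 (p1 s)) j)))
        \<le> 1 / (real j + 1) + 1 / (real (p2 (p2 s)) + 1)) \<or>
     bad a (res (\<lambda>l. pair (pair (?q (p1 (p1 (p1 s))) l) (p1 (?q (p2 (p1 s)) l))) (p2 (?q (p2 (p1 s)) l)))
       (p2 (p2 s))))" for s
  have "dec {no_oracle} (\<lambda>f s. R s)"
    unfolding R_def by (intro rec_intros dec_dst_le_sum dec_bad urec_baire_dns)
  then have "ce_set {s. R s}"
    by (rule ce_setI)
  have "pts ?Z - C = (\<Union>s\<in>{s. R s}. nbhd ?Z s)"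
  proof (intro set_eqI iffI)
    fix p
    assume p: "p \<in> pts ?Z - C"
    obtain g x H where p_eq: "p = ((g, x), H)"
      by (metis prod.exhaust)
    with p have x: "x \<in> pts X" and notC: "\<not> (names (left H) x \<and> branch a (join g (left H)) (right H))"
      by (auto simp: C_def)
    have "\<exists>N i. dst X x (dns X i) < 1 / (real N + 1) \<and>
      ((\<exists>j\<le>N. 1 / (real j + 1) + 1 / (real N + 1) < dst X (dns X i) (dns X (left H j))) \<or>
       bad a (res (join (join g (left H)) (right H)) N))"
    proof (cases "names (left H) x")
      case True
      with notC obtain N where "bad a (res (join (join g (left H)) (right H)) N)"
        unfolding branch_def by blast
      moreover obtain i where "dst X x (dns X i) < 1 / (real N + 1)"
        using dense[OF x, of "1 / (real N + 1)"] by auto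
      ultimately show ?thesis by blast
    next
      case False
      then obtain j where j: "1 / (real j + 1) < dst X x (dns X (left H j))"
        using x unfolding names_def by (auto simp: not_le)
      then have "0 < dst X x (dns X (left H j)) - 1 / (real j + 1)"
        by simp
      then obtain M where
        M: "1 / (real M + 1) + 1 / (real M + 1) < dst X x (dns X (left H j)) - 1 / (real j + 1)"
        using small_inverse_double by blast
      \<comment> \<open>Beyond j, so that the ball fixes the offending entry of the name, and beyond
        M, so that the gap absorbs both the error of the centre and the tolerance in R.\<close>
      define N where "N = max M j"
      have N: "1 / (real N + 1) \<le> 1 / (real M + 1)"
        by (simp add: N_def frac_le)
      obtain i where i: "dst X x (dns X i) < 1 / (real N + 1)"
        using dense[OF x, of "1 / (real N + 1)"] by auto
      have "dst X x (dns X (left H j)) \<le> dst X x (dns X i) + dst X (dns X i) (dns X (left H j))"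
        using x by (intro triangle) simp_all
      then have "1 / (real j + 1) + 1 / (real N + 1) < dst X (dns X i) (dns X (left H j))"
        using i N M by linarith
      moreover have "j \<le> N"
        by (simp add: N_def)
      ultimately show ?thesis
        using i by blast
    qed
    then obtain N i where i: "dst X x (dns X i) < 1 / (real N + 1)"
      and viol: "(\<exists>j\<le>N. 1 / (real j + 1) + 1 / (real N + 1) < dst X (dns X i) (dns X (left H j))) \<or>
       bad a (res (join (join g (left H)) (right H)) N)"
      by blast
    obtain b c where b: "\<forall>n\<le>N. ?q b n = g n" and c: "\<forall>n\<le>N. ?q c n = H n"
      using baire_dns_approx[of N g] baire_dns_approx[of N H] by blast
    define s where "s = pair (pair (pair b i) c) (pair 1 N)"
    have "res (\<lambda>l. pair (pair (?q b l) (p1 (?q c l))) (p2 (?q c l))) N =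
        res (join (join g (left H)) (right H)) N"
      by (rule res_cong) (use b c in \<open>simp add: join_apply\<close>)
    then have "R s"
      using viol c by (auto simp: R_def s_def left_def not_le)
    moreover have "p \<in> nbhd ?Z s"
      using x i b c by (simp add: p_eq s_def nbhd_baire_prod baire_dst_less_inverse)
    ultimately show "p \<in> (\<Union>s\<in>{s. R s}. nbhd ?Z s)"
      by blast
  next
    fix p
    assume "p \<in> (\<Union>s\<in>{s. R s}. nbhd ?Z s)"
    then obtain s where s: "R s" "p \<in> nbhd ?Z s"
      by blast
    obtain g x H where p_eq: "p = ((g, x), H)"
      by (metis prod.exhaust)
    define N where "N = p2 (p2 s)"
    have m: "p1 (p2 s) = 1"
      using s(1) by (simp add: R_def)
    have x: "x \<in> pts X" "dst X x (dns X (p2 (p1 (p1 s)))) < 1 / (real N + 1)"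
      and b: "\<forall>n\<le>N. ?q (p1 (p1 (p1 s))) n = g n" and c: "\<forall>n\<le>N. ?q (p2 (p1 s)) n = H n"
      using s(2) by (simp_all add: p_eq nbhd_baire_prod m baire_dst_less_inverse N_def)
    have "res (\<lambda>l. pair (pair (?q (p1 (p1 (p1 s))) l) (p1 (?q (p2 (p1 s)) l))) (p2 (?q (p2 (p1 s)) l))) N =
        res (join (join g (left H)) (right H)) N"
      by (rule res_cong) (use b c in \<open>simp add: join_apply\<close>)
    then consider j where "j \<le> N"
      "1 / (real j + 1) + 1 / (real N + 1) < dst X (dns X (p2 (p1 (p1 s)))) (dns X (left H j))"
      | "bad a (res (join (join g (left H)) (right H)) N)"
      using s(1) c by (auto simp: R_def left_def not_le simp flip: N_def)
    then have "\<not> (names (left H) x \<and> branch a (join g (left H)) (right H))"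
    proof cases
      case 1
      have "dst X (dns X (p2 (p1 (p1 s)))) (dns X (left H j)) \<le>
          dst X (dns X (p2 (p1 (p1 s)))) x + dst X x (dns X (left H j))"
        using x by (intro triangle) simp_all
      then have "1 / (real j + 1) < dst X x (dns X (left H j))"
        using 1 x(2) commute[of x "dns X (p2 (p1 (p1 s)))"] by linarith
      then have "\<not> names (left H) x"
        unfolding names_def by (auto simp: not_le)
      then show ?thesis by blast
    next
      case 2
      then show ?thesis
        unfolding branch_def by blast
    qed
    then show "p \<in> pts ?Z - C"
      using x by (simp add: p_eq C_def)
  qed
  then have "Sigma01 ?Z (pts ?Z - C)"
    unfolding Sigma01_def using \<open>ce_set {s. R s}\<close> by blast
  moreover have "C \<subseteq> pts ?Z"
    by (auto simp: C_def names_def)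
  then have "C = pts ?Z - (pts ?Z - C)"
    by blast
  ultimately have "Pi01 ?Z C"
    unfolding Pi01_def by blast
  moreover have "{(g, x). \<exists>y. names y x \<and> B (join g y)} = {p. \<exists>H. (p, H) \<in> C}"
  proof (intro set_eqI iffI)
    fix p
    assume "p \<in> {(g, x). \<exists>y. names y x \<and> B (join g y)}"
    then obtain g x y h where "p = (g, x)" "names y x" "branch a (join g y) h"
      unfolding a by blast
    then have "(p, join y h) \<in> C"
      by (simp add: C_def)
    then show "p \<in> {p. \<exists>H. (p, H) \<in> C}"
      by blast
  next
    fix p
    assume "p \<in> {p. \<exists>H. (p, H) \<in> C}"
    then show "p \<in> {(g, x). \<exists>y. names y x \<and> B (join g y)}"
      unfolding a C_def by blast
  qed
  ultimately show ?thesis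
    unfolding Sigma11_def by blast
qed

end

section \<open>Hyperlow functions strongly relativize\<close>

text \<open>A proper extension precedes its initial segments, so the segments of a branch descend
  forever.\<close>

lemma branch_not_wf:
  assumes "branch b z h" shows "\<not> wf (KB (tree b z) - Id)"
proof -
  have "(res h (Suc k), res h k) \<in> KB (tree b z) - Id" for k
  proof -
    have "slt (res h (Suc k)) (res h k) k"
      by (simp add: slt_def del: res.simps)
    moreover have "seqv (res h (Suc k)) (res h k) j" if "j < k" for j
      using that by (simp add: seqv_def del: res.simps)
    ultimately have "kbl (res h (Suc k)) (res h k)"
      by (rule kblI)
    moreover have "res h (Suc k) \<in> tree b z" "res h k \<in> tree b z"
      using assms unfolding branch_tree by blast+
    moreover have "res h (Suc k) \<noteq> res h k"
      by (metis llen_res n_not_Suc_n)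
    ultimately show ?thesis
      by (simp add: KB_def)
  qed
  then show ?thesis
    unfolding wf_iff_no_infinite_down_chain by blast
qed

lemma branch_not_emb: "branch b z h \<Longrightarrow> Well_order r \<Longrightarrow> \<not> emb (KB (tree b z)) r"
  using branch_not_wf emb_wf unfolding well_order_on_def by blast

lemma (in presented_space) hyperlow_strongly_relativizes_at:
  assumes "hyperlow f" shows "strongly_relativizes_at f X"
  unfolding strongly_relativizes_at_def
proof (intro allI impI)
  fix P
  let ?Y = "prod_space baire_space X"
  assume "Delta11_in f X P"
  then obtain A where A: "Sigma11 ?Y A" "P = fsection A f" and "Pi11_in f X P"
    unfolding Delta11_in_def Sigma11_in_def by blast
  then obtain S where S: "Sigma11 ?Y S" "P = fsection (pts ?Y - S) f"
    unfolding Pi11_in_def Pi11_def by blast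
  have A_pts: "x \<in> pts X" if "(g, x) \<in> A" for g x
    using A(1) that unfolding Sigma11_def Pi01_def by auto
  have AS: "x \<in> pts X \<Longrightarrow> (f, x) \<in> A \<longleftrightarrow> (f, x) \<notin> S" for x
    using A(2) S(2) by (auto simp: fsection_def)
  obtain I where I: "S11 I" "\<And>g y x. names y x \<Longrightarrow> I (join g y) \<longleftrightarrow> canonical y x"
    using S11_canonical by blast
  obtain a where a: "\<And>z. (\<exists>x. names (right z) x \<and> (left z, x) \<in> A) \<longleftrightarrow> (\<exists>h. branch a z h)"
    using S11_index[OF Sigma11_imp_S11[OF A(1)]] by blast
  obtain b where b: "\<And>z. (\<exists>x. names (right z) x \<and> (left z, x) \<in> S) \<longleftrightarrow> (\<exists>h. branch b z h)"
    using S11_index[OF Sigma11_imp_S11[OF S(1)]] by blast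
  have disj: "\<not> branch b (join f y) k" if br: "branch a (join f y) h" for y h k
  proof
    assume "branch b (join f y) k"
    then obtain x where x: "names y x" "(f, x) \<in> S"
      using b[of "join f y"] by auto
    obtain x' where x': "names y x'" "(f, x') \<in> A"
      using a[of "join f y"] br by auto
    have "x = x'"
      using x(1) x'(1) by (rule names_unique)
    with x x' AS show False
      by (simp add: names_def)
  qed
  have "\<exists>\<sigma>. computable_wellorder_in f \<sigma> \<and>
      (\<forall>y h. branch a (join f y) h \<longrightarrow> emb (KB (tree b (join f y))) \<sigma>)"
    by (rule boundedness) (rule disj)
  then obtain \<sigma> where \<sigma>: "computable_wellorder_in f \<sigma>"
    "\<And>y h. branch a (join f y) h \<Longrightarrow> emb (KB (tree b (join f y))) \<sigma>"
    by blast
  obtain \<alpha> where \<alpha>: "computable_wellorder_in no_oracle \<alpha>" "\<sigma> \<le>o \<alpha>"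
    using hyperlow_computable[OF assms \<sigma>(1)] by blast
  have wo: "Well_order \<alpha>"
    using \<alpha>(1) by (simp add: computable_wellorder_in_def)
  have "dec UNIV (\<lambda>_ x. (p1 x, p2 x) \<in> \<alpha>)"
    by (rule dec_no_oracle) (use \<alpha>(1) in \<open>simp add: computable_wellorder_in_dec\<close>)
  from dec_decides[OF this] obtain c where c: "\<And>g. decides g c \<alpha>"
    by auto
  \<comment> \<open>Supplies the constant index b and a zero oracle; the code c decides
    \<open>\<alpha>\<close> with any oracle.\<close>
  define F where "F z = join (join (\<lambda>_. b) (\<lambda>_. 0)) z" for z
  have F: "urec UNIV F"
    unfolding F_def join_def by (intro rec_intros)
  obtain E where E: "S11 E" and E': "\<forall>N g z r. decides g c r \<longrightarrow>
      (E (join (join N g) z) \<longleftrightarrow> emb (KB (tree (N 0) z)) r)"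
    using S11_emb[of c] by blast
  have E_iff: "E (F z) \<longleftrightarrow> emb (KB (tree b z)) \<alpha>" for z
    unfolding F_def by (rule E'[rule_format, OF c])
  obtain N where N: "S11 N" and N': "\<forall>N' g z r. decides g c r \<and> Well_order r \<longrightarrow>
      (N (join (join N' g) z) \<longleftrightarrow> \<not> emb (KB (tree (N' 0) z)) r)"
    using S11_not_emb[of c] by blast
  have N_iff: "N (F z) \<longleftrightarrow> \<not> emb (KB (tree b z)) \<alpha>" for z
    unfolding F_def by (rule N'[rule_format, OF conjI, OF c wo])
  \<comment> \<open>Trees over different names of one point may compare differently with
    \<open>\<alpha>\<close>; requiring the canonical name through \<open>I\<close> keeps Q and Q'
    disjoint.\<close>
  define Q where "Q = {(g, x). \<exists>y. names y x \<and> I (join g y) \<and> E (F (join g y))}"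
  define Q' where "Q' = {(g, x). \<exists>y. names y x \<and> I (join g y) \<and> N (F (join g y))}"
  have Q_iff: "(g, x) \<in> Q \<longleftrightarrow> emb (KB (tree b (join g y))) \<alpha>"
    and Q'_iff: "(g, x) \<in> Q' \<longleftrightarrow> \<not> emb (KB (tree b (join g y))) \<alpha>" if y: "canonical y x" for g x y
  proof -
    have "names y' x \<and> I (join g y') \<longleftrightarrow> y' = y" for y'
    proof
      assume "names y' x \<and> I (join g y')"
      then have "canonical y' x"
        using I(2) by blast
      then show "y' = y"
        using y by (rule canonical_unique)
    next
      assume "y' = y"
      moreover have "names y x"
        using y by (simp add: canonical_def)
      ultimately show "names y' x \<and> I (join g y')"
        using I(2) y by simp
    qed
    then show "(g, x) \<in> Q \<longleftrightarrow> emb (KB (tree b (join g y))) \<alpha>"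
      "(g, x) \<in> Q' \<longleftrightarrow> \<not> emb (KB (tree b (join g y))) \<alpha>"
      unfolding Q_def Q'_def mem_Collect_eq prod.case conj_assoc[symmetric] E_iff N_iff by simp_all
  qed
  have "Sigma11 ?Y Q"
    using S11_imp_Sigma11[OF S11_conj[OF I(1) S11_subst[OF E F]]] unfolding Q_def .
  moreover have "Sigma11 ?Y Q'"
    using S11_imp_Sigma11[OF S11_conj[OF I(1) S11_subst[OF N F]]] unfolding Q'_def .
  \<comment> \<open>This holds at every parameter g: each point has exactly one canonical name, and
    its tree either embeds or does not.\<close>
  moreover have "Q = pts ?Y - Q'"
  proof (intro set_eqI)
    fix p :: "(nat \<Rightarrow> nat) \<times> 'a"
    obtain g x where p: "p = (g, x)" by fastforce
    show "p \<in> Q \<longleftrightarrow> p \<in> pts ?Y - Q'"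
    proof (cases "x \<in> pts X")
      case True
      then obtain y where "canonical y x"
        using canonical_exists by blast
      with True show ?thesis
        by (simp add: p Q_iff Q'_iff)
    next
      case False
      then show ?thesis
        by (auto simp: p Q_def names_def)
    qed
  qed
  ultimately have "Delta11 ?Y Q"
    unfolding Delta11_def Pi11_def by blast
  moreover have "P = fsection Q f"
  proof (intro set_eqI)
    fix x
    show "x \<in> P \<longleftrightarrow> x \<in> fsection Q f"
    proof (cases "x \<in> pts X")
      case True
      then obtain y where y: "canonical y x"
        using canonical_exists by blast
      then have names: "names y x"
        by (simp add: canonical_def)
      \<comment> \<open>At f the bound separates: over points of A the tree embeds into
        \<open>\<sigma>\<close> and so into \<open>\<alpha>\<close>, over the other points it has a
        branch and embeds into no well-order.\<close>
      have "emb (KB (tree b (join f y))) \<alpha> \<longleftrightarrow> (f, x) \<in> A"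
      proof
        assume "(f, x) \<in> A"
        then obtain h where "branch a (join f y) h"
          using a[of "join f y"] names by auto
        then show "emb (KB (tree b (join f y))) \<alpha>"
          using \<sigma>(2) ordLeq_emb[OF \<alpha>(2)] emb_trans by blast
      next
        assume emb: "emb (KB (tree b (join f y))) \<alpha>"
        show "(f, x) \<in> A"
        proof (rule ccontr)
          assume "(f, x) \<notin> A"
          then have "(f, x) \<in> S"
            using AS True by blast
          then obtain h where "branch b (join f y) h"
            using b[of "join f y"] names by auto
          from branch_not_emb[OF this wo] emb show False ..
        qed
      qed
      then show ?thesis
        by (simp add: A(2) fsection_def Q_iff[OF y])
    next
      case False
      then show ?thesis
        using A_pts by (auto simp: A(2) fsection_def Q_def names_def)
    qed
  qed
  ultimately show "\<exists>Q. Delta11 ?Y Q \<and> P = fsection Q f"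
    by blast
qed

lemma hyperlow_strongly_relativizes:
  assumes "hyperlow f" shows "strongly_relativizes TYPE('a) f"
  unfolding strongly_relativizes_def
proof (intro allI impI)
  fix X :: "'a presented"
  assume "rec_presented_Polish X"
  then interpret presented_space X
    by unfold_locales
  show "strongly_relativizes_at f X"
    using assms by (rule hyperlow_strongly_relativizes_at)
qed

section \<open>Copies of the natural numbers\<close>

text \<open>Copies of the natural numbers inside any type that admits an injection from
  \<open>nat\<close>; one diagonal argument then covers \<open>nat_space\<close> and a space over
  \<open>nat \<Rightarrow> nat\<close>.\<close>

definition discrete_space :: "(nat \<Rightarrow> 'a) \<Rightarrow> 'a presented" where
  "discrete_space \<iota> = \<lparr>pts = range \<iota>, dst = (\<lambda>x y. if x = y then 0 else 1), dns = \<iota>\<rparr>"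

lemma discrete_space_simps [simp]: "pts (discrete_space \<iota>) = range \<iota>" "dns (discrete_space \<iota>) = \<iota>"
  "dst (discrete_space \<iota>) x y = (if x = y then 0 else 1)"
  by (simp_all add: discrete_space_def)

lemma nat_space_discrete: "nat_space = discrete_space id"
  by (simp add: nat_space_def discrete_space_def id_def)

lemma rec_presented_discrete:
  assumes "inj \<iota>" shows "rec_presented_Polish (discrete_space \<iota>)"
proof -
  interpret Metric_space "pts (discrete_space \<iota>)" "dst (discrete_space \<iota>)"
    by unfold_locales auto
  have "mcomplete"
    unfolding mcomplete_def
  proof (intro allI impI)
    fix s
    assume "MCauchy s"
    then have s: "range s \<subseteq> range \<iota>" "\<exists>N. \<forall>n n'. N \<le> n \<longrightarrow> N \<le> n' \<longrightarrow> dst (discrete_space \<iota>) (s n) (s n') < 1"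
      unfolding MCauchy_def by auto
    then obtain N where N: "\<forall>n n'. N \<le> n \<longrightarrow> N \<le> n' \<longrightarrow> dst (discrete_space \<iota>) (s n) (s n') < 1"
      by blast
    have eq: "s n = s N" if "N \<le> n" for n
      using N[rule_format, OF that, of N] by (simp split: if_splits)
    have "limitin mtopology s (s N) sequentially"
      unfolding limit_metric_sequentially
    proof (intro conjI allI impI)
      fix \<epsilon> :: real
      assume "0 < \<epsilon>"
      show "\<exists>M. \<forall>n\<ge>M. s n \<in> pts (discrete_space \<iota>) \<and> dst (discrete_space \<iota>) (s n) (s N) < \<epsilon>"
      proof (intro exI[of _ N] allI impI)
        fix n
        assume "N \<le> n"
        then have "s n = s N"
          by (rule eq)
        then show "s n \<in> pts (discrete_space \<iota>) \<and> dst (discrete_space \<iota>) (s n) (s N) < \<epsilon>"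
          using s(1) \<open>0 < \<epsilon>\<close> by auto
      qed
    qed (use s(1) in auto)
    then show "\<exists>x. limitin mtopology s x sequentially" ..
  qed
  moreover have "mtopology closure_of range (dns (discrete_space \<iota>)) = pts (discrete_space \<iota>)"
    using closure_of_topspace[of mtopology] unfolding topspace_mtopology
    by (simp only: discrete_space_simps)
  moreover have "computable_rel_in no_oracle 4 (\<lambda>xs. dst (discrete_space \<iota>)
      (dns (discrete_space \<iota>) (xs ! 0)) (dns (discrete_space \<iota>) (xs ! 1)) \<le> real (xs ! 2) / (real (xs ! 3) + 1))"
  proof (rule computable_rel_in_4I)
    have "dst (discrete_space \<iota>) (\<iota> i) (\<iota> j) \<le> real m / (real k + 1) \<longleftrightarrow> i = j \<or> k + 1 \<le> m" for i j m k
      using inj_eq[OF assms] by (auto simp: field_simps)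
    then show "dec {no_oracle} (\<lambda>_ x. dst (discrete_space \<iota>) (dns (discrete_space \<iota>) (p1 x))
        (dns (discrete_space \<iota>) (p1 (p2 x))) \<le> real (p1 (p2 (p2 x))) / (real (p2 (p2 (p2 x))) + 1))"
      by (simp only: discrete_space_simps(2)) (intro rec_intros)
  qed
  moreover have "computable_rel_in no_oracle 4 (\<lambda>xs. dst (discrete_space \<iota>)
      (dns (discrete_space \<iota>) (xs ! 0)) (dns (discrete_space \<iota>) (xs ! 1)) < real (xs ! 2) / (real (xs ! 3) + 1))"
  proof (rule computable_rel_in_4I)
    have "dst (discrete_space \<iota>) (\<iota> i) (\<iota> j) < real m / (real k + 1) \<longleftrightarrow>
        i = j \<and> 0 < m \<or> i \<noteq> j \<and> k + 1 < m" for i j m k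
      using inj_eq[OF assms] by (auto simp: field_simps)
    then show "dec {no_oracle} (\<lambda>_ x. dst (discrete_space \<iota>) (dns (discrete_space \<iota>) (p1 x))
        (dns (discrete_space \<iota>) (p1 (p2 x))) < real (p1 (p2 (p2 x))) / (real (p2 (p2 (p2 x))) + 1))"
      by (simp only: discrete_space_simps(2)) (intro rec_intros)
  qed
  ultimately show ?thesis
    unfolding rec_presented_Polish_def using Metric_space_axioms by simp
qed

section \<open>Strong relativization implies hyperlowness\<close>

text \<open>The diagonal set consists of the \<open>n\<close> such that the tree of the \<open>n\<close>-th \<open>\<Sigma>\<^sup>1\<^sub>1\<close> predicate
  over the point \<open>(n, f)\<close> is not embeddable into an \<open>f\<close>-computable well-order that is longer than all
  computable ones. By boundedness no \<open>f\<close>-section of a \<open>\<Delta>\<^sup>1\<^sub>1\<close> set agrees with it.\<close>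

lemma strongly_relativizes_imp_hyperlow:
  assumes inj: "inj \<iota>" and sr: "strongly_relativizes_at f (discrete_space \<iota>)"
  shows "hyperlow f"
proof (rule ccontr)
  let ?X = "discrete_space \<iota>" and ?Y = "prod_space baire_space (discrete_space \<iota>)"
  interpret presented_space ?X
    by unfold_locales (rule rec_presented_discrete[OF inj])
  assume "\<not> hyperlow f"
  then obtain r where r: "computable_wellorder_in f r"
    and bound: "\<And>\<sigma>. computable_wellorder_in no_oracle \<sigma> \<Longrightarrow> \<sigma> \<le>o r"
    using not_hyperlow_bound by blast
  have wo: "Well_order r"
    using r by (simp add: computable_wellorder_in_def)
  have "dec {f} (\<lambda>_ x. (p1 x, p2 x) \<in> r)"
    using r by (simp add: computable_wellorder_in_dec)
  from dec_decides[OF this] obtain c where c: "decides f c r"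
    by auto
  \<comment> \<open>The zero function in the parameter place and the sequence n, \<open>g 0\<close>,
    \<open>g 1\<close>, ... as the point: the parameter stays computable while g moves into the
    point.\<close>
  define pt where "pt n g = join (\<lambda>_. 0) (\<lambda>i. if i = 0 then n else g (i - 1))" for n and g :: "nat \<Rightarrow> nat"
  \<comment> \<open>The index is read off entry 1 of the name: entry 0 is only required to be within
    distance 1, which says nothing in a discrete space, whereas entry 1 is within 1/2 and must be
    n.\<close>
  define F where "F z = join (join (\<lambda>_. right z 1) (left z)) (pt (right z 1) (left z))" for z
  have F: "urec UNIV F"
    unfolding F_def pt_def join_def left_def right_def by (intro rec_intros)
  have F_eq: "F (join f y) = join (join (\<lambda>_. y 1) f) (pt (y 1) f)" for y
    by (simp add: F_def)
  obtain E where E: "S11 E" and E': "\<forall>N g z r. decides g c r \<longrightarrow>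
      (E (join (join N g) z) \<longleftrightarrow> emb (KB (tree (N 0) z)) r)"
    using S11_emb[of c] by blast
  have E_y: "E (F (join f y)) \<longleftrightarrow> emb (KB (tree (y 1) (pt (y 1) f))) r" for y
    unfolding F_eq by (rule E'[rule_format, OF c])
  obtain N where N: "S11 N" and N': "\<forall>N' g z r. decides g c r \<and> Well_order r \<longrightarrow>
      (N (join (join N' g) z) \<longleftrightarrow> \<not> emb (KB (tree (N' 0) z)) r)"
    using S11_not_emb[of c] by blast
  have N_y: "N (F (join f y)) \<longleftrightarrow> \<not> emb (KB (tree (y 1) (pt (y 1) f))) r" for y
    unfolding F_eq by (rule N'[rule_format, OF conjI, OF c wo])
  have names_1: "y 1 = n" if "names y (\<iota> n)" for y n
  proof -
    have "dst ?X (\<iota> n) (\<iota> (y 1)) \<le> 1 / (real 1 + 1)"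
      using that unfolding names_def discrete_space_simps(2) by blast
    then have "\<iota> n = \<iota> (y 1)"
      by (simp split: if_splits)
    then show ?thesis
      using inj by (simp add: inj_eq)
  qed
  have names_const: "names (\<lambda>_. n) (\<iota> n)" for n
    by (simp add: names_def)
  define P where "P = {\<iota> n | n. \<not> emb (KB (tree n (pt n f))) r}"
  have P_iff: "\<iota> n \<in> P \<longleftrightarrow> \<not> emb (KB (tree n (pt n f))) r" for n
    using inj by (auto simp: P_def inj_eq)
  have E_iff: "(\<exists>y. names y (\<iota> n) \<and> E (F (join f y))) \<longleftrightarrow> emb (KB (tree n (pt n f))) r" for n
    using names_1 names_const[of n] by (auto simp: E_y)
  have N_iff: "(\<exists>y. names y (\<iota> n) \<and> N (F (join f y))) \<longleftrightarrow> \<not> emb (KB (tree n (pt n f))) r" for n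
    using names_1 names_const[of n] by (auto simp: N_y)
  have names_range: "x \<in> range \<iota>" if "names y x" for y x
    using that by (simp add: names_def)
  have "P = fsection {(g, x). \<exists>y. names y x \<and> N (F (join g y))} f"
  proof (intro set_eqI)
    fix x
    show "x \<in> P \<longleftrightarrow> x \<in> fsection {(g, x). \<exists>y. names y x \<and> N (F (join g y))} f"
    proof (cases "x \<in> range \<iota>")
      case True
      then obtain n where x: "x = \<iota> n" by blast
      show ?thesis
        by (simp add: x P_iff fsection_def N_iff)
    next
      case False
      then show ?thesis
        using names_range by (auto simp: P_def fsection_def)
    qed
  qed
  then have "Sigma11_in f ?X P"
    unfolding Sigma11_in_def using S11_imp_Sigma11[OF S11_subst[OF N F]] by blast
  moreover have "P = fsection (pts ?Y - {(g, x). \<exists>y. names y x \<and> E (F (join g y))}) f"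
  proof (intro set_eqI)
    fix x
    show "x \<in> P \<longleftrightarrow> x \<in> fsection (pts ?Y - {(g, x). \<exists>y. names y x \<and> E (F (join g y))}) f"
    proof (cases "x \<in> range \<iota>")
      case True
      then obtain n where x: "x = \<iota> n" by blast
      show ?thesis
        by (simp add: x P_iff fsection_def flip: E_iff)
    next
      case False
      then show ?thesis
        by (auto simp: P_def fsection_def)
    qed
  qed
  then have "Pi11_in f ?X P"
    unfolding Pi11_in_def Pi11_def using S11_imp_Sigma11[OF S11_subst[OF E F]] by blast
  ultimately obtain Q where "Delta11 ?Y Q" and P: "P = fsection Q f"
    using sr unfolding strongly_relativizes_at_def Delta11_in_def by blast
  then obtain S where QS: "Sigma11 ?Y Q" "Sigma11 ?Y S" "Q = pts ?Y - S"
    unfolding Delta11_def Pi11_def by blast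
  \<comment> \<open>Undoes \<open>pt\<close>: the head of the sequence becomes the constant name of
    a point, its tail the parameter. Pulling Q and S back along G makes them predicates of
    sequences.\<close>
  define G where "G v = join (\<lambda>i. right v (i + 1)) (\<lambda>_. right v 0)" for v
  have G: "urec UNIV G"
    unfolding G_def join_def right_def by (intro rec_intros)
  have at_pt: "(\<exists>x. names (right (G (join g w))) x \<and> (left (G (join g w)), x) \<in> A) \<longleftrightarrow>
      ((\<lambda>i. w (i + 1)), \<iota> (w 0)) \<in> A" for A g w
  proof -
    have G_eq: "right (G (join g w)) = (\<lambda>_. w 0)" "left (G (join g w)) = (\<lambda>i. w (i + 1))"
      by (simp_all add: G_def)
    have "names (\<lambda>_. w 0) x \<longleftrightarrow> x = \<iota> (w 0)" for x
      using names_const[of "w 0"] names_unique by blast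
    then show ?thesis
      unfolding G_eq by simp
  qed
  obtain a where a': "\<forall>z. (\<exists>x. names (right (G z)) x \<and> (left (G z), x) \<in> Q) \<longleftrightarrow> (\<exists>h. branch a z h)"
    using S11_index[OF S11_subst[OF Sigma11_imp_S11[OF QS(1)] G]] by (elim exE)
  have a: "((\<lambda>i. w (i + 1)), \<iota> (w 0)) \<in> Q \<longleftrightarrow> (\<exists>h. branch a (join g w) h)" for g w
    using a'[rule_format, of "join g w"] unfolding at_pt .
  obtain e where e': "\<forall>z. (\<exists>x. names (right (G z)) x \<and> (left (G z), x) \<in> S) \<longleftrightarrow> (\<exists>h. branch e z h)"
    using S11_index[OF S11_subst[OF Sigma11_imp_S11[OF QS(2)] G]] by (elim exE)
  have e: "((\<lambda>i. w (i + 1)), \<iota> (w 0)) \<in> S \<longleftrightarrow> (\<exists>h. branch e (join g w) h)" for g w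
    using e'[rule_format, of "join g w"] unfolding at_pt .
  \<comment> \<open>Q and S exclude each other at every parameter, hence for every sequence w;
    boundedness can therefore be applied without f as oracle.\<close>
  have disj: "\<not> branch e (join no_oracle w) k" if "branch a (join no_oracle w) h" for w h k
    using a[of w no_oracle] e[of w no_oracle] QS(3) that by blast
  have "\<exists>\<sigma>. computable_wellorder_in no_oracle \<sigma> \<and>
      (\<forall>w h. branch a (join no_oracle w) h \<longrightarrow> emb (KB (tree e (join no_oracle w))) \<sigma>)"
    by (rule boundedness) (rule disj)
  then obtain \<sigma> where \<sigma>: "computable_wellorder_in no_oracle \<sigma>"
    "\<And>w h. branch a (join no_oracle w) h \<Longrightarrow> emb (KB (tree e (join no_oracle w))) \<sigma>"
    by blast
  define w where "w = (\<lambda>i. if i = 0 then e else f (i - 1))"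
  have w: "(\<lambda>i. w (i + 1)) = f" "w 0 = e" "pt e f = join no_oracle w"
    by (auto simp: w_def pt_def no_oracle_def)
  show False
  \<comment> \<open>The diagonal index is that of S. Membership in Q makes its tree embed into r,
    against the definition of P; otherwise its tree has a branch, which puts the point into
    P.\<close>
  proof (cases "(f, \<iota> e) \<in> Q")
    case True
    then obtain h where "branch a (join no_oracle w) h"
      using a[of w no_oracle] w by auto
    from \<sigma>(2)[OF this] have "emb (KB (tree e (pt e f))) r"
      unfolding w(3) by (rule emb_trans[OF _ ordLeq_emb[OF bound[OF \<sigma>(1)]]])
    moreover have "\<iota> e \<in> P"
      using True by (simp add: P fsection_def)
    ultimately show False
      by (simp add: P_iff)
  next
    case False
    then have "(f, \<iota> e) \<in> S"
      using QS(3) by simp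
    then obtain h where "branch e (join no_oracle w) h"
      using e[of w no_oracle] w by auto
    from branch_not_emb[OF this wo] have "\<iota> e \<in> P"
      by (simp add: P_iff w(3))
    with False show False
      by (simp add: P fsection_def)
  qed
qed

theorem theorem6:
  fixes f :: "nat \<Rightarrow> nat"
  shows "(hyperlow f \<longleftrightarrow> strongly_relativizes TYPE(nat \<Rightarrow> nat) f) \<and>
         (strongly_relativizes TYPE(nat \<Rightarrow> nat) f \<longleftrightarrow> strongly_relativizes_at f nat_space) \<and>
         (hyperlow f \<longrightarrow> strongly_relativizes TYPE('a) f)"
proof -
  have "strongly_relativizes_at f nat_space" if "hyperlow f"
    using hyperlow_strongly_relativizes[OF that, where 'a = nat] rec_presented_discrete[of "id :: nat \<Rightarrow> nat"]
    unfolding strongly_relativizes_def nat_space_discrete by simp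
  moreover have "hyperlow f" if "strongly_relativizes_at f nat_space"
    using strongly_relativizes_imp_hyperlow[of id f] that by (simp add: nat_space_discrete)
  moreover have "hyperlow f" if "strongly_relativizes TYPE(nat \<Rightarrow> nat) f"
  proof (rule strongly_relativizes_imp_hyperlow)
    \<comment> \<open>Constant functions place a copy of the natural numbers among the spaces over
      \<open>nat \<Rightarrow> nat\<close>.\<close>
    show inj: "inj (\<lambda>(n :: nat) (_ :: nat). n)"
      by (rule injI) (drule fun_cong, assumption)
    show "strongly_relativizes_at f (discrete_space (\<lambda>(n :: nat) (_ :: nat). n))"
      using that rec_presented_discrete[OF inj] by (simp add: strongly_relativizes_def)
  qed
  moreover have "strongly_relativizes TYPE(nat \<Rightarrow> nat) f" if "hyperlow f"
    using that by (rule hyperlow_strongly_relativizes)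
  moreover have "strongly_relativizes TYPE('a) f" if "hyperlow f"
    using that by (rule hyperlow_strongly_relativizes)
  ultimately show ?thesis
    by argo
qed

end
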